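(* For every $n\ge1$ there exist bijections $\phi_{B_n}:\mathcal{D}_{B_n}\to\operatorname{rev}(NC_{B_n})$ and $\psi_{B_n}:\mathcal{D}_{B_n}\to\operatorname{Sort}_{B_n}$ such that for all $D\in\mathcal{D}_{B_n}$, $$\operatorname{area}(D)=\operatorname{inv}_B(\phi_{B_n}(D))=\operatorname{inv}_B(\psi_{B_n}(D)),$$ $$2n^2-\operatorname{fmaj}(D)=\operatorname{fmaj}(\phi_{B_n}(D))+\operatorname{ifmaj}(\phi_{B_n}(D))=\operatorname{fmaj}(\psi_{B_n}(D))+\operatorname{ifmaj}(\psi_{B_n}(D)).$$
   Context: **Type $B_n$ Dyck paths.** $\mathcal{D}_{B_n}$ is the set of lattice paths with $2n$ unit steps, each a north or an east step, starting at $(0,0)$ and never going below the diagonal $x=y$ (the endpoint is otherwise arbitrary). For integers $i,j$ let $b_{ij}=\{(x,y)\in\mathbb{R}^2:i<x<i+1,\ j<y<j+1\}$. $\operatorname{area}(D)$ is the number of boxes $b_{ij}$ lying below (to the lower right of) $D$ with $0\le i<j<2n-i$. (If column $i$ is crossed by an east step of $D$ at height $h$, then $b_{ij}$ is below $D$ iff $j<h$; if $i$ is at least the number of east steps of $D$, all boxes $b_{ij}$ with $i<j<2n-i$ are counted.) Let $\operatorname{neg}(D)$ be the number of east steps of $D$. $\operatorname{fDes}(D)$ is the set of $1\le i<2n$ such that the $i$-th step is east and the $(i+1)$-st step is north, together with $2n$ if the $2n$-th step is east. $\operatorname{fmaj}(D)=2\bigl(\operatorname{neg}(D)+\sum_{i\in\operatorname{fDes}(D)}(2n-i)\bigr)$.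 **Signed permutations.** $B_n$ is the group of bijections $\sigma$ of $\{\pm1,\dots,\pm n\}$ with $\sigma_{-i}=-\sigma_i$, written $\sigma=[\sigma_1,\dots,\sigma_n]$. Let $\operatorname{neg}(\sigma)=|\{1\le i\le n:\sigma_i<0\}|$; with $\sigma_0:=0$, $\operatorname{fDes}(\sigma)=\{0\le i<n:\sigma_i>\sigma_{i+1}\}$ (usual order of integers); $\operatorname{fmaj}(\sigma)=2\sum_{i\in\operatorname{fDes}(\sigma)}i+\operatorname{neg}(\sigma)$; $\operatorname{ifmaj}(\sigma)=\operatorname{fmaj}(\sigma^{-1})$. Let $s_0=(1,-1)$ interchange $1$ and $-1$, and for $1\le i<n$ let $s_i$ interchange $i,i+1$ (and $-i,-(i+1)$). $\operatorname{inv}_B(\sigma)$ is the minimal $k$ such that $\sigma$ is a product of $k$ elements of $\{s_0,\dots,s_{n-1}\}$. **Reverse noncrossing partitions.** A set partition of type $B_n$ is a set partition of $\{\pm1,\dots,\pm n\}$ such that $B$ is a block iff $-B$ is. It is sent to the signed permutation whose cycles are its blocks written in increasing order with respect to the order $-1<-2<\dots<-n<1<2<\dots<n$. A set partition of a totally ordered set is noncrossing if there are no $a<b<c<d$ with $a,c$ in one block and $b,d$ in another. $NC_{B_n}\subseteq B_n$ is the set of signed permutations coming from the type $B_n$ set partitions that are noncrossing with respect to the order $-1<-2<\dots<-n<1<2<\dots<n$. The involution $\operatorname{rev}$ on $B_n$ reverses the order of the negative entries in the one-line notation, keeping the set of their positions and all positive entries fixed (e.g. $\operatorname{rev}([2,-4,3,-1])=[2,-1,3,-4]$),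 and $\operatorname{rev}(NC_{B_n})=\{\operatorname{rev}(\sigma):\sigma\in NC_{B_n}\}$; equivalently, these are the signed permutations coming (by the same embedding) from the type $B_n$ set partitions that are noncrossing with respect to the standard order $-n<\dots<-1<1<\dots<n$. **Sortable elements.** $\operatorname{Sort}_{B_n}\subseteq B_n$ is the set of signed permutations having a reduced expression (i.e. a product of $\operatorname{inv}_B(\sigma)$ generators) of the form $X_1X_2\cdots X_n$, where each $X_\ell$ is a (possibly empty) subword of $s_{n-1}\cdots s_1s_0$ and every generator occurring in $X_{\ell+1}$ also occurs in $X_\ell$. *)

theory Defs
  imports
    "HOL-Combinatorics.Cycles"
    "HOL-Library.Disjoint_Sets"
    "HOL-Library.Sublist"
begin

section \<open>Dyck paths of type B\<close>

datatype step = North | East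

definition dyck_paths :: "nat \<Rightarrow> step list set" where
  "dyck_paths n = {D. length D = 2 * n \<and>
     (\<forall>k \<le> length D. count_list (take k D) East \<le> count_list (take k D) North)}"

definition path_neg :: "step list \<Rightarrow> nat" where
  "path_neg D = count_list D East"

text \<open>The box with lower left corner \<open>(i, j)\<close> lies below the path. The step \<open>D ! k\<close> starts at the
  point whose coordinates are the numbers of east and of north steps in \<open>take k D\<close>.\<close>

definition box_below :: "step list \<Rightarrow> nat \<Rightarrow> nat \<Rightarrow> bool" where
  "box_below D i j \<longleftrightarrow>
     path_neg D \<le> i \<or>
     (\<exists>k < length D. D ! k = East \<and> count_list (take k D) East = i \<and>
        j < count_list (take k D) North)"

definition area :: "nat \<Rightarrow> step list \<Rightarrow> nat" where
  "area n D = card {(i, j). i < j \<and> i + j < 2 * n \<and> box_below D i j}"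

text \<open>Steps are numbered from 1, so the \<open>i\<close>-th step is \<open>D ! (i - 1)\<close>.\<close>

definition path_fDes :: "nat \<Rightarrow> step list \<Rightarrow> nat set" where
  "path_fDes n D =
     {i. 1 \<le> i \<and> i < 2 * n \<and> D ! (i - 1) = East \<and> D ! i = North} \<union>
     {i. i = 2 * n \<and> D ! (i - 1) = East}"

definition path_fmaj :: "nat \<Rightarrow> step list \<Rightarrow> nat" where
  "path_fmaj n D = 2 * (path_neg D + (\<Sum>i\<in>path_fDes n D. 2 * n - i))"


section \<open>Signed permutations\<close>

definition signed_range :: "nat \<Rightarrow> int set" where
  "signed_range n = {- int n..int n} - {0}"

text \<open>Signed permutations are functions on all integers that are the identity outside
  \<open>{\<plusminus>1, \<dots>, \<plusminus>n}\<close>. In particular \<open>\<sigma> 0 = 0\<close>, which is the convention used in \<open>fDes\<close>. Products are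
  compositions of functions.\<close>

definition signed_perms :: "nat \<Rightarrow> (int \<Rightarrow> int) set" where
  "signed_perms n = {\<sigma>. \<sigma> permutes signed_range n \<and> (\<forall>i. \<sigma> (- i) = - \<sigma> i)}"

definition neg :: "nat \<Rightarrow> (int \<Rightarrow> int) \<Rightarrow> nat" where
  "neg n \<sigma> = card {i \<in> {1..n}. \<sigma> (int i) < 0}"

definition fDes :: "nat \<Rightarrow> (int \<Rightarrow> int) \<Rightarrow> nat set" where
  "fDes n \<sigma> = {i. i < n \<and> \<sigma> (int i) > \<sigma> (int (i + 1))}"

definition fmaj :: "nat \<Rightarrow> (int \<Rightarrow> int) \<Rightarrow> nat" where
  "fmaj n \<sigma> = 2 * (\<Sum>i\<in>fDes n \<sigma>. i) + neg n \<sigma>"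

definition ifmaj :: "nat \<Rightarrow> (int \<Rightarrow> int) \<Rightarrow> nat" where
  "ifmaj n \<sigma> = fmaj n (inv \<sigma>)"

definition gen :: "nat \<Rightarrow> int \<Rightarrow> int" where
  "gen i = (if i = 0 then transpose 1 (- 1)
     else transpose (int i) (int (i + 1)) \<circ> transpose (- int i) (- int (i + 1)))"

definition word_prod :: "nat list \<Rightarrow> int \<Rightarrow> int" where
  "word_prod w = foldr (\<lambda>i \<tau>. gen i \<circ> \<tau>) w id"

definition inv_B :: "nat \<Rightarrow> (int \<Rightarrow> int) \<Rightarrow> nat" where
  "inv_B n \<sigma> = (LEAST k. \<exists>w. length w = k \<and> set w \<subseteq> {..<n} \<and> word_prod w = \<sigma>)"


section \<open>Reverse noncrossing partitions\<close>

definition partition_B :: "nat \<Rightarrow> int set set \<Rightarrow> bool" where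
  "partition_B n P \<longleftrightarrow>
     partition_on (signed_range n) P \<and> (\<forall>B. B \<in> P \<longleftrightarrow> uminus ` B \<in> P)"

text \<open>The order \<open>-1 < -2 < \<dots> < -n < 1 < 2 < \<dots> < n\<close>.\<close>

definition less_B :: "int \<Rightarrow> int \<Rightarrow> bool" where
  "less_B a b \<longleftrightarrow> (a < 0 \<and> 0 < b) \<or> (a < 0 \<and> b < 0 \<and> b < a) \<or> (0 < a \<and> a < b)"

definition noncrossing :: "(int \<Rightarrow> int \<Rightarrow> bool) \<Rightarrow> int set set \<Rightarrow> bool" where
  "noncrossing lt P \<longleftrightarrow>
     \<not> (\<exists>a b c d. lt a b \<and> lt b c \<and> lt c d \<and>
          (\<exists>B\<in>P. \<exists>C\<in>P. B \<noteq> C \<and> a \<in> B \<and> c \<in> B \<and> b \<in> C \<and> d \<in> C))"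

text \<open>The cycles of \<open>\<sigma>\<close> on \<open>{\<plusminus>1, \<dots>, \<plusminus>n}\<close> are the blocks of \<open>P\<close>, each written in increasing order
  with respect to \<open>less_B\<close>. This determines \<open>\<sigma>\<close>, since \<open>\<sigma>\<close> is the identity elsewhere.\<close>

definition cycles_of_blocks :: "int set set \<Rightarrow> (int \<Rightarrow> int) \<Rightarrow> bool" where
  "cycles_of_blocks P \<sigma> \<longleftrightarrow>
     (\<forall>B\<in>P. \<exists>cs. set cs = B \<and> sorted_wrt less_B cs \<and> (\<forall>a\<in>B. \<sigma> a = cycle_of_list cs a))"

definition NC_B :: "nat \<Rightarrow> (int \<Rightarrow> int) set" where
  "NC_B n = {\<sigma> \<in> signed_perms n.
     \<exists>P. partition_B n P \<and> noncrossing less_B P \<and> cycles_of_blocks P \<sigma>}"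

definition neg_positions :: "nat \<Rightarrow> (int \<Rightarrow> int) \<Rightarrow> int list" where
  "neg_positions n \<sigma> = filter (\<lambda>i. \<sigma> i < 0) [1..int n]"

text \<open>The one-line notation of \<open>rev_B n \<sigma>\<close>: the \<open>k\<close>-th negative position from the left receives the
  \<open>k\<close>-th negative entry from the right.\<close>

definition rev_one_line :: "nat \<Rightarrow> (int \<Rightarrow> int) \<Rightarrow> int \<Rightarrow> int" where
  "rev_one_line n \<sigma> i =
     (case map_of (zip (neg_positions n \<sigma>) (map \<sigma> (rev (neg_positions n \<sigma>)))) i of
        None \<Rightarrow> \<sigma> i | Some v \<Rightarrow> v)"

definition rev_B :: "nat \<Rightarrow> (int \<Rightarrow> int) \<Rightarrow> int \<Rightarrow> int" where
  "rev_B n \<sigma> i = (if i < 0 then - rev_one_line n \<sigma> (- i) else rev_one_line n \<sigma> i)"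


section \<open>Sortable elements\<close>

text \<open>\<open>Xs ! l\<close> is the factor with index \<open>l + 1\<close>, and \<open>rev [0..<n]\<close> is the word
  \<open>s\<^sub>n\<^sub>-\<^sub>1 \<dots> s\<^sub>1 s\<^sub>0\<close>.\<close>

definition Sort_B :: "nat \<Rightarrow> (int \<Rightarrow> int) set" where
  "Sort_B n = {\<sigma> \<in> signed_perms n.
     \<exists>Xs. length Xs = n \<and>
       (\<forall>X\<in>set Xs. subseq X (rev [0..<n])) \<and>
       (\<forall>l. Suc l < n \<longrightarrow> set (Xs ! Suc l) \<subseteq> set (Xs ! l)) \<and>
       word_prod (concat Xs) = \<sigma> \<and> length (concat Xs) = inv_B n \<sigma>}"

end

theory Submission
  imports Defs "HOL-Combinatorics.Orbits"
begin

text \<open>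
  All three sets grow by the same recursion on \<open>n\<close>, and this recursion determines the joint
  distribution of the statistics. An object of size \<open>n\<close> carries a label \<open>l\<close> with \<open>0 \<le> l \<le> 2n\<close>. For
  each \<open>t\<close> with \<open>l \<le> t \<le> 2n\<close> it has one child of size \<open>n + 1\<close>. The label of this child is \<open>t + 1\<close>, its
  area (or length) has grown by \<open>2n - t\<close>, and a second statistic has grown by \<open>t\<close> if \<open>l < t\<close> and not
  at all if \<open>l = t\<close>. Exactly one object of each size is not a child, and it has label \<open>0\<close>: the path with north steps only,
  and the signed permutation \<open>[-1, \<dots>, -n]\<close>. Two families that grow in this way are related by a
  bijection that respects everything (\<open>growth_families_equidistributed\<close>).

  For a Dyck path the label is the number of steps from the first east step to the end, and a child
  arises by inserting a north step and an east step into the initial run of north steps, with \<open>t\<close>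
  steps after them. The second statistic is the sum of \<open>2n - i\<close> over the valleys
  (\<open>path_growth_family\<close>).

  For signed permutations a child arises by inserting the entry \<open>q + 1\<close> at position \<open>p + 1\<close>, where
  \<open>p + q = t\<close>, and renumbering the other positions and values. If all entries to the right of the
  new one are smaller, the length grows by \<open>2n - (p + q)\<close>, whichever way \<open>t\<close> is split into \<open>p\<close> and
  \<open>q\<close>; the second statistic is the sum of the ascent positions of the permutation and of its inverse,
  and the only new ascents can be \<open>p\<close> and \<open>q\<close> (\<open>stats_insert_entry\<close>). Reversed noncrossing partitions
  and sortable elements differ only in the splitting. Splitting \<open>t\<close> as evenly as possible gives the
  reversed noncrossing partitions (\<open>nested_growth_family\<close>, \<open>rev_NC_B_eq\<close>): a position \<open>x\<close> corresponds
  to the steps \<open>2x - 1\<close> and \<open>2x\<close> of a path, which tell whether \<open>x\<close> is the least and whether it is the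
  greatest element of its block. Splitting \<open>t\<close> as unevenly as possible gives the inverses of the
  sortable elements (\<open>avoiding_growth_family\<close>, \<open>Sort_B_eq\<close>), which are characterised by the avoidance
  of a pattern. Length and the sum of both major indices do not change under inversion.

  Finally, descents and ascents together exhaust \<open>0, \<dots>, n - 1\<close>, so that \<open>fmaj\<close> and \<open>ifmaj\<close> are
  determined by the sum of the ascent positions and by the number of negative entries
  (\<open>fmaj_plus_ifmaj\<close>). The latter is \<open>n\<close> minus the number of insertions, which for the path is the
  number of east steps.
\<close>

section \<open>Families grown by the same recursion\<close>

text \<open>The statistics are \<open>A\<close> (area or length), \<open>M\<close> (valleys or ascents) and \<open>C\<close> (the number of growth
steps since the root). A growth step is recovered from its result because the label of a child
records \<open>t\<close>.\<close>

locale growth_family =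
  fixes X :: "nat \<Rightarrow> 'a set"
    and lab :: "nat \<Rightarrow> 'a \<Rightarrow> nat"
    and base :: "nat \<Rightarrow> 'a"
    and grow :: "nat \<Rightarrow> nat \<Rightarrow> 'a \<Rightarrow> 'a"
    and A M C :: "nat \<Rightarrow> 'a \<Rightarrow> nat"
  assumes zero: "X 0 = {base 0}"
    and base_in: "base n \<in> X n"
    and lab_base: "lab n (base n) = 0"
    and A_base: "A n (base n) = n\<^sup>2"
    and M_base: "M n (base n) = 0"
    and C_base: "C n (base n) = 0"
    and grow_in: "x \<in> X n \<Longrightarrow> lab n x \<le> t \<Longrightarrow> t \<le> 2 * n \<Longrightarrow> grow n t x \<in> X (Suc n)"
    and lab_grow: "x \<in> X n \<Longrightarrow> lab n x \<le> t \<Longrightarrow> t \<le> 2 * n \<Longrightarrow> lab (Suc n) (grow n t x) = Suc t"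
    and grow_inj: "x \<in> X n \<Longrightarrow> lab n x \<le> t \<Longrightarrow> y \<in> X n \<Longrightarrow> lab n y \<le> t \<Longrightarrow> t \<le> 2 * n \<Longrightarrow>
        grow n t x = grow n t y \<Longrightarrow> x = y"
    and grow_cover: "y \<in> X (Suc n) \<Longrightarrow>
        y = base (Suc n) \<or> (\<exists>x\<in>X n. \<exists>t. lab n x \<le> t \<and> t \<le> 2 * n \<and> y = grow n t x)"
    and A_grow: "x \<in> X n \<Longrightarrow> lab n x \<le> t \<Longrightarrow> t \<le> 2 * n \<Longrightarrow> A (Suc n) (grow n t x) = A n x + (2 * n - t)"
    and M_grow: "x \<in> X n \<Longrightarrow> lab n x \<le> t \<Longrightarrow> t \<le> 2 * n \<Longrightarrow>
        M (Suc n) (grow n t x) = M n x + (if lab n x < t then t else 0)"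
    and C_grow: "x \<in> X n \<Longrightarrow> lab n x \<le> t \<Longrightarrow> t \<le> 2 * n \<Longrightarrow> C (Suc n) (grow n t x) = Suc (C n x)"
begin

definition parent :: "nat \<Rightarrow> 'a \<Rightarrow> 'a" where
  "parent n y = (SOME x. x \<in> X n \<and> lab n x \<le> lab (Suc n) y - 1 \<and> y = grow n (lab (Suc n) y - 1) x)"

lemma parent_grow:
  assumes "x \<in> X n" "lab n x \<le> t" "t \<le> 2 * n"
  shows "parent n (grow n t x) = x"
proof -
  have *: "lab (Suc n) (grow n t x) - 1 = t" using lab_grow[OF assms] by simp
  show ?thesis unfolding parent_def *
    by (rule some_equality) (use assms grow_inj in blast)+
qed

lemma grow_neq_base:
  assumes "x \<in> X n" "lab n x \<le> t" "t \<le> 2 * n"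
  shows "grow n t x \<noteq> base (Suc n)"
  using lab_grow[OF assms] lab_base[of "Suc n"] by auto

end

theorem growth_families_equidistributed:
  assumes "growth_family X labX baseX growX AX MX CX"
    and "growth_family Y labY baseY growY AY MY CY"
  shows "\<exists>f. bij_betw f (X n) (Y n) \<and>
    (\<forall>x\<in>X n. labY n (f x) = labX n x \<and> AY n (f x) = AX n x \<and> MY n (f x) = MX n x \<and> CY n (f x) = CX n x)"
proof -
  interpret X: growth_family X labX baseX growX AX MX CX by fact
  interpret Y: growth_family Y labY baseY growY AY MY CY by fact
  show ?thesis
  proof (induction n)
    case 0
    show ?case
      by (rule exI[of _ "\<lambda>_. baseY 0"])
        (simp add: X.zero Y.zero X.lab_base Y.lab_base X.A_base Y.A_base X.M_base Y.M_base X.C_base Y.C_base bij_betw_def)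
  next
    case (Suc n)
    then obtain f where f: "bij_betw f (X n) (Y n)"
      and st: "\<And>x. x \<in> X n \<Longrightarrow> labY n (f x) = labX n x \<and> AY n (f x) = AX n x \<and> MY n (f x) = MX n x \<and> CY n (f x) = CX n x"
      by blast
    have fY: "f x \<in> Y n" if "x \<in> X n" for x using f that by (auto simp: bij_betw_def)
    \<comment> \<open>the bijection on size n is applied to the parent, and the same growth step follows\<close>
    define g where "g y = (if y = baseX (Suc n) then baseY (Suc n)
        else growY n (labX (Suc n) y - 1) (f (X.parent n y)))" for y
    have g_base: "g (baseX (Suc n)) = baseY (Suc n)" by (simp add: g_def)
    have g_grow: "g (growX n t x) = growY n t (f x)" if "x \<in> X n" "labX n x \<le> t" "t \<le> 2 * n" for x t
      using X.grow_neq_base[OF that] X.parent_grow[OF that] X.lab_grow[OF that] by (simp add: g_def)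
    have stats: "labY (Suc n) (g y) = labX (Suc n) y \<and> AY (Suc n) (g y) = AX (Suc n) y \<and>
        MY (Suc n) (g y) = MX (Suc n) y \<and> CY (Suc n) (g y) = CX (Suc n) y \<and> g y \<in> Y (Suc n)"
      if yX: "y \<in> X (Suc n)" for y
    proof (cases "y = baseX (Suc n)")
      case True
      then show ?thesis
        by (simp add: g_base X.lab_base Y.lab_base X.A_base Y.A_base X.M_base Y.M_base X.C_base Y.C_base Y.base_in)
    next
      case False
      then obtain x t where x: "x \<in> X n" "labX n x \<le> t" "t \<le> 2 * n" and y: "y = growX n t x"
        using X.grow_cover[OF yX] by blast
      have fx: "f x \<in> Y n" "labY n (f x) \<le> t" using fY st x by auto
      show ?thesis unfolding y g_grow[OF x]
        using st[OF x(1)] X.lab_grow[OF x] Y.lab_grow[OF fx x(3)] X.A_grow[OF x] Y.A_grow[OF fx x(3)]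
          X.M_grow[OF x] Y.M_grow[OF fx x(3)] X.C_grow[OF x] Y.C_grow[OF fx x(3)] Y.grow_in[OF fx x(3)]
        by simp
    qed
    have "inj_on g (X (Suc n))"
    proof (rule inj_onI)
      fix y z assume y: "y \<in> X (Suc n)" and z: "z \<in> X (Suc n)" and e: "g y = g z"
      have l: "labX (Suc n) y = labX (Suc n) z" using stats[OF y] stats[OF z] e by simp
      show "y = z"
      proof (cases "y = baseX (Suc n) \<or> z = baseX (Suc n)")
        case True
        then show ?thesis using l X.grow_cover[OF y] X.grow_cover[OF z] X.lab_grow X.lab_base
          by (metis nat.distinct(1))
      next
        case False
        then obtain x t where x: "x \<in> X n" "labX n x \<le> t" "t \<le> 2 * n" and y': "y = growX n t x"
          using X.grow_cover[OF y] by blast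
        obtain x' t' where x': "x' \<in> X n" "labX n x' \<le> t'" "t' \<le> 2 * n" and z': "z = growX n t' x'"
          using X.grow_cover[OF z] False by blast
        have t: "t' = t" using l X.lab_grow[OF x] X.lab_grow[OF x'] by (simp add: y' z')
        have "growY n t (f x) = growY n t (f x')" using e g_grow[OF x] g_grow[OF x'] by (simp add: y' z' t)
        then have "f x = f x'"
          using Y.grow_inj[of "f x" n t "f x'"] fY x x' st t by auto
        then have "x = x'" using f x(1) x'(1) by (auto simp: bij_betw_def inj_on_def)
        then show ?thesis by (simp add: y' z' t)
      qed
    qed
    moreover have "g ` X (Suc n) = Y (Suc n)"
    proof
      show "g ` X (Suc n) \<subseteq> Y (Suc n)" using stats by blast
      show "Y (Suc n) \<subseteq> g ` X (Suc n)"
      proof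
        fix z assume z: "z \<in> Y (Suc n)"
        show "z \<in> g ` X (Suc n)"
        proof (cases "z = baseY (Suc n)")
          case True
          then show ?thesis using g_base X.base_in by (metis imageI)
        next
          case False
          then obtain y t where y: "y \<in> Y n" "labY n y \<le> t" "t \<le> 2 * n" and z': "z = growY n t y"
            using Y.grow_cover[OF z] by blast
          obtain x where x: "x \<in> X n" "y = f x" using y(1) f by (auto simp: bij_betw_def)
          have "labX n x \<le> t" using st[OF x(1)] x y by simp
          then show ?thesis using g_grow[OF x(1) _ y(3)] X.grow_in[OF x(1) _ y(3)] z' x(2)
            by (metis imageI)
        qed
      qed
    qed
    ultimately have "bij_betw g (X (Suc n)) (Y (Suc n))" by (simp add: bij_betw_def)
    with stats show ?case by blast
  qed
qed

section \<open>Dyck paths\<close>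

fun nonneg_from :: "nat \<Rightarrow> step list \<Rightarrow> bool" where
  "nonneg_from h [] \<longleftrightarrow> True"
| "nonneg_from h (North # D) \<longleftrightarrow> nonneg_from (Suc h) D"
| "nonneg_from h (East # D) \<longleftrightarrow> 0 < h \<and> nonneg_from (h - 1) D"

text \<open>For a path that starts at height \<open>0\<close> this is the area, counted by antidiagonals.\<close>

fun half_heights :: "nat \<Rightarrow> step list \<Rightarrow> nat" where
  "half_heights h [] = 0"
| "half_heights h (North # D) = Suc h div 2 + half_heights (Suc h) D"
| "half_heights h (East # D) = (h - 1) div 2 + half_heights (h - 1) D"

text \<open>Steps are counted from the end of the path: the \<open>i\<close>-th of \<open>2n\<close> steps has \<open>2n - i\<close> steps after it. In
this form an east step at the very end contributes nothing, and a change near the beginning of the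
path does not affect the later valleys.\<close>

fun valley_sum :: "step list \<Rightarrow> nat" where
  "valley_sum [] = 0"
| "valley_sum (x # D) = (if x = East \<and> D \<noteq> [] \<and> hd D = North then length D else 0) + valley_sum D"

definition north_run :: "step list \<Rightarrow> nat" where
  "north_run D = length (takeWhile (\<lambda>x. x = North) D)"

lemma count_North: "count_list D North = length D - count_list D East"
proof -
  have "count_list D North + count_list D East = length D"
    by (induction D) (auto split: if_splits, metis step.exhaust)
  then show ?thesis by linarith
qed

lemma nonneg_from_iff:
  "nonneg_from h D \<longleftrightarrow> (\<forall>k\<le>length D. count_list (take k D) East \<le> h + count_list (take k D) North)"
proof (induction h D rule: nonneg_from.induct)
  case (2 h D)
  show ?case unfolding nonneg_from.simps 2
  proof safe
    fix k assume a: "\<forall>k\<le>length D. count_list (take k D) East \<le> Suc h + count_list (take k D) North"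
      and k: "k \<le> length (North # D)"
    show "count_list (take k (North # D)) East \<le> h + count_list (take k (North # D)) North"
      using a k by (cases k) auto
  next
    fix k assume a: "\<forall>k\<le>length (North # D). count_list (take k (North # D)) East \<le> h + count_list (take k (North # D)) North"
      and k: "k \<le> length D"
    show "count_list (take k D) East \<le> Suc h + count_list (take k D) North"
      using a[rule_format, of "Suc k"] k by auto
  qed
next
  case (3 h D)
  show ?case unfolding nonneg_from.simps 3
  proof safe
    fix k assume a: "\<forall>k\<le>length D. count_list (take k D) East \<le> h - 1 + count_list (take k D) North"
      and k: "k \<le> length (East # D)" and h: "0 < h"
    show "count_list (take k (East # D)) East \<le> h + count_list (take k (East # D)) North"
      using a[rule_format, of "k - 1"] k h by (cases k) auto
  next
    assume a: "\<forall>k\<le>length (East # D). count_list (take k (East # D)) East \<le> h + count_list (take k (East # D)) North"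
    show "0 < h" using a[rule_format, of 1] by simp
  next
    fix k assume a: "\<forall>k\<le>length (East # D). count_list (take k (East # D)) East \<le> h + count_list (take k (East # D)) North"
      and k: "k \<le> length D"
    show "count_list (take k D) East \<le> h - 1 + count_list (take k D) North"
      using a[rule_format, of "Suc k"] a[rule_format, of 1] k by auto
  qed
qed simp

lemma dyck_paths_iff: "D \<in> dyck_paths n \<longleftrightarrow> length D = 2 * n \<and> nonneg_from 0 D"
  by (auto simp: dyck_paths_def nonneg_from_iff)

text \<open>The point that is reached after \<open>i + j + 1\<close> steps lies on the antidiagonal through the centre of the
box, so the box is below the path iff this point is to the left of the centre.\<close>

lemma box_below_iff:
  assumes "i + j < length D"
  shows "box_below D i j \<longleftrightarrow> count_list (take (i + j + 1) D) East \<le> i"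
proof -
  have east_step: "count_list (take (Suc k) D) East = count_list (take k D) East + (if D ! k = East then 1 else 0)"
    if "k < length D" for k
    using that by (simp add: take_Suc_conv_app_nth)
  have mono: "count_list (take k D) East \<le> count_list (take l D) East" if "k \<le> l" for k l
  proof -
    have "take l D = take k D @ take (l - k) (drop k D)" using that by (metis le_add_diff_inverse take_add)
    then show ?thesis by simp
  qed
  have north: "count_list (take k D) North = k - count_list (take k D) East" if "k \<le> length D" for k
    using that by (simp add: count_North min_def)
  show ?thesis
  proof
    assume "box_below D i j"
    then consider "path_neg D \<le> i" | k where "k < length D" "D ! k = East" "count_list (take k D) East = i"
        "j < count_list (take k D) North" unfolding box_below_def by blast
    then show "count_list (take (i + j + 1) D) East \<le> i"
    proof cases
      case 1
      then show ?thesis using mono[of "i + j + 1" "length D"] assms by (auto simp: path_neg_def)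
    next
      case 2
      then have "i + j + 1 \<le> k" using north[of k] by linarith
      then show ?thesis using mono[of "i + j + 1" k] 2 by simp
    qed
  next
    assume le: "count_list (take (i + j + 1) D) East \<le> i"
    show "box_below D i j"
    proof (cases "path_neg D \<le> i")
      case False
      define k where "k = (LEAST k. i < count_list (take (Suc k) D) East)"
      have ex: "i < count_list (take (Suc (length D - 1)) D) East"
        using False assms by (simp add: path_neg_def)
      have k: "i < count_list (take (Suc k) D) East" unfolding k_def by (rule LeastI, rule ex)
      have kl: "k \<le> length D - 1" unfolding k_def by (rule Least_le, rule ex)
      have klt: "k < length D" using kl assms by linarith
      have k': "count_list (take k D) East \<le> i"
      proof (cases k)
        case (Suc m)
        then have "\<not> i < count_list (take (Suc m) D) East"
          using not_less_Least[of m "\<lambda>k. i < count_list (take (Suc k) D) East"] unfolding k_def by simp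
        then show ?thesis using Suc by simp
      qed simp
      have E: "D ! k = East" and c: "count_list (take k D) East = i"
        using east_step[OF klt] k k' by (auto split: if_splits)
      have "\<not> Suc k \<le> i + j + 1" using mono[of "Suc k" "i + j + 1"] k le by linarith
      then have "j < count_list (take k D) North" using north[of k] klt c by linarith
      then show ?thesis using klt E c unfolding box_below_def by blast
    qed (simp add: box_below_def)
  qed
qed

lemma half_heights_eq_sum:
  assumes "nonneg_from h D"
  shows "half_heights h D = (\<Sum>t<length D. (h + Suc t - 2 * count_list (take (Suc t) D) East) div 2)"
  using assms
proof (induction h D rule: half_heights.induct)
  case (3 h D)
  have "(h + Suc (Suc t) - 2 * Suc (count_list (take (Suc t) D) East)) div 2 =
      (h - 1 + Suc t - 2 * count_list (take (Suc t) D) East) div 2" for t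
    using 3(2) by (intro arg_cong[where f = "\<lambda>x. x div 2"]) auto
  then show ?case using 3 by (simp add: sum.lessThan_Suc_shift del: sum.lessThan_Suc)
qed (simp_all add: sum.lessThan_Suc_shift del: sum.lessThan_Suc)

text \<open>The boxes are counted by antidiagonals. On the antidiagonal \<open>i + j = t\<close> the boxes below the path are
those between the path and the main diagonal, and their number is half the height of the path after
\<open>t + 1\<close> steps.\<close>

lemma area_eq_half_heights:
  assumes "D \<in> dyck_paths n"
  shows "area n D = half_heights 0 D"
proof -
  have len: "length D = 2 * n" and nn: "nonneg_from 0 D" using assms by (auto simp: dyck_paths_iff)
  let ?e = "\<lambda>t. count_list (take (Suc t) D) East"
  have "{(i, j). i < j \<and> i + j < 2 * n \<and> box_below D i j} =
      (\<lambda>(t, i). (i, t - i)) ` (SIGMA t:{..<2 * n}. {?e t..<Suc t div 2})" (is "?B = ?f ` ?S")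
  proof (intro set_eqI iffI)
    fix p assume "p \<in> ?B"
    then obtain i j where p: "p = (i, j)" and ij: "i < j" "i + j < 2 * n" "box_below D i j" by blast
    have "?e (i + j) \<le> i" using ij box_below_iff[of i j D] len by simp
    then have "(i + j, i) \<in> ?S" using ij by auto
    then show "p \<in> ?f ` ?S" unfolding p by force
  next
    fix p assume "p \<in> ?f ` ?S"
    then obtain t i where p: "p = (i, t - i)" and t: "t < 2 * n" "?e t \<le> i" "i < Suc t div 2" by auto
    have i: "i < t - i" "i + (t - i) = t" using t by auto
    then have "box_below D i (t - i)" using box_below_iff[of i "t - i" D] len t by simp
    then show "p \<in> ?B" using i t p by simp
  qed
  moreover have "inj_on ?f ?S"
  proof (rule inj_onI, clarsimp)
    fix t t' i assume "i < Suc t div 2" "i < Suc t' div 2" "t - i = t' - i"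
    then show "t = t'" by linarith
  qed
  ultimately have "area n D = card ?S" by (simp add: area_def card_image)
  also have "\<dots> = (\<Sum>t<2 * n. Suc t div 2 - ?e t)" by simp
  also have "\<dots> = (\<Sum>t<2 * n. (0 + Suc t - 2 * ?e t) div 2)"
    by (rule sum.cong) auto
  also have "\<dots> = half_heights 0 D" using half_heights_eq_sum[OF nn] len by simp
  finally show ?thesis .
qed

text \<open>The index \<open>2n\<close> that \<open>path_fDes\<close> contains for a final east step has weight \<open>0\<close>.\<close>

lemma valley_sum_eq:
  assumes "length D = 2 * n"
  shows "(\<Sum>i\<in>path_fDes n D. 2 * n - i) = valley_sum D"
proof -
  have gen: "valley_sum D = (\<Sum>i<length D - 1. if D ! i = East \<and> D ! Suc i = North then length D - Suc i else 0)" for D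
  proof (induction D)
    case (Cons x D)
    show ?case
    proof (cases D)
      case (Cons y D')
      then have l: "length (x # D) - 1 = Suc (length D - 1)" by simp
      show ?thesis unfolding l sum.lessThan_Suc_shift using Cons.IH Cons by (simp add: hd_conv_nth cong: if_cong)
    qed simp
  qed simp
  let ?V = "{i. 1 \<le> i \<and> i < 2 * n \<and> D ! (i - 1) = East \<and> D ! i = North}"
  let ?L = "{i. i = 2 * n \<and> D ! (i - 1) = East}"
  have fV: "finite ?V" by (rule finite_subset[of _ "{..<2 * n}"]) auto
  have fL: "finite ?L" by simp
  have "(\<Sum>i\<in>path_fDes n D. 2 * n - i) = (\<Sum>i\<in>?V. 2 * n - i) + (\<Sum>i\<in>?L. 2 * n - i)"
    unfolding path_fDes_def by (rule sum.union_disjoint[OF fV fL]) auto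
  also have "(\<Sum>i\<in>?L. 2 * n - i) = 0" by (rule sum.neutral) auto
  also have "(\<Sum>i\<in>?V. 2 * n - i) = (\<Sum>i\<in>{i. i < 2 * n - 1 \<and> D ! i = East \<and> D ! Suc i = North}. 2 * n - Suc i)"
    by (rule sum.reindex_bij_witness[of _ Suc "\<lambda>i. i - 1"]) auto
  also have "\<dots> = (\<Sum>i<2 * n - 1. if D ! i = East \<and> D ! Suc i = North then 2 * n - Suc i else 0)"
  proof -
    have eq: "{i. i < 2 * n - 1 \<and> D ! i = East \<and> D ! Suc i = North} =
        {i \<in> {..<2 * n - 1}. D ! i = East \<and> D ! Suc i = North}" by auto
    show ?thesis unfolding eq by (rule sum.inter_filter) simp
  qed
  also have "\<dots> = valley_sum D" using gen[of D] unfolding assms by simp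
  finally show ?thesis by simp
qed

lemma nonneg_from_norths: "nonneg_from h (replicate m North @ D) \<longleftrightarrow> nonneg_from (h + m) D"
  by (induction m arbitrary: h) auto

lemma half_heights_norths:
  "half_heights h (replicate m North @ D) = (\<Sum>i<m. (h + Suc i) div 2) + half_heights (h + m) D"
  by (induction m arbitrary: h) (auto simp: sum.lessThan_Suc_shift simp del: sum.lessThan_Suc)

lemma valley_sum_norths: "valley_sum (replicate m North @ D) = valley_sum D"
  by (induction m) auto

lemma count_East_norths: "count_list (replicate m North @ D) East = count_list D East"
  by (induction m) auto

lemma north_run_norths: "north_run (replicate m North @ D) = m + north_run D"
  by (induction m) (auto simp: north_run_def)

lemma north_run_decomp: "D = replicate (north_run D) North @ drop (north_run D) D"
  by (induction D) (auto simp: north_run_def)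

lemma hd_after_north_run: "drop (north_run D) D \<noteq> [] \<Longrightarrow> hd (drop (north_run D) D) = East"
  by (induction D) (auto simp: north_run_def, metis step.exhaust)


definition path_lab :: "nat \<Rightarrow> step list \<Rightarrow> nat" where
  "path_lab n D = 2 * n - north_run D"

text \<open>The last \<open>t\<close> steps of the path are kept. Since \<open>t\<close> is at least the label, the steps before them are
north steps only.\<close>

definition path_grow :: "nat \<Rightarrow> nat \<Rightarrow> step list \<Rightarrow> step list" where
  "path_grow n t D = replicate (2 * n - t + 1) North @ East # drop (2 * n - t) D"

text \<open>What precedes the last \<open>t\<close> steps is part of the initial run of north steps.\<close>

lemma path_split:
  assumes "length D = 2 * n" "path_lab n D \<le> t" "t \<le> 2 * n"
  shows "D = replicate (2 * n - t) North @ drop (2 * n - t) D"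
proof -
  have "2 * n - t \<le> north_run D" using assms by (simp add: path_lab_def)
  then have "take (2 * n - t) D = take (2 * n - t) (replicate (north_run D) North)"
    by (metis append_take_drop_id length_replicate north_run_decomp take_append diff_is_0_eq take_0 append_Nil2)
  then show ?thesis using \<open>2 * n - t \<le> north_run D\<close>
    by (metis append_take_drop_id min.absorb1 take_replicate)
qed

lemma north_run_le: "north_run D \<le> length D"
  by (simp add: north_run_def length_takeWhile_le)

lemma half_sum_square: "(\<Sum>i<2 * n. Suc i div 2) = n\<^sup>2"
  by (induction n) (auto simp: power2_eq_square)

lemma path_growth_family:
  "growth_family dyck_paths path_lab (\<lambda>n. replicate (2 * n) North) path_grow
     area (\<lambda>n D. \<Sum>i\<in>path_fDes n D. 2 * n - i) (\<lambda>n. path_neg)"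
proof
  show "dyck_paths 0 = {replicate (2 * 0) North}" by (auto simp: dyck_paths_iff)
next
  fix n
  let ?b = "replicate (2 * n) North"
  show b: "?b \<in> dyck_paths n" using nonneg_from_norths[of 0 "2 * n" "[]"] by (simp add: dyck_paths_iff)
  show "path_lab n ?b = 0" using north_run_norths[of "2 * n" "[]"] by (simp add: path_lab_def)
  show "area n ?b = n\<^sup>2"
    using area_eq_half_heights[OF b] half_heights_norths[of 0 "2 * n" "[]"] half_sum_square[of n] by simp
  show "(\<Sum>i\<in>path_fDes n ?b. 2 * n - i) = 0"
    using valley_sum_eq[of ?b n] valley_sum_norths[of "2 * n" "[]"] by simp
  show "path_neg ?b = 0" using count_East_norths[of "2 * n" "[]"] by (simp add: path_neg_def)
next
  fix D n t assume D: "D \<in> dyck_paths n" and t: "path_lab n D \<le> t" "t \<le> 2 * n"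
  let ?c = "2 * n - t" and ?R = "drop (2 * n - t) D"
  have len: "length D = 2 * n" and nn: "nonneg_from 0 D" using D by (auto simp: dyck_paths_iff)
  have split: "D = replicate ?c North @ ?R" by (rule path_split[OF len t])
  have lR: "length ?R = t" using len t by simp
  have nnR: "nonneg_from ?c ?R" using nn nonneg_from_norths[of 0 ?c ?R] split by simp
  have G: "path_grow n t D = replicate (Suc ?c) North @ East # ?R" by (simp add: path_grow_def)
  have lenG: "length (path_grow n t D) = 2 * Suc n" unfolding G using lR t by simp
  show mem: "path_grow n t D \<in> dyck_paths (Suc n)"
    unfolding dyck_paths_iff using lenG nnR nonneg_from_norths[of 0 "Suc ?c" "East # ?R"] by (simp add: G)
  have "north_run (path_grow n t D) = Suc ?c"
    unfolding G north_run_norths by (simp add: north_run_def)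
  then show "path_lab (Suc n) (path_grow n t D) = Suc t" using t by (simp add: path_lab_def)
  \<comment> \<open>the new north step ends at height c + 1 and the new east step at height c, where c = 2n - t\<close>
  have "half_heights 0 (path_grow n t D) = half_heights 0 D + ?c"
  proof -
    have "half_heights 0 (path_grow n t D) = (\<Sum>i<?c. Suc i div 2) + Suc ?c div 2 + ?c div 2 + half_heights ?c ?R"
      unfolding G half_heights_norths by simp
    moreover have "half_heights 0 D = (\<Sum>i<?c. Suc i div 2) + half_heights ?c ?R"
      using half_heights_norths[of 0 ?c ?R] split by simp
    moreover have "Suc ?c div 2 + ?c div 2 = ?c" by presburger
    ultimately show ?thesis by linarith
  qed
  then show "area (Suc n) (path_grow n t D) = area n D + (2 * n - t)"
    using area_eq_half_heights[OF D] area_eq_half_heights[OF mem] by simp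
  show "path_neg (path_grow n t D) = Suc (path_neg D)"
    using split count_East_norths[of "Suc ?c" "East # ?R"] count_East_norths[of ?c ?R] by (simp add: path_neg_def G)
  \<comment> \<open>the new east step is followed by a north step unless it is put directly before the old first east step or at the very end\<close>
  have hd: "?R \<noteq> [] \<and> hd ?R = North \<longleftrightarrow> path_lab n D < t"
  proof (cases "path_lab n D < t")
    case True
    then have "?c < north_run D" "t > 0" using t by (auto simp: path_lab_def)
    moreover from this have "?R = replicate (north_run D - ?c) North @ drop (north_run D) D"
      using split north_run_decomp[of D] by (metis drop_append drop_replicate length_replicate drop_0 less_imp_le_nat diff_is_0_eq)
    ultimately show ?thesis using True by (cases "north_run D - ?c") auto
  next
    case False
    then have "?c = north_run D" using t north_run_le[of D] len by (simp add: path_lab_def)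
    then show ?thesis using False hd_after_north_run[of D] by auto
  qed
  have "valley_sum (path_grow n t D) = valley_sum D + (if path_lab n D < t then t else 0)"
    using valley_sum_norths[of "Suc ?c" "East # ?R"] valley_sum_norths[of ?c ?R] split hd lR by (auto simp: G)
  then show "(\<Sum>i\<in>path_fDes (Suc n) (path_grow n t D). 2 * Suc n - i) =
      (\<Sum>i\<in>path_fDes n D. 2 * n - i) + (if path_lab n D < t then t else 0)"
    using valley_sum_eq[OF len] valley_sum_eq[OF lenG] by simp
next
  fix n D t D' assume a: "D \<in> dyck_paths n" "path_lab n D \<le> t" "D' \<in> dyck_paths n" "path_lab n D' \<le> t" "t \<le> 2 * n"
    and e: "path_grow n t D = path_grow n t D'"
  have "drop (2 * n - t) D = drop (2 * n - t) D'" using e by (simp add: path_grow_def)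
  then show "D = D'" using path_split[of D n t] path_split[of D' n t] a by (simp add: dyck_paths_iff)
next
  fix n D assume D: "D \<in> dyck_paths (Suc n)"
  have len: "length D = 2 * Suc n" and nn: "nonneg_from 0 D" using D by (auto simp: dyck_paths_iff)
  show "D = replicate (2 * Suc n) North \<or>
      (\<exists>D'\<in>dyck_paths n. \<exists>t. path_lab n D' \<le> t \<and> t \<le> 2 * n \<and> D = path_grow n t D')"
  proof (cases "drop (north_run D) D")
    case Nil
    then have "D = replicate (2 * Suc n) North" using north_run_decomp[of D] len by (metis append_Nil2 length_replicate)
    then show ?thesis ..
  next
    case (Cons x R)
    have x: "x = East" using hd_after_north_run[of D] Cons by simp
    have dec: "D = replicate (north_run D) North @ East # R" using north_run_decomp[of D] Cons x by simp
    have "nonneg_from (north_run D) (East # R)" using nn nonneg_from_norths[of 0 "north_run D" "East # R"] dec by simp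
    then obtain c where c: "north_run D = Suc c" and R: "nonneg_from c R" by (cases "north_run D") auto
    define t where "t = length R"
    have ct: "c + t = 2 * n" using len arg_cong[OF dec, of length] c t_def by simp
    let ?D' = "replicate c North @ R"
    have "?D' \<in> dyck_paths n" unfolding dyck_paths_iff using ct R nonneg_from_norths[of 0 c R] by (simp add: t_def)
    moreover have "path_lab n ?D' \<le> t" using ct by (simp add: path_lab_def north_run_norths)
    moreover have "D = path_grow n t ?D'"
      using dec c ct by (simp add: path_grow_def)
    ultimately show ?thesis using ct by (metis le_add2)
  qed
qed

section \<open>Signed permutations and their length\<close>

lemma mem_signed_range: "x \<in> signed_range n \<longleftrightarrow> x \<noteq> 0 \<and> \<bar>x\<bar> \<le> int n"
  by (auto simp: signed_range_def)

lemma finite_signed_range [simp]: "finite (signed_range n)"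
  by (simp add: signed_range_def)

lemma signed_perms_iff:
  "\<sigma> \<in> signed_perms n \<longleftrightarrow> bij \<sigma> \<and> (\<forall>x. \<sigma> (- x) = - \<sigma> x) \<and> (\<forall>x. int n < x \<longrightarrow> \<sigma> x = x)"
proof
  assume "\<sigma> \<in> signed_perms n"
  then have p: "\<sigma> permutes signed_range n" and o: "\<forall>x. \<sigma> (- x) = - \<sigma> x" by (auto simp: signed_perms_def)
  have "\<sigma> x = x" if "int n < x" for x
    using permutes_not_in[OF p, of x] that by (auto simp: mem_signed_range)
  with o permutes_bij[OF p] show "bij \<sigma> \<and> (\<forall>x. \<sigma> (- x) = - \<sigma> x) \<and> (\<forall>x. int n < x \<longrightarrow> \<sigma> x = x)" by blast
next
  assume a: "bij \<sigma> \<and> (\<forall>x. \<sigma> (- x) = - \<sigma> x) \<and> (\<forall>x. int n < x \<longrightarrow> \<sigma> x = x)"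
  have "\<sigma> x = x" if "x \<notin> signed_range n" for x
  proof -
    from that consider "x = 0" | "int n < x" | "int n < - x" by (force simp: mem_signed_range)
    then show ?thesis
    proof cases
      case 1
      then show ?thesis using a by (metis minus_zero neg_equal_zero)
    next
      case 2
      then show ?thesis using a by blast
    next
      case 3
      then have "\<sigma> (- x) = - x" using a by blast
      then show ?thesis using a by simp
    qed
  qed
  then have "\<sigma> permutes signed_range n"
    using a by (auto simp: permutes_def bij_iff)
  then show "\<sigma> \<in> signed_perms n" using a by (simp add: signed_perms_def)
qed

context
  fixes \<sigma> :: "int \<Rightarrow> int" and n :: nat
  assumes \<sigma>: "\<sigma> \<in> signed_perms n"
begin

lemma sp_minus: "\<sigma> (- x) = - \<sigma> x"
  using \<sigma> by (simp add: signed_perms_iff)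

lemma sp_bij: "bij \<sigma>"
  using \<sigma> by (simp add: signed_perms_iff)

lemma sp_eq: "\<sigma> x = \<sigma> y \<longleftrightarrow> x = y"
  using sp_bij by (metis bij_pointE)

lemma sp_eq_minus: "\<sigma> x = - \<sigma> y \<longleftrightarrow> x = - y"
  using sp_eq[of x "- y"] by (simp add: sp_minus)

lemma sp_zero: "\<sigma> 0 = 0"
  using sp_minus[of 0] by simp

lemma sp_eq_zero: "\<sigma> x = 0 \<longleftrightarrow> x = 0"
  using sp_eq[of x 0] by (simp add: sp_zero)

lemma sp_fix: "int n < \<bar>x\<bar> \<Longrightarrow> \<sigma> x = x"
  using \<sigma> sp_minus[of x] by (auto simp: signed_perms_iff abs_if split: if_splits)

lemma sp_range: "\<sigma> x \<in> signed_range n \<longleftrightarrow> x \<in> signed_range n"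
  using \<sigma> permutes_in_image[of \<sigma> "signed_range n" x] by (simp add: signed_perms_def)

lemma sp_abs_le: "\<bar>\<sigma> x\<bar> \<le> int n \<longleftrightarrow> \<bar>x\<bar> \<le> int n"
  using sp_range[of x] sp_eq_zero[of x] by (auto simp: mem_signed_range)

lemma sp_inv_apply [simp]: "inv \<sigma> (\<sigma> x) = x" "\<sigma> (inv \<sigma> x) = x"
  using sp_bij by (simp_all add: bij_is_inj bij_is_surj surj_f_inv_f)

lemma sp_inv: "inv \<sigma> \<in> signed_perms n"
proof -
  have "inv \<sigma> (- x) = - inv \<sigma> x" for x
    using sp_minus[of "inv \<sigma> x"] by (metis sp_inv_apply)
  moreover have "inv \<sigma> x = x" if "int n < x" for x
    using sp_fix[of x] that by (metis sp_inv_apply(1) abs_ge_self order_less_le_trans)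
  ultimately show ?thesis using sp_bij by (simp add: signed_perms_iff bij_imp_bij_inv)
qed

lemma sp_inv_inv: "inv (inv \<sigma>) = \<sigma>"
  using sp_bij by (rule inv_inv_eq)

lemma inv_eqI: "\<sigma> x = y \<Longrightarrow> inv \<sigma> y = x"
  by auto

end

lemma id_signed_perms: "id \<in> signed_perms n"
  by (simp_all add: signed_perms_iff)

lemma comp_signed_perms: "\<sigma> \<in> signed_perms n \<Longrightarrow> \<tau> \<in> signed_perms n \<Longrightarrow> \<sigma> \<circ> \<tau> \<in> signed_perms n"
  by (simp add: signed_perms_iff bij_comp)

lemma signed_permsI:
  assumes "\<And>x. \<tau> (\<sigma> x) = x" "\<And>x. \<sigma> (\<tau> x) = x" "\<And>x. \<sigma> (- x) = - \<sigma> x" "\<And>x. int n < x \<Longrightarrow> \<sigma> x = x"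
  shows "\<sigma> \<in> signed_perms n"
proof -
  have "bij \<sigma>" by (rule o_bij[of \<tau>]) (use assms in \<open>auto simp: fun_eq_iff\<close>)
  with assms show ?thesis by (simp add: signed_perms_iff)
qed

lemma inv_unique:
  assumes "\<And>x. \<tau> (\<sigma> x) = x" "\<And>x. \<sigma> (\<tau> x) = x"
  shows "inv \<sigma> = \<tau>"
  by (rule inv_unique_comp) (use assms in \<open>auto simp: fun_eq_iff\<close>)

lemma signed_perms_eqI:
  assumes "\<sigma> \<in> signed_perms n" "\<tau> \<in> signed_perms n" "\<And>x. 0 < x \<Longrightarrow> x \<le> int n \<Longrightarrow> \<sigma> x = \<tau> x"
  shows "\<sigma> = \<tau>"
proof
  fix x
  have pos: "\<sigma> x = \<tau> x" if "0 < x" for x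
    using assms sp_fix[OF assms(1), of x] sp_fix[OF assms(2), of x] that by (cases "x \<le> int n") auto
  show "\<sigma> x = \<tau> x"
    using pos[of x] pos[of "- x"] sp_minus[OF assms(1), of x] sp_minus[OF assms(2), of x]
      sp_zero[OF assms(1)] sp_zero[OF assms(2)] by (cases "x = 0"; cases "x < 0") auto
qed

text \<open>The values at \<open>0, 1, \<dots>, n\<close> increase strictly and stay between \<open>0\<close> and \<open>n\<close>.\<close>

lemma increasing_eq_id:
  assumes "\<sigma> \<in> signed_perms n" and inc: "\<And>i. i < n \<Longrightarrow> \<sigma> (int i) < \<sigma> (int i + 1)"
  shows "\<sigma> = id"
proof (rule signed_perms_eqI[OF assms(1) id_signed_perms])
  have lo: "int i \<le> \<sigma> (int i)" if "i \<le> n" for i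
    using that
  proof (induction i)
    case (Suc i)
    then show ?case using inc[of i] by (simp add: add.commute)
  qed (simp add: sp_zero[OF assms(1)])
  have hi: "\<sigma> (int (n - j)) \<le> int (n - j)" if "j \<le> n" for j
    using that
  proof (induction j)
    case 0
    then show ?case using sp_abs_le[OF assms(1), of "int n"] by simp
  next
    case (Suc j)
    have e: "int (n - Suc j) + 1 = int (n - j)" using Suc.prems by simp
    then show ?case using Suc inc[of "n - Suc j"] by simp
  qed
  fix x :: int assume x: "0 < x" "x \<le> int n"
  show "\<sigma> x = id x" using lo[of "nat x"] hi[of "n - nat x"] x by simp
qed

definition inversions :: "nat \<Rightarrow> (int \<Rightarrow> int) \<Rightarrow> (int \<times> int) set" where
  "inversions n \<sigma> = {(x, y). x \<in> signed_range n \<and> y \<in> signed_range n \<and> x < y \<and> \<sigma> y < \<sigma> x}"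

text \<open>With \<open>(x, y)\<close> also \<open>(- y, - x)\<close> is an inversion, so every reflection that shortens the signed
permutation is counted twice, except for the pairs \<open>(- x, x)\<close>. The number of negative entries counts
these once more.\<close>

definition twice_length :: "nat \<Rightarrow> (int \<Rightarrow> int) \<Rightarrow> nat" where
  "twice_length n \<sigma> = card (inversions n \<sigma>) + neg n \<sigma>"

lemma finite_inversions [simp]: "finite (inversions n \<sigma>)"
  by (rule finite_subset[of _ "signed_range n \<times> signed_range n"]) (auto simp: inversions_def)

lemma neg_int: "neg n \<sigma> = card {x. 0 < x \<and> x \<le> int n \<and> \<sigma> x < 0}"
proof -
  have "bij_betw int {i \<in> {1..n}. \<sigma> (int i) < 0} {x. 0 < x \<and> x \<le> int n \<and> \<sigma> x < 0}"
  proof (rule bij_betwI[where g = nat])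
  qed auto
  then show ?thesis unfolding neg_def by (rule bij_betw_same_card)
qed

lemma neg_inv:
  assumes "\<sigma> \<in> signed_perms n"
  shows "neg n (inv \<sigma>) = neg n \<sigma>"
proof -
  note [simp] = sp_minus[OF assms] sp_minus[OF sp_inv[OF assms]] sp_inv_apply[OF assms]
  have "bij_betw (\<lambda>x. - \<sigma> x) {x. 0 < x \<and> x \<le> int n \<and> \<sigma> x < 0} {x. 0 < x \<and> x \<le> int n \<and> inv \<sigma> x < 0}"
  proof (rule bij_betwI[where g = "\<lambda>x. - inv \<sigma> x"])
    show "(\<lambda>x. - \<sigma> x) \<in> {x. 0 < x \<and> x \<le> int n \<and> \<sigma> x < 0} \<rightarrow> {x. 0 < x \<and> x \<le> int n \<and> inv \<sigma> x < 0}"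
    proof clarsimp
      fix x assume "0 < x" "x \<le> int n" "\<sigma> x < 0"
      then show "- \<sigma> x \<le> int n" using sp_abs_le[OF assms, of x] by linarith
    qed
    show "(\<lambda>x. - inv \<sigma> x) \<in> {x. 0 < x \<and> x \<le> int n \<and> inv \<sigma> x < 0} \<rightarrow> {x. 0 < x \<and> x \<le> int n \<and> \<sigma> x < 0}"
    proof clarsimp
      fix x assume "0 < x" "x \<le> int n" "inv \<sigma> x < 0"
      then show "- inv \<sigma> x \<le> int n" using sp_abs_le[OF sp_inv[OF assms], of x] by linarith
    qed
  qed auto
  then show ?thesis unfolding neg_int by (simp add: bij_betw_same_card)
qed

text \<open>Exchanging positions and values turns the inversions of a permutation into those of its inverse.\<close>

lemma twice_length_inv:
  assumes "\<sigma> \<in> signed_perms n"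
  shows "twice_length n (inv \<sigma>) = twice_length n \<sigma>"
proof -
  have "bij_betw (\<lambda>(x, y). (\<sigma> y, \<sigma> x)) (inversions n \<sigma>) (inversions n (inv \<sigma>))"
    by (rule bij_betwI[where g = "\<lambda>(x, y). (inv \<sigma> y, inv \<sigma> x)"])
      (use sp_range[OF assms] sp_range[OF sp_inv[OF assms]] sp_inv_apply[OF assms] in
        \<open>auto simp: inversions_def\<close>)
  then show ?thesis by (simp add: twice_length_def neg_inv[OF assms] bij_betw_same_card)
qed

lemma gen_eq:
  "gen i x = (if i = 0 then (if \<bar>x\<bar> = 1 then - x else x)
    else if x = int i then x + 1 else if x = int i + 1 then x - 1
    else if x = - int i then x - 1 else if x = - int i - 1 then x + 1 else x)"
  by (auto simp: gen_def transpose_def)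

lemma gen_gen [simp]: "gen i (gen i x) = x"
  by (simp add: gen_eq)

lemma gen_signed_perms: "i < n \<Longrightarrow> gen i \<in> signed_perms n"
  by (rule signed_permsI[of "gen i"]) (auto simp: gen_eq)

lemma inv_gen: "inv (gen i) = gen i"
  by (rule inv_unique) simp_all

lemma gen_mono_iff:
  assumes "x \<noteq> 0" "y \<noteq> 0" "x < y"
  shows "gen i y < gen i x \<longleftrightarrow>
    (x, y) \<in> (if i = 0 then {(- 1, 1)} else {(int i, int i + 1), (- int i - 1, - int i)})"
  using assms by (auto simp: gen_eq)

text \<open>A generator reverses the order of two pairs of positions only (one pair for \<open>i = 0\<close>). All other
inversions are carried along, while these pairs become inversions.\<close>

lemma twice_length_gen_up:
  assumes "\<sigma> \<in> signed_perms n" "i < n" "\<sigma> (int i) < \<sigma> (int i + 1)"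
  shows "twice_length n (\<sigma> \<circ> gen i) = twice_length n \<sigma> + 2"
proof -
  define S where "S = (if i = 0 then {(- 1, 1)} else {(int i, int i + 1), (- int i - 1, - int i)})"
  let ?g = "gen i" and ?f = "\<lambda>(x, y). (gen i x, gen i y)"
  note m = sp_minus[OF assms(1)]
  have gr: "gen i x \<in> signed_range n \<longleftrightarrow> x \<in> signed_range n" for x
    using sp_range[OF gen_signed_perms[OF assms(2)]] .
  have neq: "gen i x = gen i y \<longleftrightarrow> x = y" for x y by (metis gen_gen)
  have S: "x \<in> signed_range n \<and> y \<in> signed_range n \<and> x < y \<and> \<sigma> x < \<sigma> y \<and> gen i y = x \<and> gen i x = y"
    if "(x, y) \<in> S" for x y
  proof -
    from that consider "i = 0" "x = - 1" "y = 1" | "i \<noteq> 0" "x = int i" "y = int i + 1"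
      | "i \<noteq> 0" "x = - int i - 1" "y = - int i" by (auto simp: S_def split: if_splits)
    then show ?thesis
    proof cases
      case 1
      have "\<sigma> (- 1) = - \<sigma> 1" using m[of 1] .
      then show ?thesis using 1 assms(2,3) sp_zero[OF assms(1)] by (simp add: mem_signed_range gen_eq)
    next
      case 2
      then show ?thesis using assms(2,3) by (simp add: mem_signed_range gen_eq)
    next
      case 3
      have "\<sigma> (- int i - 1) = - \<sigma> (int i + 1)" "\<sigma> (- int i) = - \<sigma> (int i)"
        using m[of "int i + 1"] m[of "int i"] by simp_all
      then show ?thesis using 3 assms(2,3) by (simp add: mem_signed_range gen_eq)
    qed
  qed
  have iff: "gen i y < gen i x \<longleftrightarrow> (x, y) \<in> S" if "x \<in> signed_range n" "y \<in> signed_range n" "x < y" for x y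
    using gen_mono_iff[of x y i] that by (simp add: S_def mem_signed_range)
  have eq: "inversions n (\<sigma> \<circ> ?g) = ?f ` inversions n \<sigma> \<union> S"
  proof (intro set_eqI iffI)
    fix p assume p: "p \<in> inversions n (\<sigma> \<circ> ?g)"
    obtain x y where xy: "p = (x, y)" by (cases p)
    with p have r: "x \<in> signed_range n" "y \<in> signed_range n" "x < y" "\<sigma> (?g y) < \<sigma> (?g x)"
      by (auto simp: inversions_def)
    show "p \<in> ?f ` inversions n \<sigma> \<union> S"
    proof (cases "(x, y) \<in> S")
      case False
      then have "?g x < ?g y" using iff[OF r(1-3)] neq[of x y] r(3) by linarith
      then have "(?g x, ?g y) \<in> inversions n \<sigma>" using r gr by (simp add: inversions_def)
      then have "?f (?g x, ?g y) \<in> ?f ` inversions n \<sigma>" by (rule imageI)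
      then show ?thesis by (simp add: xy)
    qed (simp add: xy)
  next
    fix p assume "p \<in> ?f ` inversions n \<sigma> \<union> S"
    then show "p \<in> inversions n (\<sigma> \<circ> ?g)"
    proof
      assume "p \<in> ?f ` inversions n \<sigma>"
      then obtain x y where xy: "p = (?g x, ?g y)" and i: "(x, y) \<in> inversions n \<sigma>" by auto
      then have r: "x \<in> signed_range n" "y \<in> signed_range n" "x < y" "\<sigma> y < \<sigma> x" by (auto simp: inversions_def)
      then have "(x, y) \<notin> S" using S[of x y] by linarith
      then have "?g x < ?g y" using iff[OF r(1-3)] neq[of x y] r(3) by linarith
      then show ?thesis using r gr by (simp add: xy inversions_def)
    next
      assume "p \<in> S"
      moreover obtain x y where xy: "p = (x, y)" by (cases p)
      ultimately show ?thesis using S[of x y] by (auto simp: inversions_def)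
    qed
  qed
  have "p \<notin> S" if p: "p \<in> ?f ` inversions n \<sigma>" for p
  proof
    assume pS: "p \<in> S"
    obtain x y where xy: "p = (?g x, ?g y)" and i: "(x, y) \<in> inversions n \<sigma>" using p by auto
    then have "x < y" by (simp add: inversions_def)
    then show False using S[of "?g x" "?g y"] pS unfolding xy gen_gen by linarith
  qed
  then have disj: "?f ` inversions n \<sigma> \<inter> S = {}" by blast
  have "inj_on ?f (inversions n \<sigma>)" by (auto intro!: inj_onI simp: neq)
  then have card: "card (inversions n (\<sigma> \<circ> ?g)) = card (inversions n \<sigma>) + card S"
    unfolding eq using disj by (subst card_Un_disjoint) (auto simp: card_image S_def)
  show ?thesis
  proof (cases "i = 0")
    case True
    have "{x. 0 < x \<and> x \<le> int n \<and> (\<sigma> \<circ> ?g) x < 0} = insert 1 {x. 0 < x \<and> x \<le> int n \<and> \<sigma> x < 0}"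
    proof -
      have "0 < x \<and> x \<le> int n \<and> (\<sigma> \<circ> ?g) x < 0 \<longleftrightarrow> x = 1 \<or> 0 < x \<and> x \<le> int n \<and> \<sigma> x < 0" for x
      proof (cases "x = 1")
        case x: True
        have "\<sigma> (- 1) = - \<sigma> 1" by (rule m)
        then show ?thesis using True assms(2,3) sp_zero[OF assms(1)] x by (simp add: gen_eq)
      next
        case x: False
        then have "0 < x \<Longrightarrow> ?g x = x" using True by (simp add: gen_eq)
        then show ?thesis using x by auto
      qed
      then show ?thesis by blast
    qed
    moreover have "1 \<notin> {x. 0 < x \<and> x \<le> int n \<and> \<sigma> x < 0}" using True assms(3) sp_zero[OF assms(1)] by simp
    moreover have "finite {x. 0 < x \<and> x \<le> int n \<and> \<sigma> x < 0}"
      by (rule finite_subset[of _ "{0..int n}"]) auto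
    ultimately show ?thesis using card True by (simp add: twice_length_def neg_int S_def)
  next
    case False
    have "{x. 0 < x \<and> x \<le> int n \<and> (\<sigma> \<circ> ?g) x < 0} = ?g ` {x. 0 < x \<and> x \<le> int n \<and> \<sigma> x < 0}" (is "?A = ?g ` ?B")
    proof (intro set_eqI iffI)
      fix x assume "x \<in> ?A"
      then have "?g x \<in> ?B" using False assms(2) by (auto simp: gen_eq)
      then have "?g (?g x) \<in> ?g ` ?B" by (rule imageI)
      then show "x \<in> ?g ` ?B" by simp
    next
      fix x assume "x \<in> ?g ` ?B"
      then obtain z where z: "x = ?g z" "z \<in> ?B" by blast
      then show "x \<in> ?A" using False assms(2) by (auto simp: gen_eq)
    qed
    then have "neg n (\<sigma> \<circ> ?g) = neg n \<sigma>" unfolding neg_int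
      by (simp add: card_image inj_on_def neq)
    then show ?thesis using card False by (simp add: twice_length_def S_def)
  qed
qed

lemma twice_length_gen_down:
  assumes "\<sigma> \<in> signed_perms n" "i < n" "\<sigma> (int i + 1) < \<sigma> (int i)"
  shows "twice_length n \<sigma> = twice_length n (\<sigma> \<circ> gen i) + 2"
proof -
  have "(\<sigma> \<circ> gen i) \<circ> gen i = \<sigma>" by (simp add: fun_eq_iff)
  moreover have "(\<sigma> \<circ> gen i) (int i) < (\<sigma> \<circ> gen i) (int i + 1)"
    using assms(3) sp_minus[OF assms(1), of 1] sp_zero[OF assms(1)] by (auto simp: gen_eq)
  ultimately show ?thesis
    using twice_length_gen_up[OF comp_signed_perms[OF assms(1) gen_signed_perms[OF assms(2)]] assms(2)] by simp
qed

lemma twice_length_id: "twice_length n id = 0"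
proof -
  have "inversions n id = {}" by (auto simp: inversions_def)
  moreover have "{x. 0 < x \<and> x \<le> int n \<and> id x < 0} = {}" by auto
  ultimately show ?thesis unfolding twice_length_def neg_int by (metis add_0 card.empty)
qed

lemma word_prod_simps [simp]: "word_prod [] = id" "word_prod (i # w) = gen i \<circ> word_prod w"
  by (simp_all add: word_prod_def)

lemma word_prod_append: "word_prod (v @ w) = word_prod v \<circ> word_prod w"
  by (induction v) (simp_all add: comp_assoc)

lemma word_prod_signed_perms: "set w \<subseteq> {..<n} \<Longrightarrow> word_prod w \<in> signed_perms n"
  by (induction w) (auto intro: id_signed_perms comp_signed_perms gen_signed_perms)

lemma twice_length_gen_le:
  assumes "\<sigma> \<in> signed_perms n" "i < n"
  shows "twice_length n (\<sigma> \<circ> gen i) \<le> twice_length n \<sigma> + 2"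
proof -
  have "\<sigma> (int i) \<noteq> \<sigma> (int i + 1)" using sp_eq[OF assms(1)] by simp
  then show ?thesis using twice_length_gen_up[OF assms] twice_length_gen_down[OF assms] by linarith
qed

lemma twice_length_word_le: "set w \<subseteq> {..<n} \<Longrightarrow> twice_length n (word_prod w) \<le> 2 * length w"
proof (induction w rule: rev_induct)
  case (snoc i w)
  then show ?case
    using twice_length_gen_le[OF word_prod_signed_perms, of w n i] by (simp add: word_prod_append comp_def)
qed (simp add: twice_length_id)

text \<open>As long as the signed permutation is not the identity it has a descent, and removing descents
shortens it until it is the identity.\<close>

lemma ex_reduced_word:
  assumes "\<sigma> \<in> signed_perms n"
  shows "\<exists>w. set w \<subseteq> {..<n} \<and> word_prod w = \<sigma> \<and> 2 * length w = twice_length n \<sigma>"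
  using assms
proof (induction "twice_length n \<sigma>" arbitrary: \<sigma> rule: less_induct)
  case less
  show ?case
  proof (cases "\<exists>i<n. \<sigma> (int i + 1) < \<sigma> (int i)")
    case True
    then obtain i where i: "i < n" "\<sigma> (int i + 1) < \<sigma> (int i)" by blast
    note d = twice_length_gen_down[OF less.prems i]
    obtain w where w: "set w \<subseteq> {..<n}" "word_prod w = \<sigma> \<circ> gen i" "2 * length w = twice_length n (\<sigma> \<circ> gen i)"
      using less.hyps[of "\<sigma> \<circ> gen i"] d comp_signed_perms[OF less.prems gen_signed_perms[OF i(1)]] by auto
    have "word_prod (w @ [i]) = \<sigma>" by (simp add: word_prod_append w(2) fun_eq_iff)
    then show ?thesis using w d i by (intro exI[of _ "w @ [i]"]) simp
  next
    case False
    then have "\<sigma> (int i) < \<sigma> (int i + 1)" if "i < n" for i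
      using that sp_eq[OF less.prems, of "int i" "int i + 1"] by force
    then have "\<sigma> = id" by (rule increasing_eq_id[OF less.prems])
    then show ?thesis by (intro exI[of _ "[]"]) (simp add: twice_length_id)
  qed
qed

lemma inv_B_eq:
  assumes "\<sigma> \<in> signed_perms n"
  shows "2 * inv_B n \<sigma> = twice_length n \<sigma>"
proof -
  obtain w where w: "set w \<subseteq> {..<n}" "word_prod w = \<sigma>" "2 * length w = twice_length n \<sigma>"
    using ex_reduced_word[OF assms] by blast
  have "inv_B n \<sigma> = length w" unfolding inv_B_def
  proof (rule Least_equality)
    show "\<exists>v. length v = length w \<and> set v \<subseteq> {..<n} \<and> word_prod v = \<sigma>" using w by blast
    fix k assume "\<exists>v. length v = k \<and> set v \<subseteq> {..<n} \<and> word_prod v = \<sigma>"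
    then obtain v where v: "length v = k" "set v \<subseteq> {..<n}" "word_prod v = \<sigma>" by blast
    then show "length w \<le> k" using twice_length_word_le[OF v(2)] w(3) by simp
  qed
  then show ?thesis using w by simp
qed

lemma inv_B_inv: "\<sigma> \<in> signed_perms n \<Longrightarrow> inv_B n (inv \<sigma>) = inv_B n \<sigma>"
  using inv_B_eq[of \<sigma> n] inv_B_eq[OF sp_inv, of \<sigma> n] twice_length_inv[of \<sigma> n] by simp

section \<open>Inserting an entry into a signed permutation\<close>

text \<open>The increasing odd injection of the integers that misses exactly the two numbers \<open>p + 1\<close> and
\<open>- (p + 1)\<close>; \<open>unskip\<close> is its left inverse.\<close>

definition skip :: "nat \<Rightarrow> int \<Rightarrow> int" where
  "skip p v = (if int p < v then v + 1 else if v < - int p then v - 1 else v)"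

definition unskip :: "nat \<Rightarrow> int \<Rightarrow> int" where
  "unskip p v = (if int p + 1 < v then v - 1 else if v < - int p - 1 then v + 1 else v)"

text \<open>The entry \<open>q + 1\<close> is inserted at position \<open>p + 1\<close>. Counting both from \<open>0\<close> makes \<open>p + q\<close> the
parameter \<open>t\<close> of the corresponding growth step of a path.\<close>

definition insert_entry :: "nat \<Rightarrow> nat \<Rightarrow> (int \<Rightarrow> int) \<Rightarrow> int \<Rightarrow> int" where
  "insert_entry p q \<sigma> x =
     (if x = int p + 1 then int q + 1 else if x = - int p - 1 then - int q - 1 else skip q (\<sigma> (unskip p x)))"

definition delete_entry :: "nat \<Rightarrow> nat \<Rightarrow> (int \<Rightarrow> int) \<Rightarrow> int \<Rightarrow> int" where
  "delete_entry p q \<sigma> x = unskip q (\<sigma> (skip p x))"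

lemma unskip_skip [simp]: "unskip p (skip p v) = v"
  by (simp add: skip_def unskip_def)

lemma skip_unskip: "v \<noteq> int p + 1 \<Longrightarrow> v \<noteq> - int p - 1 \<Longrightarrow> skip p (unskip p v) = v"
  by (auto simp: skip_def unskip_def)

lemma skip_neq [simp]: "skip p v \<noteq> int p + 1" "skip p v \<noteq> - int p - 1"
  by (auto simp: skip_def)

lemma skip_minus: "skip p (- v) = - skip p v"
  by (auto simp: skip_def)

lemma unskip_minus: "unskip p (- v) = - unskip p v"
  by (auto simp: unskip_def)

lemma skip_less_iff [simp]: "skip p v < skip p w \<longleftrightarrow> v < w"
  by (auto simp: skip_def)

lemma skip_eq_iff [simp]: "skip p v = skip p w \<longleftrightarrow> v = w"
  by (metis unskip_skip)

lemma skip_sign [simp]: "skip p v < 0 \<longleftrightarrow> v < 0" "0 < skip p v \<longleftrightarrow> 0 < v" "skip p v = 0 \<longleftrightarrow> v = 0"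
  by (auto simp: skip_def)

lemma skip_le_iff: "p \<le> n \<Longrightarrow> skip p v \<le> int (Suc n) \<longleftrightarrow> v \<le> int n"
  by (auto simp: skip_def)

lemma skip_signed_range: "p \<le> n \<Longrightarrow> skip p v \<in> signed_range (Suc n) \<longleftrightarrow> v \<in> signed_range n"
  by (auto simp: skip_def mem_signed_range)

lemma insert_entry_at [simp]:
  "insert_entry p q \<sigma> (int p + 1) = int q + 1" "insert_entry p q \<sigma> (- int p - 1) = - int q - 1"
  by (simp_all add: insert_entry_def)

lemma insert_entry_skip [simp]: "insert_entry p q \<sigma> (skip p x) = skip q (\<sigma> x)"
  by (simp add: insert_entry_def)

lemma insert_entry_low: "\<bar>x\<bar> \<le> int p \<Longrightarrow> insert_entry p q \<sigma> x = skip q (\<sigma> x)"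
  by (auto simp: insert_entry_def unskip_def)

lemma insert_entry_high: "int p + 1 < x \<Longrightarrow> insert_entry p q \<sigma> x = skip q (\<sigma> (x - 1))"
  by (auto simp: insert_entry_def unskip_def)

lemma skip_cases [case_names at minus_at skip]:
  assumes "x = int p + 1 \<Longrightarrow> P" "x = - int p - 1 \<Longrightarrow> P" "\<And>y. x = skip p y \<Longrightarrow> P"
  shows P
  using assms(1,2) assms(3)[of "unskip p x"] skip_unskip[of x p] by metis

lemma insert_entry_inverse:
  assumes "\<And>x. \<tau> (\<sigma> x) = x"
  shows "insert_entry q p \<tau> (insert_entry p q \<sigma> x) = x"
  by (cases x rule: skip_cases[of _ p]) (simp_all add: assms)

lemma insert_entry_minus:
  assumes "\<And>x. \<sigma> (- x) = - \<sigma> x"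
  shows "insert_entry p q \<sigma> (- x) = - insert_entry p q \<sigma> x"
  by (auto simp: insert_entry_def unskip_minus assms skip_minus)

lemma insert_entry_signed_perms:
  assumes "\<sigma> \<in> signed_perms n" "p \<le> n" "q \<le> n"
  shows "insert_entry p q \<sigma> \<in> signed_perms (Suc n)"
proof (rule signed_permsI[of "insert_entry q p (inv \<sigma>)"])
  fix x :: int
  show "insert_entry p q \<sigma> x = x" if "int (Suc n) < x"
  proof -
    have "insert_entry p q \<sigma> x = skip q (\<sigma> (x - 1))" using that assms by (intro insert_entry_high) simp
    also have "\<sigma> (x - 1) = x - 1" using sp_fix[OF assms(1)] that by simp
    finally show ?thesis using that assms by (simp add: skip_def)
  qed
qed (simp_all add: insert_entry_inverse insert_entry_minus sp_inv_apply[OF assms(1)] sp_minus[OF assms(1)])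

lemma inv_insert_entry:
  assumes "\<sigma> \<in> signed_perms n"
  shows "inv (insert_entry p q \<sigma>) = insert_entry q p (inv \<sigma>)"
  by (rule inv_unique) (simp_all add: insert_entry_inverse sp_inv_apply[OF assms])

lemma insert_delete_entry:
  assumes "\<sigma> \<in> signed_perms n" "\<sigma> (int p + 1) = int q + 1"
  shows "insert_entry p q (delete_entry p q \<sigma>) = \<sigma>"
proof
  fix x show "insert_entry p q (delete_entry p q \<sigma>) x = \<sigma> x"
  proof (cases x rule: skip_cases[of _ p])
    case (skip y)
    have "\<sigma> (skip p y) \<noteq> int q + 1" "\<sigma> (skip p y) \<noteq> - int q - 1"
      using sp_eq[OF assms(1), of "skip p y" "int p + 1"] sp_eq_minus[OF assms(1), of "skip p y" "int p + 1"]
        assms(2) skip_neq[of p y] by auto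
    then show ?thesis by (simp add: skip delete_entry_def skip_unskip)
  qed (use assms sp_minus[OF assms(1), of "int p + 1"] in simp_all)
qed

lemma delete_insert_entry [simp]: "delete_entry p q (insert_entry p q \<sigma>) = \<sigma>"
  by (simp add: delete_entry_def fun_eq_iff)

lemma insert_entry_inj: "insert_entry p q \<sigma> = insert_entry p q \<tau> \<Longrightarrow> \<sigma> = \<tau>"
  by (metis delete_insert_entry)

lemma delete_entry_signed_perms:
  assumes "\<sigma> \<in> signed_perms (Suc n)" "\<sigma> (int p + 1) = int q + 1" "p \<le> n"
  shows "delete_entry p q \<sigma> \<in> signed_perms n"
proof (rule signed_permsI[of "delete_entry q p (inv \<sigma>)"])
  have q: "q \<le> n" using sp_abs_le[OF assms(1), of "int p + 1"] assms by simp
  have s: "\<sigma> (skip p y) \<noteq> int q + 1 \<and> \<sigma> (skip p y) \<noteq> - int q - 1" for y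
    using sp_eq[OF assms(1), of "skip p y" "int p + 1"] sp_eq_minus[OF assms(1), of "skip p y" "int p + 1"]
      assms(2) skip_neq[of p y] by auto
  have s': "inv \<sigma> (skip q y) \<noteq> int p + 1 \<and> inv \<sigma> (skip q y) \<noteq> - int p - 1" for y
    using sp_inv_apply(2)[OF assms(1), of "skip q y"] assms(2) skip_neq[of q y] sp_minus[OF assms(1), of "int p + 1"]
    by fastforce
  fix x
  show "delete_entry q p (inv \<sigma>) (delete_entry p q \<sigma> x) = x"
    using s[of x] by (simp add: delete_entry_def skip_unskip sp_inv_apply[OF assms(1)])
  show "delete_entry p q \<sigma> (delete_entry q p (inv \<sigma>) x) = x"
    using s'[of x] by (simp add: delete_entry_def skip_unskip sp_inv_apply[OF assms(1)])
  show "delete_entry p q \<sigma> (- x) = - delete_entry p q \<sigma> x"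
    by (simp add: delete_entry_def skip_minus unskip_minus sp_minus[OF assms(1)])
  show "delete_entry p q \<sigma> x = x" if "int n < x"
  proof -
    have "skip p x = x + 1" using that assms(3) by (simp add: skip_def)
    then have "\<sigma> (skip p x) = x + 1" using sp_fix[OF assms(1), of "x + 1"] that by simp
    then show ?thesis using that q by (simp add: delete_entry_def unskip_def)
  qed
qed

lemma neg_insert_entry:
  assumes "\<sigma> \<in> signed_perms n" "p \<le> n"
  shows "neg (Suc n) (insert_entry p q \<sigma>) = neg n \<sigma>"
proof -
  have "{x. 0 < x \<and> x \<le> int (Suc n) \<and> insert_entry p q \<sigma> x < 0} = skip p ` {x. 0 < x \<and> x \<le> int n \<and> \<sigma> x < 0}"
    (is "?A = ?f ` ?B")
  proof (intro set_eqI iffI)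
    fix x assume x: "x \<in> ?A"
    show "x \<in> ?f ` ?B"
    proof (cases x rule: skip_cases[of _ p])
      case (skip y)
      have "insert_entry p q \<sigma> x = skip q (\<sigma> y)" by (simp add: skip)
      then have "0 < y" "\<sigma> y < 0" using x skip by auto
      moreover have "y \<le> int n" using x skip skip_le_iff[OF assms(2)] by simp
      ultimately have "y \<in> ?B" by simp
      then show ?thesis using skip by blast
    qed (use x in auto)
  next
    fix x assume "x \<in> ?f ` ?B"
    then show "x \<in> ?A" using skip_le_iff[OF assms(2)] by auto
  qed
  then show ?thesis unfolding neg_int by (simp add: card_image inj_on_def)
qed

text \<open>The new entry \<open>q + 1\<close> exceeds all \<open>n - p\<close> entries to its right. Consequently the \<open>n - q\<close> larger values
all occur to its left, partly at negative positions. Together they give \<open>(n - p) + (n - q)\<close>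
inversions with the new entry, and as many with its mirror image.\<close>

lemma twice_length_insert_entry:
  assumes \<sigma>: "\<sigma> \<in> signed_perms n" and pq: "p \<le> n" "q \<le> n"
    and small: "\<And>x. int p < x \<Longrightarrow> x \<le> int n \<Longrightarrow> \<sigma> x \<le> int q"
  shows "twice_length (Suc n) (insert_entry p q \<sigma>) = twice_length n \<sigma> + 2 * (2 * n - (p + q))"
proof -
  define \<rho> where "\<rho> = insert_entry p q \<sigma>"
  have \<rho>: "\<rho> \<in> signed_perms (Suc n)" unfolding \<rho>_def by (rule insert_entry_signed_perms[OF \<sigma> pq])
  have at: "\<rho> (int p + 1) = int q + 1" by (simp add: \<rho>_def)
  have high: "\<rho> y < int q + 1" if "int p + 1 < y" "y \<le> int (Suc n)" for y
  proof -
    have "\<rho> y = skip q (\<sigma> (y - 1))" unfolding \<rho>_def using that by (intro insert_entry_high) simp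
    then show ?thesis using small[of "y - 1"] that by (simp add: skip_def)
  qed
  define f where "f = (\<lambda>(x, y). (skip p x, skip p y))"
  \<comment> \<open>inversions that involve the position p + 1; those that involve -(p + 1) are their mirror images\<close>
  define J where "J = {int p + 1} \<times> {int p + 2..int n + 1} \<union> (inv \<rho> ` {int q + 2..int n + 1}) \<times> {int p + 1}"
  define m where "m = (\<lambda>(x, y). (- y, - x) :: int \<times> int)"
  have flip: "(- y, - x) \<in> inversions (Suc n) \<rho>" if "(x, y) \<in> inversions (Suc n) \<rho>" for x y
    using that by (simp add: inversions_def mem_signed_range sp_minus[OF \<rho>])
  have J_in: "pr \<in> inversions (Suc n) \<rho>" if "pr \<in> J" for pr
  proof -
    from that consider y where "pr = (int p + 1, y)" "int p + 2 \<le> y" "y \<le> int n + 1"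
      | v where "pr = (inv \<rho> v, int p + 1)" "int q + 2 \<le> v" "v \<le> int n + 1" by (auto simp: J_def)
    then show ?thesis
    proof cases
      case 1
      then show ?thesis using high[of y] at by (simp add: inversions_def mem_signed_range)
    next
      case 2
      let ?x = "inv \<rho> v"
      have r: "\<rho> ?x = v" by (simp add: sp_inv_apply[OF \<rho>])
      have "?x \<in> signed_range (Suc n)" using sp_range[OF \<rho>, of ?x] 2 by (simp add: r mem_signed_range)
      moreover have "?x < int p + 1"
      proof (rule ccontr)
        assume "\<not> ?x < int p + 1"
        moreover have "?x \<noteq> int p + 1" using at r 2 by auto
        moreover have "?x \<le> int (Suc n)" using \<open>?x \<in> signed_range (Suc n)\<close> by (auto simp: mem_signed_range)
        ultimately have "\<rho> ?x < int q + 1" by (intro high) auto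
        then show False using r 2 by simp
      qed
      ultimately show ?thesis using 2 at r pq by (simp add: inversions_def mem_signed_range)
    qed
  qed
  have eq: "inversions (Suc n) \<rho> = f ` inversions n \<sigma> \<union> (J \<union> m ` J)"
  proof (intro set_eqI iffI)
    fix pr assume pr: "pr \<in> inversions (Suc n) \<rho>"
    have J_top: "(x, y) \<in> J" if "(x, y) \<in> inversions (Suc n) \<rho>" "x = int p + 1 \<or> y = int p + 1" for x y
    proof -
      from that(2) show ?thesis
      proof
        assume "x = int p + 1"
        then show ?thesis using that(1) by (auto simp: J_def inversions_def mem_signed_range)
      next
        assume y: "y = int p + 1"
        then have "\<rho> x \<in> {int q + 2..int n + 1}"
          using that(1) at sp_range[OF \<rho>, of x] by (auto simp: inversions_def mem_signed_range)
        moreover have "x = inv \<rho> (\<rho> x)" by (simp add: sp_inv_apply[OF \<rho>])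
        ultimately show ?thesis using y by (auto simp: J_def)
      qed
    qed
    obtain x y where xy: "pr = (x, y)" by (cases pr)
    show "pr \<in> f ` inversions n \<sigma> \<union> (J \<union> m ` J)"
    proof (cases "x = int p + 1 \<or> y = int p + 1")
      case True
      then show ?thesis using J_top pr xy by blast
    next
      case 1: False
      show ?thesis
      proof (cases "x = - int p - 1 \<or> y = - int p - 1")
        case True
        then have "(- y, - x) \<in> J" using J_top[of "- y" "- x"] flip[of x y] pr xy by auto
        moreover have "pr = m (- y, - x)" by (simp add: m_def xy)
        ultimately show ?thesis by blast
      next
        case False
        then obtain x' y' where s: "x = skip p x'" "y = skip p y'" using 1 by (metis skip_unskip)
        then have "(x', y') \<in> inversions n \<sigma>"
          using pr xy skip_signed_range[OF pq(1)] by (simp add: inversions_def \<rho>_def)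
        moreover have "pr = f (x', y')" by (simp add: f_def xy s)
        ultimately show ?thesis by blast
      qed
    qed
  next
    fix pr assume "pr \<in> f ` inversions n \<sigma> \<union> (J \<union> m ` J)"
    then consider "pr \<in> f ` inversions n \<sigma>" | "pr \<in> J" | "pr \<in> m ` J" by blast
    then show "pr \<in> inversions (Suc n) \<rho>"
    proof cases
      case 1
      then obtain x y where xy: "pr = (skip p x, skip p y)" "(x, y) \<in> inversions n \<sigma>" by (auto simp: f_def)
      then show ?thesis using skip_signed_range[OF pq(1)] by (simp add: inversions_def \<rho>_def)
    next
      case 2
      then show ?thesis by (rule J_in)
    next
      case 3
      then show ?thesis using J_in flip by (auto simp: m_def)
    qed
  qed
  have notJ: "f pr \<notin> J \<union> m ` J" for pr
  proof -
    obtain x y where "pr = (x, y)" by (cases pr)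
    moreover have "skip p z \<noteq> int p + 1 \<and> skip p z \<noteq> - int p - 1" for z by simp
    ultimately show ?thesis by (force simp: f_def J_def m_def)
  qed
  have JmJ: "J \<inter> m ` J = {}"
  proof -
    have False if "(x, y) \<in> J" "(- y, - x) \<in> J" for x y
    proof -
      have "x < y" "\<rho> y < \<rho> x" using J_in[OF that(1)] by (auto simp: inversions_def)
      moreover have "x = int p + 1 \<or> y = int p + 1" "- y = int p + 1 \<or> - x = int p + 1" using that by (auto simp: J_def)
      ultimately have "x = - (int p + 1)" "y = int p + 1" by auto
      then have "\<rho> x = - (int q + 1)" using sp_minus[OF \<rho>, of "int p + 1"] at by simp
      then show False using \<open>\<rho> y < \<rho> x\<close> \<open>y = int p + 1\<close> at by simp
    qed
    then show ?thesis by (force simp: m_def)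
  qed
  have finJ: "finite J" by (simp add: J_def)
  have cJ: "card J = 2 * n - (p + q)"
  proof -
    have "({int p + 1} \<times> {int p + 2..int n + 1}) \<inter> ((inv \<rho> ` {int q + 2..int n + 1}) \<times> {int p + 1}) = {}" by auto
    then have "card J = card ({int p + 1} \<times> {int p + 2..int n + 1}) + card ((inv \<rho> ` {int q + 2..int n + 1}) \<times> {int p + 1})"
      unfolding J_def by (intro card_Un_disjoint) auto
    also have "\<dots> = (n - p) + (n - q)"
      using sp_eq[OF sp_inv[OF \<rho>]] by (simp add: card_cartesian_product card_image inj_on_def)
    finally show ?thesis using pq by simp
  qed
  have "card (m ` J) = card J" by (rule card_image) (auto simp: inj_on_def m_def)
  then have "card (J \<union> m ` J) = 2 * (2 * n - (p + q))"
    using JmJ finJ cJ by (simp add: card_Un_disjoint)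
  moreover have "card (f ` inversions n \<sigma>) = card (inversions n \<sigma>)"
    by (rule card_image) (auto simp: inj_on_def f_def)
  moreover have "f ` inversions n \<sigma> \<inter> (J \<union> m ` J) = {}" using notJ by blast
  ultimately have "card (inversions (Suc n) \<rho>) = card (inversions n \<sigma>) + 2 * (2 * n - (p + q))"
    unfolding eq using finJ by (subst card_Un_disjoint) auto
  then show ?thesis using neg_insert_entry[OF \<sigma> pq(1), of q] by (simp add: twice_length_def \<rho>_def)
qed

definition ascents :: "nat \<Rightarrow> (int \<Rightarrow> int) \<Rightarrow> nat set" where
  "ascents n \<sigma> = {i. i < n \<and> \<sigma> (int i) < \<sigma> (int i + 1)}"

lemma finite_ascents [simp]: "finite (ascents n \<sigma>)"
  by (simp add: ascents_def)

text \<open>To the right of the new entry there is no ascent, neither before nor after the insertion, so no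
ascent is moved. An old ascent \<open>p\<close> remains an ascent because the entry at \<open>p + 1\<close> is now larger than
the entry that stood there.\<close>

lemma ascents_insert_entry:
  assumes small: "\<And>x. int p < x \<Longrightarrow> x \<le> int n \<Longrightarrow> \<sigma> x \<le> int q"
    and desc: "\<And>x. int p < x \<Longrightarrow> x < int n \<Longrightarrow> \<sigma> (x + 1) < \<sigma> x" and p: "p \<le> n"
  shows "ascents (Suc n) (insert_entry p q \<sigma>) =
    ascents n \<sigma> \<union> (if \<sigma> (int p) \<le> int q then {p} else {})"
proof (rule set_eqI)
  fix i
  let ?\<rho> = "insert_entry p q \<sigma>"
  have skip_le: "skip q v < int q + 1 \<longleftrightarrow> v \<le> int q" for v by (auto simp: skip_def)
  show "i \<in> ascents (Suc n) ?\<rho> \<longleftrightarrow> i \<in> ascents n \<sigma> \<union> (if \<sigma> (int p) \<le> int q then {p} else {})"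
  proof (cases i p rule: linorder_cases)
    case less
    then show ?thesis using p insert_entry_low[of "int i" p q \<sigma>] insert_entry_low[of "int i + 1" p q \<sigma>]
      by (auto simp: ascents_def)
  next
    case equal
    have "p \<in> ascents n \<sigma> \<Longrightarrow> \<sigma> (int p) \<le> int q" using small[of "int p + 1"] by (auto simp: ascents_def)
    then show ?thesis using equal p insert_entry_low[of "int p" p q \<sigma>] skip_le[of "\<sigma> (int p)"] by (auto simp: ascents_def)
  next
    case greater
    have "i \<notin> ascents n \<sigma>" using desc[of "int i"] greater by (force simp: ascents_def)
    moreover have "i \<notin> ascents (Suc n) ?\<rho>"
    proof
      assume "i \<in> ascents (Suc n) ?\<rho>"
      then have i: "i \<le> n" and lt: "?\<rho> (int i) < ?\<rho> (int i + 1)" by (auto simp: ascents_def)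
      have r1: "?\<rho> (int i + 1) = skip q (\<sigma> (int i))" using insert_entry_high[of p "int i + 1" q \<sigma>] greater by simp
      show False
      proof (cases "i = Suc p")
        case True
        then have "?\<rho> (int i) = int q + 1" using insert_entry_at(1)[of p q \<sigma>] by (simp add: add.commute)
        then show False using lt r1 small[of "int i"] True i by (simp add: skip_def split: if_splits)
      next
        case False
        then have "?\<rho> (int i) = skip q (\<sigma> (int i - 1))" using insert_entry_high[of p "int i" q \<sigma>] greater by simp
        then show False using lt r1 desc[of "int i - 1"] False i greater by simp
      qed
    qed
    ultimately show ?thesis using greater by simp
  qed
qed

definition total_ascents :: "nat \<Rightarrow> (int \<Rightarrow> int) \<Rightarrow> nat" where
  "total_ascents n \<sigma> = \<Sum>(ascents n \<sigma>) + \<Sum>(ascents n (inv \<sigma>))"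

lemma sum_ascents_insert_entry:
  assumes "\<And>x. int p < x \<Longrightarrow> x \<le> int n \<Longrightarrow> \<sigma> x \<le> int q"
    and "\<And>x. int p < x \<Longrightarrow> x < int n \<Longrightarrow> \<sigma> (x + 1) < \<sigma> x" and "p \<le> n"
  shows "\<Sum>(ascents (Suc n) (insert_entry p q \<sigma>)) =
    \<Sum>(ascents n \<sigma>) + (if \<sigma> (int p) \<le> int q \<and> p \<notin> ascents n \<sigma> then p else 0)"
proof -
  have eq: "ascents (Suc n) (insert_entry p q \<sigma>) = ascents n \<sigma> \<union> (if \<sigma> (int p) \<le> int q then {p} else {})"
    by (rule ascents_insert_entry) (use assms in auto)
  show ?thesis unfolding eq by (simp add: insert_absorb)
qed

text \<open>The hypothesis is symmetric under inversion: it says that no position beyond \<open>p\<close> carries a value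
beyond \<open>q\<close>.\<close>

lemma inv_small:
  assumes "\<sigma> \<in> signed_perms n" and small: "\<And>x. int p < x \<Longrightarrow> x \<le> int n \<Longrightarrow> \<sigma> x \<le> int q"
    and y: "int q < y" "y \<le> int n"
  shows "inv \<sigma> y \<le> int p"
proof (rule ccontr)
  assume "\<not> inv \<sigma> y \<le> int p"
  moreover have "\<bar>inv \<sigma> y\<bar> \<le> int n" using sp_abs_le[OF sp_inv[OF assms(1)]] y by simp
  ultimately have "\<sigma> (inv \<sigma> y) \<le> int q" by (intro small) auto
  then show False using y by (simp add: sp_inv_apply[OF assms(1)])
qed

text \<open>The increase of the length depends on \<open>p + q\<close> only; how this number is split matters for the ascents
alone.\<close>

lemma stats_insert_entry:
  assumes \<sigma>: "\<sigma> \<in> signed_perms n" and pq: "p \<le> n" "q \<le> n"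
    and small: "\<And>x. int p < x \<Longrightarrow> x \<le> int n \<Longrightarrow> \<sigma> x \<le> int q"
    and desc: "\<And>x. int p < x \<Longrightarrow> x < int n \<Longrightarrow> \<sigma> (x + 1) < \<sigma> x"
    and desc': "\<And>y. int q < y \<Longrightarrow> y < int n \<Longrightarrow> inv \<sigma> (y + 1) < inv \<sigma> y"
  shows "inv_B (Suc n) (insert_entry p q \<sigma>) = inv_B n \<sigma> + (2 * n - (p + q))"
    and "total_ascents (Suc n) (insert_entry p q \<sigma>) = total_ascents n \<sigma> +
      (if \<sigma> (int p) \<le> int q \<and> p \<notin> ascents n \<sigma> then p else 0) +
      (if inv \<sigma> (int q) \<le> int p \<and> q \<notin> ascents n (inv \<sigma>) then q else 0)"
    and "Suc n - neg (Suc n) (insert_entry p q \<sigma>) = Suc (n - neg n \<sigma>)"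
proof -
  show "inv_B (Suc n) (insert_entry p q \<sigma>) = inv_B n \<sigma> + (2 * n - (p + q))"
    using twice_length_insert_entry[OF \<sigma> pq small] inv_B_eq[OF \<sigma>] inv_B_eq[OF insert_entry_signed_perms[OF \<sigma> pq]]
    by simp
  show "total_ascents (Suc n) (insert_entry p q \<sigma>) = total_ascents n \<sigma> +
      (if \<sigma> (int p) \<le> int q \<and> p \<notin> ascents n \<sigma> then p else 0) +
      (if inv \<sigma> (int q) \<le> int p \<and> q \<notin> ascents n (inv \<sigma>) then q else 0)"
    unfolding total_ascents_def inv_insert_entry[OF \<sigma>]
    using sum_ascents_insert_entry[of p n \<sigma> q, OF small desc pq(1)]
      sum_ascents_insert_entry[of q n "inv \<sigma>" p, OF inv_small[OF \<sigma> small] desc' pq(2)] by simp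
  have "neg n \<sigma> \<le> n" unfolding neg_def
    by (rule order_trans[OF card_mono[of "{1..n}"]]) auto
  then show "Suc n - neg (Suc n) (insert_entry p q \<sigma>) = Suc (n - neg n \<sigma>)"
    using neg_insert_entry[OF \<sigma> pq(1), of q] by simp
qed

text \<open>The signed permutation \<open>[-1, \<dots>, -n]\<close>, which is the longest element.\<close>

definition flip :: "nat \<Rightarrow> int \<Rightarrow> int" where
  "flip n x = (if \<bar>x\<bar> \<le> int n then - x else x)"

lemma flip_signed_perms: "flip n \<in> signed_perms n"
  by (rule signed_permsI[of "flip n"]) (auto simp: flip_def)

lemma inv_flip: "inv (flip n) = flip n"
  by (rule inv_unique) (auto simp: flip_def)

lemma neg_flip: "neg n (flip n) = n"
proof -
  have "{i \<in> {1..n}. flip n (int i) < 0} = {1..n}" by (auto simp: flip_def)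
  then show ?thesis by (simp add: neg_def)
qed

lemma total_ascents_flip: "total_ascents n (flip n) = 0"
proof -
  have "ascents n (flip n) = {}" by (auto simp: ascents_def flip_def)
  then show ?thesis by (simp add: total_ascents_def inv_flip)
qed

lemma inv_B_flip: "inv_B n (flip n) = n\<^sup>2"
proof -
  have c: "card (signed_range n) = 2 * n"
    by (simp add: signed_range_def card_Diff_singleton)
  let ?R = "signed_range n"
  let ?D = "(\<lambda>x. (x, x)) ` ?R" and ?L = "{(x, y). x \<in> ?R \<and> y \<in> ?R \<and> y < x}"
  have I: "inversions n (flip n) = {(x, y). x \<in> ?R \<and> y \<in> ?R \<and> x < y}"
    by (auto simp: inversions_def flip_def mem_signed_range)
  have "bij_betw prod.swap (inversions n (flip n)) ?L"
    by (rule bij_betwI[where g = prod.swap]) (auto simp: I)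
  then have cL: "card ?L = card (inversions n (flip n))" by (simp add: bij_betw_same_card)
  have "?R \<times> ?R = inversions n (flip n) \<union> (?D \<union> ?L)" by (auto simp: I)
  then have "card (?R \<times> ?R) = card (inversions n (flip n) \<union> (?D \<union> ?L))" by simp
  also have "\<dots> = card (inversions n (flip n)) + card (?D \<union> ?L)"
    by (rule card_Un_disjoint) (auto simp: I intro: finite_subset[of _ "?R \<times> ?R"])
  also have "card (?D \<union> ?L) = card ?D + card ?L"
    by (rule card_Un_disjoint) (auto intro: finite_subset[of _ "?R \<times> ?R"])
  also have "card ?D = 2 * n" by (simp add: card_image inj_on_def c)
  finally have "(2 * n) * (2 * n) = 2 * card (inversions n (flip n)) + 2 * n"
    by (simp add: card_cartesian_product c cL)
  then have "2 * inv_B n (flip n) = 2 * n\<^sup>2"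
    unfolding inv_B_eq[OF flip_signed_perms] twice_length_def neg_flip by (simp add: power2_eq_square)
  then show ?thesis by simp
qed

text \<open>Each of \<open>0, \<dots>, n - 1\<close> is either a descent or an ascent.\<close>

lemma fmaj_plus_ifmaj:
  assumes \<sigma>: "\<sigma> \<in> signed_perms n"
  shows "int (fmaj n \<sigma>) + int (ifmaj n \<sigma>) =
    2 * int n * (int n - 1) - 2 * int (total_ascents n \<sigma>) + 2 * int (neg n \<sigma>)"
proof -
  have gen: "2 * (\<Sum>(fDes n \<tau>) + \<Sum>(ascents n \<tau>)) + n = n * n" if \<tau>: "\<tau> \<in> signed_perms n" for \<tau>
  proof -
    have "fDes n \<tau> \<union> ascents n \<tau> = {..<n}"
      using sp_eq[OF \<tau>] by (auto simp: fDes_def ascents_def add.commute not_less le_less)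
    moreover have "fDes n \<tau> \<inter> ascents n \<tau> = {}" by (auto simp: fDes_def ascents_def add.commute)
    moreover have "finite (fDes n \<tau>)" by (simp add: fDes_def)
    ultimately have "\<Sum>(fDes n \<tau>) + \<Sum>(ascents n \<tau>) = \<Sum>{..<n}"
      by (metis finite_ascents sum.union_disjoint)
    moreover have "2 * \<Sum>{..<n} + n = n * n" by (induction n) auto
    ultimately show ?thesis by simp
  qed
  from gen[OF \<sigma>] have 1: "2 * (int (\<Sum>(fDes n \<sigma>)) + int (\<Sum>(ascents n \<sigma>))) + int n = int n * int n"
    by (metis (mono_tags) of_nat_add of_nat_mult of_nat_numeral)
  from gen[OF sp_inv[OF \<sigma>]] have 2: "2 * (int (\<Sum>(fDes n (inv \<sigma>))) + int (\<Sum>(ascents n (inv \<sigma>)))) + int n = int n * int n"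
    by (metis (mono_tags) of_nat_add of_nat_mult of_nat_numeral)
  show ?thesis
    unfolding ifmaj_def fmaj_def total_ascents_def neg_inv[OF \<sigma>] using 1 2
    by (simp add: algebra_simps)
qed

section \<open>Pattern-avoiding signed permutations\<close>

text \<open>The full word from position \<open>-n\<close> to position \<open>n\<close> has no subword ordered like \<open>312\<close> whose smallest
entry stands at a positive position.\<close>

definition avoiding :: "nat \<Rightarrow> (int \<Rightarrow> int) set" where
  "avoiding n = {\<tau> \<in> signed_perms n. \<forall>i j k. i < j \<and> 0 < j \<and> j < k \<longrightarrow> \<not> (\<tau> j < \<tau> k \<and> \<tau> k < \<tau> i)}"

text \<open>There are two kinds of insertions. If \<open>n\<close> stands at a positive position, it was the entry inserted
last. Otherwise the entries decrease from left to right, and the first entry was inserted last, unless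
it is negative. The two kinds are told apart by \<open>n \<le> t\<close> and \<open>t < n\<close>.\<close>

definition avoiding_lab :: "nat \<Rightarrow> (int \<Rightarrow> int) \<Rightarrow> nat" where
  "avoiding_lab n \<tau> = (if n = 0 then 0 else if 0 < inv \<tau> (int n) then n + nat (inv \<tau> (int n)) - 1 else nat (\<tau> 1))"

definition avoiding_grow :: "nat \<Rightarrow> nat \<Rightarrow> (int \<Rightarrow> int) \<Rightarrow> int \<Rightarrow> int" where
  "avoiding_grow n t \<tau> = (if t < n then insert_entry 0 t \<tau> else insert_entry (t - n) n \<tau>)"

lemma avoidingI:
  assumes \<tau>: "\<tau> \<in> signed_perms n"
    and av: "\<And>i j k. i < j \<Longrightarrow> 0 < j \<Longrightarrow> j < k \<Longrightarrow> k \<le> int n \<Longrightarrow> \<tau> j < \<tau> k \<Longrightarrow> \<tau> k < \<tau> i \<Longrightarrow> False"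
  shows "\<tau> \<in> avoiding n"
proof -
  have False if p: "i < j" "0 < j" "j < k" "\<tau> j < \<tau> k" "\<tau> k < \<tau> i" for i j k
  proof (cases "k \<le> int n")
    case True
    then show False using av p by blast
  next
    case False
    then have "\<tau> k = k" using sp_fix[OF \<tau>, of k] by simp
    then have "\<bar>\<tau> i\<bar> > int n" using p False by linarith
    then have "\<bar>i\<bar> > int n" using sp_abs_le[OF \<tau>, of i] by linarith
    then show False using sp_fix[OF \<tau>, of i] \<open>\<tau> k = k\<close> p by simp
  qed
  then show ?thesis using \<tau> by (auto simp: avoiding_def)
qed

lemma decreasing_avoiding:
  assumes "\<tau> \<in> signed_perms n" "\<And>j k. 0 < j \<Longrightarrow> j < k \<Longrightarrow> k \<le> int n \<Longrightarrow> \<tau> k < \<tau> j"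
  shows "\<tau> \<in> avoiding n"
  by (rule avoidingI[OF assms(1)]) (use assms(2) less_asym in blast)

text \<open>Two increasing entries to the right of the greatest value \<open>n\<close> would complete the pattern. If \<open>n\<close>
stands at a negative position, all positive positions are to its right.\<close>

lemma avoiding_decreasing:
  assumes "\<tau> \<in> avoiding n" "inv \<tau> (int n) \<le> j" "0 < j" "j < k" "k \<le> int n"
  shows "\<tau> k < \<tau> j"
proof -
  let ?v = "inv \<tau> (int n)"
  have \<tau>: "\<tau> \<in> signed_perms n" using assms by (simp add: avoiding_def)
  have v: "\<tau> ?v = int n" by (simp add: sp_inv_apply[OF \<tau>])
  have "\<tau> k \<noteq> int n" using v sp_eq[OF \<tau>, of k ?v] assms by auto
  moreover have "\<bar>\<tau> k\<bar> \<le> int n" using sp_abs_le[OF \<tau>, of k] assms by simp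
  ultimately have kn: "\<tau> k < int n" by simp
  show ?thesis
  proof (cases "?v = j")
    case False
    then have "?v < j" using assms(2) by simp
    then have "\<not> (\<tau> j < \<tau> k \<and> \<tau> k < \<tau> ?v)" using assms(1,3,4) unfolding avoiding_def by blast
    then show ?thesis using v kn sp_eq[OF \<tau>, of j k] assms by linarith
  qed (use v kn in auto)
qed

lemma decreasing_negative_eq_flip:
  assumes \<tau>: "\<tau> \<in> signed_perms n" and dec: "\<And>x. 0 < x \<Longrightarrow> x < int n \<Longrightarrow> \<tau> (x + 1) < \<tau> x" and neg: "n > 0 \<Longrightarrow> \<tau> 1 < 0"
  shows "\<tau> = flip n"
proof -
  have "flip n \<circ> \<tau> = id"
  proof (rule increasing_eq_id[of _ n])
    show "flip n \<circ> \<tau> \<in> signed_perms n" by (rule comp_signed_perms[OF flip_signed_perms \<tau>])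
    fix i assume i: "i < n"
    have "\<bar>\<tau> (int i)\<bar> \<le> int n" "\<bar>\<tau> (int i + 1)\<bar> \<le> int n" using sp_abs_le[OF \<tau>] i by auto
    then have "flip n (\<tau> (int i)) = - \<tau> (int i)" "flip n (\<tau> (int i + 1)) = - \<tau> (int i + 1)" by (simp_all add: flip_def)
    moreover have "\<tau> (int i + 1) < \<tau> (int i)"
      using dec[of "int i"] neg i sp_zero[OF \<tau>] by (cases "i = 0") auto
    ultimately show "(flip n \<circ> \<tau>) (int i) < (flip n \<circ> \<tau>) (int i + 1)" by simp
  qed
  then have "flip n (flip n (\<tau> x)) = flip n x" for x by (simp add: fun_eq_iff)
  moreover have "flip n (flip n y) = y" for y by (simp add: flip_def)
  ultimately show ?thesis by (simp add: fun_eq_iff)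
qed

lemma signed_perms_0: "signed_perms 0 = {flip 0}"
proof
  show "signed_perms 0 \<subseteq> {flip 0}"
    using decreasing_negative_eq_flip[of _ 0] by auto
qed (simp add: flip_signed_perms)

lemma delete_entry_avoiding:
  assumes "\<tau> \<in> avoiding (Suc n)" "\<tau> (int p + 1) = int q + 1" "p \<le> n"
  shows "delete_entry p q \<tau> \<in> avoiding n"
proof -
  have \<tau>: "\<tau> \<in> signed_perms (Suc n)" using assms by (simp add: avoiding_def)
  have e: "\<tau> (skip p x) = skip q (delete_entry p q \<tau> x)" for x
    by (metis insert_delete_entry[OF \<tau> assms(2)] insert_entry_skip)
  show ?thesis unfolding avoiding_def
  proof (clarify, intro conjI allI impI delete_entry_signed_perms[OF \<tau> assms(2,3)], clarify)
    fix i j k assume a: "i < j" "0 < j" "j < k" "delete_entry p q \<tau> j < delete_entry p q \<tau> k"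
      "delete_entry p q \<tau> k < delete_entry p q \<tau> i"
    then have "\<tau> (skip p j) < \<tau> (skip p k)" "\<tau> (skip p k) < \<tau> (skip p i)" by (simp_all add: e)
    moreover have "skip p i < skip p j" "0 < skip p j" "skip p j < skip p k" using a by simp_all
    ultimately show False using assms(1) unfolding avoiding_def by blast
  qed
qed

text \<open>For \<open>t < n\<close> the greatest value stands at a negative position, so the entries decrease.\<close>

lemma avoiding_early:
  assumes "\<tau> \<in> avoiding n" "avoiding_lab n \<tau> \<le> t" "t < n"
  shows "inv \<tau> (int n) < 0" "avoiding_lab n \<tau> = nat (\<tau> 1)" "\<tau> 1 \<le> int t"
    and "\<And>j k. 0 < j \<Longrightarrow> j < k \<Longrightarrow> k \<le> int n \<Longrightarrow> \<tau> k < \<tau> j"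
    and "\<And>x. 0 < x \<Longrightarrow> x \<le> int n \<Longrightarrow> \<tau> x \<le> \<tau> 1"
    and "\<And>y. \<tau> 1 < y \<Longrightarrow> 0 < y \<Longrightarrow> y \<le> int n \<Longrightarrow> inv \<tau> y < 0"
    and "\<And>y. \<tau> 1 < y \<Longrightarrow> 0 < y \<Longrightarrow> y < int n \<Longrightarrow> inv \<tau> (y + 1) < inv \<tau> y"
proof -
  have \<tau>: "\<tau> \<in> signed_perms n" using assms by (simp add: avoiding_def)
  have np: "\<not> 0 < inv \<tau> (int n)"
  proof
    assume "0 < inv \<tau> (int n)"
    then have "avoiding_lab n \<tau> = n + nat (inv \<tau> (int n)) - 1" "nat (inv \<tau> (int n)) \<ge> 1"
      using assms(3) by (auto simp: avoiding_lab_def)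
    then show False using assms(2,3) by linarith
  qed
  moreover have "inv \<tau> (int n) \<noteq> 0" using sp_eq_zero[OF sp_inv[OF \<tau>], of "int n"] assms(3) by simp
  ultimately show neg: "inv \<tau> (int n) < 0" by simp
  show lab: "avoiding_lab n \<tau> = nat (\<tau> 1)" using np assms(3) by (simp add: avoiding_lab_def)
  show "\<tau> 1 \<le> int t" using assms(2) lab by simp
  show dec: "\<tau> k < \<tau> j" if "0 < j" "j < k" "k \<le> int n" for j k
    using avoiding_decreasing[OF assms(1)] neg that by simp
  show le1: "\<tau> x \<le> \<tau> 1" if "0 < x" "x \<le> int n" for x
    using dec[of 1 x] that by (cases "x = 1") auto
  show negy: "inv \<tau> y < 0" if y: "\<tau> 1 < y" "0 < y" "y \<le> int n" for y
  proof (rule ccontr)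
    assume "\<not> inv \<tau> y < 0"
    moreover have "inv \<tau> y \<noteq> 0" using sp_eq_zero[OF sp_inv[OF \<tau>], of y] y by simp
    moreover have "\<bar>inv \<tau> y\<bar> \<le> int n" using sp_abs_le[OF sp_inv[OF \<tau>], of y] y by simp
    ultimately have "\<tau> (inv \<tau> y) \<le> \<tau> 1" by (intro le1) auto
    then show False using y by (simp add: sp_inv_apply[OF \<tau>])
  qed
  show "inv \<tau> (y + 1) < inv \<tau> y" if y: "\<tau> 1 < y" "0 < y" "y < int n" for y
  proof (rule ccontr)
    assume "\<not> inv \<tau> (y + 1) < inv \<tau> y"
    moreover have "inv \<tau> (y + 1) \<noteq> inv \<tau> y" using sp_eq[OF sp_inv[OF \<tau>]] by simp
    moreover have "\<bar>inv \<tau> y\<bar> \<le> int n" using sp_abs_le[OF sp_inv[OF \<tau>], of y] y by simp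
    ultimately have "\<tau> (- inv \<tau> y) < \<tau> (- inv \<tau> (y + 1))"
      using negy[of "y + 1"] y by (intro dec) auto
    then show False by (simp add: sp_minus[OF \<tau>] sp_inv_apply[OF \<tau>])
  qed
qed

lemma avoiding_late:
  assumes "\<tau> \<in> avoiding n" "avoiding_lab n \<tau> \<le> t" "n \<le> t" "n > 0"
  shows "inv \<tau> (int n) \<le> int (t - n) + 1"
    and "avoiding_lab n \<tau> < t \<longleftrightarrow> inv \<tau> (int n) \<le> int (t - n)"
proof -
  let ?v = "inv \<tau> (int n)"
  have \<tau>: "\<tau> \<in> signed_perms n" using assms by (simp add: avoiding_def)
  have "?v \<le> int (t - n) + 1 \<and> (avoiding_lab n \<tau> < t \<longleftrightarrow> ?v \<le> int (t - n))"
  proof (cases "0 < ?v")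
    case True
    then have "avoiding_lab n \<tau> = n + nat ?v - 1" using assms(4) by (simp add: avoiding_lab_def)
    then show ?thesis using True assms(2-4) by auto
  next
    case False
    then have l: "avoiding_lab n \<tau> = nat (\<tau> 1)" using assms(4) by (simp add: avoiding_lab_def)
    have "\<tau> 1 \<noteq> int n" using False sp_inv_apply(1)[OF \<tau>, of 1] by auto
    moreover have "\<bar>\<tau> 1\<bar> \<le> int n" using sp_abs_le[OF \<tau>, of 1] assms(4) by simp
    ultimately show ?thesis using l False assms(3,4) by auto
  qed
  then show "?v \<le> int (t - n) + 1" "avoiding_lab n \<tau> < t \<longleftrightarrow> ?v \<le> int (t - n)" by auto
qed

lemma avoiding_growth_family:
  "growth_family avoiding avoiding_lab flip avoiding_grow inv_B total_ascents (\<lambda>n \<tau>. n - neg n \<tau>)"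
proof
  fix n
  show base: "flip n \<in> avoiding n" for n by (rule decreasing_avoiding[OF flip_signed_perms]) (simp add: flip_def)
  show "avoiding 0 = {flip 0}" using base[of 0] signed_perms_0 by (auto simp: avoiding_def)
  show "avoiding_lab n (flip n) = 0" by (simp add: avoiding_lab_def inv_flip) (simp add: flip_def)
  show "inv_B n (flip n) = n\<^sup>2" by (rule inv_B_flip)
  show "total_ascents n (flip n) = 0" by (rule total_ascents_flip)
  show "n - neg n (flip n) = 0" by (simp add: neg_flip)
next
  fix \<tau> n t assume av: "\<tau> \<in> avoiding n" and t: "avoiding_lab n \<tau> \<le> t" "t \<le> 2 * n"
  have \<tau>: "\<tau> \<in> signed_perms n" using av by (simp add: avoiding_def)
  have "avoiding_grow n t \<tau> \<in> avoiding (Suc n) \<and> avoiding_lab (Suc n) (avoiding_grow n t \<tau>) = Suc t \<and>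
    inv_B (Suc n) (avoiding_grow n t \<tau>) = inv_B n \<tau> + (2 * n - t) \<and>
    total_ascents (Suc n) (avoiding_grow n t \<tau>) = total_ascents n \<tau> + (if avoiding_lab n \<tau> < t then t else 0) \<and>
    Suc n - neg (Suc n) (avoiding_grow n t \<tau>) = Suc (n - neg n \<tau>)"
  proof (cases "t < n")
    case True
    note e = avoiding_early[OF av t(1) True]
    define \<rho> where "\<rho> = insert_entry 0 t \<tau>"
    have g: "avoiding_grow n t \<tau> = \<rho>" using True by (simp add: avoiding_grow_def \<rho>_def)
    have \<rho>: "\<rho> \<in> signed_perms (Suc n)" unfolding \<rho>_def by (rule insert_entry_signed_perms[OF \<tau>]) (use True in auto)
    have \<rho>1: "\<rho> 1 = int t + 1" using insert_entry_at(1)[of 0 t \<tau>] by (simp add: \<rho>_def)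
    have \<rho>k: "\<rho> k = skip t (\<tau> (k - 1))" if "1 < k" for k unfolding \<rho>_def using that by (intro insert_entry_high) simp
    have "\<rho> \<in> avoiding (Suc n)"
    proof (rule decreasing_avoiding[OF \<rho>])
      fix j k :: int assume jk: "0 < j" "j < k" "k \<le> int (Suc n)"
      show "\<rho> k < \<rho> j"
      proof (cases "j = 1")
        case True
        have "\<tau> (k - 1) \<le> int t" using e(5)[of "k - 1"] e(3) jk by simp
        then show ?thesis using True \<rho>1 \<rho>k[of k] jk by (simp add: skip_def)
      next
        case False
        then show ?thesis using \<rho>k[of k] \<rho>k[of j] jk e(4)[of "j - 1" "k - 1"] by simp
      qed
    qed
    moreover have "avoiding_lab (Suc n) \<rho> = Suc t"
    proof -
      have "inv \<rho> (int (Suc n)) = skip 0 (inv \<tau> (int n))"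
        unfolding \<rho>_def inv_insert_entry[OF \<tau>] using insert_entry_high[of t "int (Suc n)" 0 "inv \<tau>"] True by simp
      then have "inv \<rho> (int (Suc n)) < 0" using e(1) by simp
      then show ?thesis using \<rho>1 by (simp add: avoiding_lab_def)
    qed
    moreover note st = stats_insert_entry[OF \<tau>, of 0 t]
    have small: "\<tau> x \<le> int t" if "int 0 < x" "x \<le> int n" for x using e(5)[of x] e(3) that by simp
    have desc: "\<tau> (x + 1) < \<tau> x" if "int 0 < x" "x < int n" for x using e(4)[of x "x + 1"] that by simp
    have desc': "inv \<tau> (y + 1) < inv \<tau> y" if "int t < y" "y < int n" for y using e(7)[of y] e(3) that by simp
    have "(if inv \<tau> (int t) \<le> int 0 \<and> t \<notin> ascents n (inv \<tau>) then t else 0) = (if avoiding_lab n \<tau> < t then t else 0)"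
    proof (cases "avoiding_lab n \<tau> < t")
      case lt: True
      then have "\<tau> 1 < int t" "0 < t" using e(2) by auto
      then show ?thesis using e(6)[of "int t"] e(7)[of "int t"] True lt by (auto simp: ascents_def)
    next
      case False
      then have "t = 0 \<or> \<tau> 1 = int t" using e(2) e(3) by linarith
      then have "t = 0 \<or> inv \<tau> (int t) = 1" using sp_inv_apply(1)[OF \<tau>, of 1] by auto
      then show ?thesis using False by auto
    qed
    then have "total_ascents (Suc n) \<rho> = total_ascents n \<tau> + (if avoiding_lab n \<tau> < t then t else 0)"
      using st(2)[OF _ _ small desc desc'] True by (simp add: \<rho>_def)
    moreover have "inv_B (Suc n) \<rho> = inv_B n \<tau> + (2 * n - t)" "Suc n - neg (Suc n) \<rho> = Suc (n - neg n \<tau>)"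
      using st(1,3)[OF _ _ small desc desc'] True by (simp_all add: \<rho>_def)
    ultimately show ?thesis by (simp add: g)
  next
    case False
    \<comment> \<open>the value n stands at position p + 1 or to the left of it, so the entries beyond p decrease\<close>
    define p where "p = t - n"
    have p: "p \<le> n" "t = p + n" using t False by (auto simp: p_def)
    define \<rho> where "\<rho> = insert_entry p n \<tau>"
    have g: "avoiding_grow n t \<tau> = \<rho>" using False by (simp add: avoiding_grow_def \<rho>_def p_def)
    have \<rho>: "\<rho> \<in> signed_perms (Suc n)" unfolding \<rho>_def by (rule insert_entry_signed_perms[OF \<tau>]) (use p in auto)
    have at: "\<rho> (int p + 1) = int n + 1" by (simp add: \<rho>_def)
    have dec: "\<tau> k < \<tau> j" if "int p < j" "j < k" "k \<le> int n" for j k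
      using avoiding_decreasing[OF av, of j k] avoiding_late(1)[OF av t(1)] False that by (simp add: p_def)
    have top: "\<rho> i \<le> int n + 1" if "i \<le> int n + 1" for i
      using sp_abs_le[OF \<rho>, of i] sp_fix[OF \<rho>, of i] that by (cases "\<bar>i\<bar> \<le> int n + 1") auto
    have "\<rho> \<in> avoiding (Suc n)"
    proof (rule avoidingI[OF \<rho>])
      fix i j k assume a: "i < j" "0 < j" "j < k" "k \<le> int (Suc n)" "\<rho> j < \<rho> k" "\<rho> k < \<rho> i"
      have "\<rho> i \<le> int n + 1" using top a by simp
      then have "j \<noteq> int p + 1" "k \<noteq> int p + 1" "j \<noteq> - int p - 1" "k \<noteq> - int p - 1" using a at by auto
      then obtain j' k' where s: "j = skip p j'" "k = skip p k'" by (metis skip_unskip)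
      have s': "0 < j'" "j' < k'" "\<tau> j' < \<tau> k'" "k' \<le> int n"
        using a s skip_le_iff[OF p(1)] by (auto simp: \<rho>_def)
      show False
      proof (cases i rule: skip_cases[of _ p])
        case at
        then have "int p < j'" using a s by (auto simp: skip_def split: if_splits)
        then show False using dec[of j' k'] s' by simp
      next
        case minus_at
        then have "\<rho> k < - (int n + 1)" using a(6) by (simp add: \<rho>_def)
        then show False using sp_abs_le[OF \<rho>, of k] a by simp
      next
        case (skip i')
        then have "i' < j'" "\<tau> k' < \<tau> i'" using a s by (auto simp: \<rho>_def)
        then show False using s' av unfolding avoiding_def by blast
      qed
    qed
    moreover have "avoiding_lab (Suc n) \<rho> = Suc t"
    proof -
      have "inv \<rho> (int (Suc n)) = int p + 1" using inv_eqI[OF \<rho> at] by (simp add: add.commute)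
      then show ?thesis using p by (simp add: avoiding_lab_def)
    qed
    moreover note st = stats_insert_entry[OF \<tau>, of p n]
    have small: "\<tau> x \<le> int n" if "int p < x" "x \<le> int n" for x using sp_abs_le[OF \<tau>, of x] that by simp
    have desc: "\<tau> (x + 1) < \<tau> x" if "int p < x" "x < int n" for x using dec[of x "x + 1"] that by simp
    have desc': "inv \<tau> (y + 1) < inv \<tau> y" if "int n < y" "y < int n" for y using that by simp
    have "(if \<tau> (int p) \<le> int n \<and> p \<notin> ascents n \<tau> then p else 0) +
        (if inv \<tau> (int n) \<le> int p \<and> n \<notin> ascents n (inv \<tau>) then n else 0) = (if avoiding_lab n \<tau> < t then t else 0)"
    proof (cases "n = 0")
      case True
      then show ?thesis using p t by simp
    next
      case n: False
      have \<tau>p: "\<tau> (int p) \<le> int n" using sp_abs_le[OF \<tau>, of "int p"] p by simp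
      have late: "avoiding_lab n \<tau> < t \<longleftrightarrow> inv \<tau> (int n) \<le> int p" "inv \<tau> (int n) \<le> int p + 1"
        using avoiding_late[OF av t(1)] False n by (auto simp: p_def)
      show ?thesis
      proof (cases "inv \<tau> (int n) \<le> int p")
        case True
        have "p = 0 \<or> p \<notin> ascents n \<tau>"
          using avoiding_decreasing[OF av True, of "int p + 1"] by (force simp: ascents_def)
        then show ?thesis using True late p \<tau>p by (auto simp: ascents_def)
      next
        case False
        then have v: "inv \<tau> (int n) = int p + 1" using late by simp
        then have \<tau>v: "\<tau> (int p + 1) = int n" using sp_inv_apply(2)[OF \<tau>, of "int n"] by simp
        then have "\<bar>int p + 1\<bar> \<le> int n" using sp_abs_le[OF \<tau>, of "int p + 1"] by simp
        moreover have "\<tau> (int p) \<noteq> int n" using \<tau>v sp_eq[OF \<tau>, of "int p" "int p + 1"] by auto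
        ultimately have "p \<in> ascents n \<tau>" using \<tau>p \<tau>v by (simp add: ascents_def)
        then show ?thesis using late v by simp
      qed
    qed
    then have "total_ascents (Suc n) \<rho> = total_ascents n \<tau> + (if avoiding_lab n \<tau> < t then t else 0)"
      using st(2)[OF _ _ small desc desc'] p by (simp add: \<rho>_def)
    moreover have "inv_B (Suc n) \<rho> = inv_B n \<tau> + (2 * n - t)" "Suc n - neg (Suc n) \<rho> = Suc (n - neg n \<tau>)"
      using st(1,3)[OF _ _ small desc desc'] p by (simp_all add: \<rho>_def)
    ultimately show ?thesis by (simp add: g)
  qed
  then show "avoiding_grow n t \<tau> \<in> avoiding (Suc n)" "avoiding_lab (Suc n) (avoiding_grow n t \<tau>) = Suc t"
    "inv_B (Suc n) (avoiding_grow n t \<tau>) = inv_B n \<tau> + (2 * n - t)"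
    "total_ascents (Suc n) (avoiding_grow n t \<tau>) = total_ascents n \<tau> + (if avoiding_lab n \<tau> < t then t else 0)"
    "Suc n - neg (Suc n) (avoiding_grow n t \<tau>) = Suc (n - neg n \<tau>)" by auto
next
  fix n \<tau> t \<sigma> assume "avoiding_grow n t \<tau> = avoiding_grow n t \<sigma>"
  then show "\<tau> = \<sigma>" using insert_entry_inj by (auto simp: avoiding_grow_def split: if_splits)
next
  fix n \<tau> assume av: "\<tau> \<in> avoiding (Suc n)"
  have \<tau>: "\<tau> \<in> signed_perms (Suc n)" using av by (simp add: avoiding_def)
  let ?v = "inv \<tau> (int (Suc n))"
  have \<tau>v: "\<tau> ?v = int n + 1" by (simp add: sp_inv_apply[OF \<tau>] add.commute)
  have vr: "\<bar>?v\<bar> \<le> int n + 1" "?v \<noteq> 0"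
    using sp_range[OF sp_inv[OF \<tau>], of "int (Suc n)"] by (auto simp: mem_signed_range)
  show "\<tau> = flip (Suc n) \<or> (\<exists>\<sigma>\<in>avoiding n. \<exists>t. avoiding_lab n \<sigma> \<le> t \<and> t \<le> 2 * n \<and> \<tau> = avoiding_grow n t \<sigma>)"
  proof (cases "0 < ?v")
    case True
    define p where "p = nat ?v - 1"
    have p: "?v = int p + 1" "p \<le> n" using True vr by (auto simp: p_def)
    have at: "\<tau> (int p + 1) = int n + 1" using \<tau>v p by simp
    let ?\<sigma> = "delete_entry p n \<tau>"
    have \<sigma>: "?\<sigma> \<in> avoiding n" by (rule delete_entry_avoiding[OF av at p(2)])
    have \<sigma>sp: "?\<sigma> \<in> signed_perms n" using \<sigma> by (simp add: avoiding_def)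
    have ins: "insert_entry p n ?\<sigma> = \<tau>" by (rule insert_delete_entry[OF \<tau> at])
    have "avoiding_lab n ?\<sigma> \<le> p + n"
    proof (cases "n > 0 \<and> 0 < inv ?\<sigma> (int n)")
      case True
      let ?w = "inv ?\<sigma> (int n)"
      \<comment> \<open>if n stood further right, the entry right after n + 1 would exceed it, as entries decrease after n + 1\<close>
      have "?w \<le> int p + 1"
      proof (rule ccontr)
        assume w: "\<not> ?w \<le> int p + 1"
        have "\<tau> (?w + 1) = skip n (?\<sigma> ?w)" using w insert_entry_skip[of p n ?\<sigma> ?w] by (simp add: ins skip_def)
        then have tw: "\<tau> (?w + 1) = int n" by (simp add: sp_inv_apply[OF \<sigma>sp] skip_def)
        have "\<bar>?w\<bar> \<le> int n" using sp_abs_le[OF sp_inv[OF \<sigma>sp], of "int n"] by simp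
        then have "\<tau> (?w + 1) < \<tau> (int p + 2)" using w p by (intro avoiding_decreasing[OF av]) auto
        moreover have "\<tau> (int p + 2) \<noteq> int n + 1" using at sp_eq[OF \<tau>, of "int p + 2" "int p + 1"] by auto
        moreover have "\<tau> (int p + 2) \<le> int n + 1"
          using sp_abs_le[OF \<tau>, of "int p + 2"] w \<open>\<bar>?w\<bar> \<le> int n\<close> by auto
        ultimately show False using tw by simp
      qed
      then show ?thesis using True by (simp add: avoiding_lab_def)
    next
      case False
      then have "avoiding_lab n ?\<sigma> = (if n = 0 then 0 else nat (?\<sigma> 1))" by (auto simp: avoiding_lab_def)
      moreover have "n > 0 \<Longrightarrow> \<bar>?\<sigma> 1\<bar> \<le> int n" using sp_abs_le[OF \<sigma>sp, of 1] by simp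
      ultimately show ?thesis by auto
    qed
    moreover have "\<tau> = avoiding_grow n (p + n) ?\<sigma>" using ins by (simp add: avoiding_grow_def)
    ultimately show ?thesis using \<sigma> p(2) by (intro disjI2 bexI[OF _ \<sigma>] exI[of _ "p + n"]) auto
  next
    case False
    have dec: "\<tau> k < \<tau> j" if "0 < j" "j < k" "k \<le> int (Suc n)" for j k
      using avoiding_decreasing[OF av] that False by simp
    show ?thesis
    proof (cases "\<tau> 1 < 0")
      case True
      have "\<tau> = flip (Suc n)" by (rule decreasing_negative_eq_flip[OF \<tau>]) (use dec True in auto)
      then show ?thesis ..
    next
      case pos: False
      define t where "t = nat (\<tau> 1) - 1"
      have "\<tau> 1 \<noteq> 0" using sp_eq_zero[OF \<tau>, of 1] by simp
      moreover have "\<bar>\<tau> 1\<bar> \<le> int n + 1" using sp_abs_le[OF \<tau>, of 1] by simp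
      moreover have "\<tau> 1 \<noteq> int n + 1" using \<tau>v sp_eq[OF \<tau>, of 1 ?v] False by auto
      ultimately have at1: "\<tau> 1 = int t + 1" and t: "t < n" using pos by (auto simp: t_def)
      then have at: "\<tau> (int 0 + 1) = int t + 1" by simp
      let ?\<sigma> = "delete_entry 0 t \<tau>"
      have \<sigma>: "?\<sigma> \<in> avoiding n" by (rule delete_entry_avoiding[OF av at]) simp
      have \<sigma>sp: "?\<sigma> \<in> signed_perms n" using \<sigma> by (simp add: avoiding_def)
      have ins: "insert_entry 0 t ?\<sigma> = \<tau>" by (rule insert_delete_entry[OF \<tau> at])
      have "\<not> 0 < inv ?\<sigma> (int n)"
      proof
        assume w: "0 < inv ?\<sigma> (int n)"
        have "\<tau> (skip 0 (inv ?\<sigma> (int n))) = skip t (int n)"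
          using insert_entry_skip[of 0 t ?\<sigma> "inv ?\<sigma> (int n)"] by (simp add: ins sp_inv_apply[OF \<sigma>sp])
        then have "\<tau> (skip 0 (inv ?\<sigma> (int n))) = \<tau> ?v" using t \<tau>v by (simp add: skip_def)
        then show False using w False sp_eq[OF \<tau>] by (metis skip_sign(2))
      qed
      then have "avoiding_lab n ?\<sigma> = nat (?\<sigma> 1)" using t by (simp add: avoiding_lab_def)
      moreover have "?\<sigma> 1 \<le> int t"
      proof -
        have "\<tau> 2 = skip t (?\<sigma> 1)" using insert_entry_skip[of 0 t ?\<sigma> 1] by (simp add: ins skip_def)
        moreover have "\<tau> 2 < \<tau> 1" using dec[of 1 2] t by simp
        ultimately show ?thesis using at1 by (simp add: skip_def split: if_splits)
      qed
      ultimately have "avoiding_lab n ?\<sigma> \<le> t" by simp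
      moreover have "\<tau> = avoiding_grow n t ?\<sigma>" using ins t by (simp add: avoiding_grow_def)
      ultimately show ?thesis using \<sigma> t by (intro disjI2 bexI[OF _ \<sigma>] exI[of _ t]) auto
    qed
  qed
qed

section \<open>Sortable elements\<close>

text \<open>A sorting word is read letter by letter, its inverse acting on positions. Before the letter
\<open>s\<^sub>s\<^sub>-\<^sub>1\<close> of a factor the rest of the word is a sorting word for the rotated Coxeter element
\<open>s\<^sub>s\<^sub>-\<^sub>1 \<dots> s\<^sub>0 s\<^sub>n\<^sub>-\<^sub>1 \<dots> s\<^sub>s\<close>. In it the neighbours \<open>s\<^sub>s\<close> and \<open>s\<^sub>s\<^sub>-\<^sub>1\<close> occur in the opposite order, and this
mirrors the forbidden pattern for the middle position \<open>s\<close>.\<close>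

definition stage :: "nat \<Rightarrow> nat \<Rightarrow> (int \<Rightarrow> int) set" where
  "stage n s = {\<tau> \<in> signed_perms n. \<forall>i j k. i < j \<and> 0 < j \<and> j < k \<longrightarrow>
     (if j = int s then \<not> (\<tau> k < \<tau> i \<and> \<tau> i < \<tau> j) else \<not> (\<tau> j < \<tau> k \<and> \<tau> k < \<tau> i))}"

text \<open>The parabolic subgroup of the products of generators other than \<open>s\<^sub>i\<close>, by its action on positions.\<close>

definition separated :: "nat \<Rightarrow> (int \<Rightarrow> int) \<Rightarrow> bool" where
  "separated i \<tau> \<longleftrightarrow> (\<forall>x k. x \<le> int i \<and> int i < k \<longrightarrow> \<tau> x < \<tau> k)"

lemma stage_signed_perms: "\<tau> \<in> stage n s \<Longrightarrow> \<tau> \<in> signed_perms n"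
  by (simp add: stage_def)

lemma stageD:
  assumes "\<tau> \<in> stage n s" "i < j" "0 < j" "j < k"
  shows "j = int s \<Longrightarrow> \<not> (\<tau> k < \<tau> i \<and> \<tau> i < \<tau> j)" "j \<noteq> int s \<Longrightarrow> \<not> (\<tau> j < \<tau> k \<and> \<tau> k < \<tau> i)"
  using assms unfolding stage_def by (auto split: if_splits)

lemma stageI:
  assumes "\<tau> \<in> signed_perms n"
    and "\<And>i k. i < int s \<Longrightarrow> 0 < s \<Longrightarrow> int s < k \<Longrightarrow> \<tau> k < \<tau> i \<Longrightarrow> \<tau> i < \<tau> (int s) \<Longrightarrow> False"
    and "\<And>i j k. i < j \<Longrightarrow> 0 < j \<Longrightarrow> j < k \<Longrightarrow> j \<noteq> int s \<Longrightarrow> \<tau> j < \<tau> k \<Longrightarrow> \<tau> k < \<tau> i \<Longrightarrow> False"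
  shows "\<tau> \<in> stage n s"
  using assms unfolding stage_def by auto

lemma stage_0: "stage n 0 = avoiding n"
  by (auto simp: stage_def avoiding_def)

text \<open>The position \<open>n\<close> cannot be the middle of a pattern, because nothing moves beyond it.\<close>

lemma stage_top: "stage n n = avoiding n"
proof (intro set_eqI iffI)
  fix \<tau> assume \<tau>: "\<tau> \<in> stage n n"
  show "\<tau> \<in> avoiding n"
  proof (rule avoidingI[OF stage_signed_perms[OF \<tau>]])
    fix i j k assume "i < j" "0 < j" "j < k" "k \<le> int n" "\<tau> j < \<tau> k" "\<tau> k < \<tau> i"
    then show False using stageD(2)[OF \<tau>, of i j k] by simp
  qed
next
  fix \<tau> assume \<tau>: "\<tau> \<in> avoiding n"
  then have sp: "\<tau> \<in> signed_perms n" by (simp add: avoiding_def)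
  show "\<tau> \<in> stage n n"
  proof (rule stageI[OF sp])
    fix i k assume a: "i < int n" "0 < n" "int n < k" "\<tau> k < \<tau> i" "\<tau> i < \<tau> (int n)"
    have "\<tau> k = k" using sp_fix[OF sp, of k] a by simp
    moreover have "\<tau> (int n) \<le> int n" using sp_abs_le[OF sp, of "int n"] by simp
    ultimately show False using a by simp
  next
    fix i j k assume "i < j" "0 < j" "j < k" "\<tau> j < \<tau> k" "\<tau> k < \<tau> i"
    then show False using \<tau> unfolding avoiding_def by blast
  qed
qed

lemma gen_order:
  assumes "x < j" "0 < j" "j \<noteq> int i" "j \<noteq> int i + 1"
  shows "gen i x < j" "gen i j = j"
  using assms by (auto simp: gen_eq)

lemma gen_order':
  assumes "j < k" "0 < j" "j \<noteq> int i" "j \<noteq> int i + 1"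
  shows "j < gen i k"
  using assms by (auto simp: gen_eq)

lemma gen_values:
  "i \<noteq> 0 \<Longrightarrow> gen i (int i) = int i + 1" "i \<noteq> 0 \<Longrightarrow> gen i (int i + 1) = int i"
  "int i + 1 < k \<Longrightarrow> gen i k = k" "i \<noteq> 0 \<Longrightarrow> x < int i \<Longrightarrow> gen i x < int i"
  "gen 0 1 = - 1" "1 < k \<Longrightarrow> gen 0 k = k" "x < - 1 \<Longrightarrow> gen 0 x = x" "gen 0 0 = 0" "gen 0 (- 1) = 1"
  by (auto simp: gen_eq)

text \<open>The generator exchanges the neighbouring positions \<open>i\<close> and \<open>i + 1\<close>. A pattern with one of them in
the middle becomes a pattern with the other in the middle, and patterns with another middle are not
affected. For \<open>i = 0\<close> the patterns at the middle position \<open>1\<close> are exchanged by the reflection of the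
full word.\<close>

lemma stage_gen_up:
  assumes \<rho>: "\<rho> \<in> stage n i" and i: "i < n" and asc: "\<rho> (int i) < \<rho> (int i + 1)"
  shows "\<rho> \<circ> gen i \<in> stage n (Suc i)"
proof -
  have sp: "\<rho> \<in> signed_perms n" by (rule stage_signed_perms[OF \<rho>])
  let ?a = "int i" and ?b = "int i + 1"
  have b: "int (Suc i) = ?b" by simp
  show ?thesis
  proof (rule stageI[OF comp_signed_perms[OF sp gen_signed_perms[OF i]]], unfold b comp_apply)
    fix x k assume h: "x < ?b" "?b < k" "\<rho> (gen i k) < \<rho> (gen i x)" "\<rho> (gen i x) < \<rho> (gen i ?b)"
    have gk: "gen i k = k" using h gen_values by simp
    show False
    proof (cases "i = 0")
      case False
      have "x \<noteq> ?a" using h asc gen_values(1,2)[OF False] by auto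
      then have "gen i x < ?a" using h gen_values(4)[of i x] False by simp
      then show False using stageD(1)[OF \<rho>, of "gen i x" ?a k] h False gk gen_values(2)[of i] by simp
    next
      case True
      have m: "\<rho> (- y) = - \<rho> y" for y by (rule sp_minus[OF sp])
      have \<rho>1: "0 < \<rho> 1" using asc True sp_zero[OF sp] by simp
      have hx: "\<rho> (gen 0 x) < - \<rho> 1" using h True m[of 1] gen_values(5) by simp
      have "x \<noteq> 0" "x \<noteq> - 1" using hx \<rho>1 sp_zero[OF sp] gen_values(8,9) by auto
      then have x: "x < - 1" using h True by simp
      then have gx: "gen 0 x = x" by (rule gen_values)
      \<comment> \<open>the reflected positions -k < 1 < -x form a pattern\<close>
      have "\<not> (\<rho> 1 < \<rho> (- x) \<and> \<rho> (- x) < \<rho> (- k))"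
        using stageD(2)[OF \<rho>, of "- k" 1 "- x"] x h True by simp
      then show False using hx gx h(3) gk True m[of x] m[of k] by simp
    qed
  next
    fix x j k assume h: "x < j" "0 < j" "j < k" "j \<noteq> ?b" "\<rho> (gen i j) < \<rho> (gen i k)" "\<rho> (gen i k) < \<rho> (gen i x)"
    show False
    proof (cases "j = ?a")
      case True
      then have i0: "i \<noteq> 0" using h by simp
      have "k \<noteq> ?b" using h True asc gen_values(1,2)[OF i0] by auto
      then have gk: "?b < k" "gen i k = k" using h True gen_values(3)[of i k] by auto
      have "gen i x < ?b" using gen_values(4)[OF i0, of x] h True by simp
      then show False using stageD(2)[OF \<rho>, of "gen i x" ?b k] h True gk gen_values(1)[OF i0] by simp
    next
      case False
      note o = gen_order[of x j i, OF h(1,2) False h(4)] gen_order'[of j k i, OF h(3,2) False h(4)]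
      then show False using stageD(2)[OF \<rho> o(1) h(2) o(3)] False h by simp
    qed
  qed
qed

text \<open>A pattern with middle \<open>i\<close> or \<open>i + 1\<close> contains an inversion across the gap between these positions.\<close>

lemma stage_separated_up:
  assumes \<rho>: "\<rho> \<in> stage n i" and sep: "separated i \<rho>"
  shows "\<rho> \<in> stage n (Suc i)"
proof (rule stageI[OF stage_signed_perms[OF \<rho>]])
  fix x k assume h: "x < int (Suc i)" "int (Suc i) < k" "\<rho> k < \<rho> x"
  then show False using sep[unfolded separated_def, rule_format, of x k] by simp
next
  fix x j k assume h: "x < j" "0 < j" "j < k" "j \<noteq> int (Suc i)" "\<rho> j < \<rho> k" "\<rho> k < \<rho> x"
  show False
  proof (cases "j = int i")
    case True
    then show False using sep[unfolded separated_def, rule_format, of x k] h by simp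
  next
    case False
    then show False using stageD(2)[OF \<rho> h(1-3)] h by simp
  qed
qed

lemma stage_gen_down:
  assumes \<tau>: "\<tau> \<in> stage n (Suc i)" and i: "i < n" and desc: "\<tau> (int i + 1) < \<tau> (int i)"
  shows "\<tau> \<circ> gen i \<in> stage n i"
proof -
  have sp: "\<tau> \<in> signed_perms n" by (rule stage_signed_perms[OF \<tau>])
  let ?a = "int i" and ?b = "int i + 1"
  have b: "int (Suc i) = ?b" by simp
  show ?thesis
  proof (rule stageI[OF comp_signed_perms[OF sp gen_signed_perms[OF i]]], unfold comp_apply)
    fix x k assume h: "x < ?a" "0 < i" "?a < k" "\<tau> (gen i k) < \<tau> (gen i x)" "\<tau> (gen i x) < \<tau> (gen i ?a)"
    then have i0: "i \<noteq> 0" by simp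
    have "k \<noteq> ?b" using h desc gen_values(1,2)[OF i0] by auto
    then have gk: "?b < k" "gen i k = k" using h gen_values(3)[of i k] by auto
    have "gen i x < ?b" using gen_values(4)[OF i0, of x] h by simp
    then show False using stageD(1)[OF \<tau>, of "gen i x" ?b k] h gk gen_values(1)[OF i0] by simp
  next
    fix x j k assume h: "x < j" "0 < j" "j < k" "j \<noteq> ?a" "\<tau> (gen i j) < \<tau> (gen i k)" "\<tau> (gen i k) < \<tau> (gen i x)"
    show False
    proof (cases "j = ?b")
      case True
      have gk: "gen i k = k" using h True gen_values by simp
      show False
      proof (cases "i = 0")
        case False
        have "x \<noteq> ?a" using h True desc gen_values(1,2)[OF False] by auto
        then have gx: "gen i x < ?a" using h True gen_values(4)[OF False, of x] by simp
        then show False using stageD(2)[OF \<tau>, of "gen i x" ?a k] h True gk False gen_values(2)[OF False] by simp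
      next
        case i0: True
        have m: "\<tau> (- y) = - \<tau> y" for y by (rule sp_minus[OF sp])
        have \<tau>1: "\<tau> 1 < 0" using desc i0 sp_zero[OF sp] by simp
        have hk: "- \<tau> 1 < \<tau> k" using h(5) True gk i0 m[of 1] gen_values(5) by simp
        have "x \<noteq> 0" "x \<noteq> - 1" using h(6) hk \<tau>1 gk sp_zero[OF sp] gen_values(8,9) i0 by auto
        then have x: "x < - 1" using h(1) True i0 by simp
        then have gx: "gen 0 x = x" by (rule gen_values)
        have "\<not> (\<tau> (- x) < \<tau> (- k) \<and> \<tau> (- k) < \<tau> 1)"
          using stageD(1)[OF \<tau>, of "- k" 1 "- x"] x h(2,3) True i0 by simp
        then show False using hk gx h(6) gk i0 m[of x] m[of k] by simp
      qed
    next
      case False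
      note o = gen_order[of x j i, OF h(1,2,4) False] gen_order'[of j k i, OF h(3,2,4) False]
      then show False using stageD(2)[OF \<tau> o(1) h(2) o(3)] False h by simp
    qed
  qed
qed

text \<open>If the next letter cannot be removed, it does not occur in the rest of the word: an inversion across
the gap after position \<open>i\<close> would form a forbidden pattern with the entries at \<open>i\<close> and \<open>i + 1\<close>.\<close>

lemma stage_ascent_separated:
  assumes \<tau>: "\<tau> \<in> stage n (Suc i)" and asc: "\<tau> (int i) < \<tau> (int i + 1)"
  shows "separated i \<tau>" "\<tau> \<in> stage n i"
proof -
  have sp: "\<tau> \<in> signed_perms n" by (rule stage_signed_perms[OF \<tau>])
  let ?a = "int i" and ?b = "int i + 1"
  note neq = sp_eq[OF sp]
  have low: "\<tau> ?a < \<tau> k" if "?b \<le> k" for k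
    using that asc stageD(1)[OF \<tau>, of ?a ?b k] neq[of k ?a] by (cases "k = ?b") auto
  have "\<tau> x < \<tau> k" if "x \<le> ?a" "?a < k" for x k
  proof (cases "i = 0")
    case True
    have pos: "0 < \<tau> y" if "0 < y" for y using low[of y] True that sp_zero[OF sp] by simp
    have "\<tau> x \<le> 0" using pos[of "- x"] sp_minus[OF sp, of x] sp_zero[OF sp] that True by (cases "x = 0") auto
    then show ?thesis using pos[of k] that True by simp
  next
    case False
    show ?thesis
    proof (cases "x = ?a")
      case False
      then have "\<not> (\<tau> ?a < \<tau> k \<and> \<tau> k < \<tau> x)" using stageD(2)[OF \<tau>, of x ?a k] that \<open>i \<noteq> 0\<close> by simp
      then show ?thesis using low[of k] that neq[of x k] by auto
    qed (use low that in auto)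
  qed
  then show sep: "separated i \<tau>" by (simp add: separated_def)
  show "\<tau> \<in> stage n i"
  proof (rule stageI[OF sp])
    fix x k assume "x < ?a" "?a < k" "\<tau> k < \<tau> x"
    then show False using sep[unfolded separated_def, rule_format, of x k] by simp
  next
    fix x j k assume h: "x < j" "0 < j" "j < k" "j \<noteq> ?a" "\<tau> j < \<tau> k" "\<tau> k < \<tau> x"
    show False
    proof (cases "j = ?b")
      case True
      then show False using sep[unfolded separated_def, rule_format, of x k] h by simp
    next
      case False
      then show False using stageD(2)[OF \<tau> h(1-3)] h by simp
    qed
  qed
qed

lemma separated_gen: "separated i \<tau> \<Longrightarrow> j \<noteq> i \<Longrightarrow> separated i (\<tau> \<circ> gen j)"
  unfolding separated_def by (auto simp: gen_eq)

lemma separated_not_descent: "separated i \<tau> \<Longrightarrow> \<tau> (int i) < \<tau> (int i + 1)"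
  by (simp add: separated_def)

text \<open>Inverting turns a letter at the front of a word into a generator acting on positions.\<close>

definition word_inv :: "nat list \<Rightarrow> int \<Rightarrow> int" where
  "word_inv w = inv (word_prod w)"

lemma word_inv_Nil [simp]: "word_inv [] = id"
  by (simp add: word_inv_def)

lemma word_inv_Cons:
  assumes "set w \<subseteq> {..<n}" "i < n"
  shows "word_inv (i # w) = word_inv w \<circ> gen i"
proof -
  have "bij (gen i)" "bij (word_prod w)"
    using sp_bij[OF gen_signed_perms[OF assms(2)]] sp_bij[OF word_prod_signed_perms[OF assms(1)]] .
  then show ?thesis unfolding word_inv_def by (simp add: o_inv_distrib inv_gen)
qed

lemma word_inv_signed_perms: "set w \<subseteq> {..<n} \<Longrightarrow> word_inv w \<in> signed_perms n"
  unfolding word_inv_def by (intro sp_inv word_prod_signed_perms)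

definition reduced :: "nat \<Rightarrow> nat list \<Rightarrow> bool" where
  "reduced n w \<longleftrightarrow> 2 * length w = twice_length n (word_inv w)"

lemma reduced_iff_inv_B:
  assumes "set w \<subseteq> {..<n}"
  shows "reduced n w \<longleftrightarrow> length w = inv_B n (word_prod w)"
  unfolding reduced_def word_inv_def twice_length_inv[OF word_prod_signed_perms[OF assms]]
    inv_B_eq[OF word_prod_signed_perms[OF assms], symmetric] by simp

lemma reduced_ConsD:
  assumes "reduced n (i # w)" "set w \<subseteq> {..<n}" "i < n"
  shows "reduced n w" "word_inv w (int i) < word_inv w (int i + 1)"
proof -
  let ?\<rho> = "word_inv w"
  have \<rho>: "?\<rho> \<in> signed_perms n" by (rule word_inv_signed_perms[OF assms(2)])
  have le: "twice_length n ?\<rho> \<le> 2 * length w"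
    unfolding word_inv_def twice_length_inv[OF word_prod_signed_perms[OF assms(2)]]
    by (rule twice_length_word_le[OF assms(2)])
  have l: "2 * length w + 2 = twice_length n (?\<rho> \<circ> gen i)"
    using assms(1) by (simp add: reduced_def word_inv_Cons[OF assms(2,3)])
  have "\<not> ?\<rho> (int i + 1) < ?\<rho> (int i)" using twice_length_gen_down[OF \<rho> assms(3)] l le by linarith
  then show "?\<rho> (int i) < ?\<rho> (int i + 1)" using sp_eq[OF \<rho>, of "int i" "int i + 1"] by linarith
  then show "reduced n w" using twice_length_gen_up[OF \<rho> assms(3)] l by (simp add: reduced_def)
qed

lemma separated_word: "set w \<subseteq> {..<n} \<Longrightarrow> i \<notin> set w \<Longrightarrow> separated i (word_inv w)"
proof (induction w)
  case Nil
  then show ?case by (simp add: separated_def)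
next
  case (Cons j w)
  then have "separated i (word_inv w \<circ> gen j)" by (intro separated_gen) auto
  moreover have "word_inv (j # w) = word_inv w \<circ> gen j" by (rule word_inv_Cons) (use Cons.prems in auto)
  ultimately show ?case by metis
qed

text \<open>A factor is treated from its end, that is, from the smallest letters. A letter that is missing from
the factor is missing from all later factors, too.\<close>

lemma block_stage:
  assumes rest: "set w \<subseteq> {..<n}" "set w \<subseteq> S" "word_inv w \<in> avoiding n"
  shows "s \<le> n \<Longrightarrow> reduced n (filter (\<lambda>i. i \<in> S) (rev [0..<s]) @ w) \<Longrightarrow>
    word_inv (filter (\<lambda>i. i \<in> S) (rev [0..<s]) @ w) \<in> stage n s"
proof (induction s)
  case 0
  then show ?case using rest(3) by (simp add: stage_0)
next
  case (Suc s)
  let ?W = "filter (\<lambda>i. i \<in> S) (rev [0..<s]) @ w"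
  have W: "set ?W \<subseteq> {..<n}" using rest(1) Suc.prems(1) by auto
  show ?case
  proof (cases "s \<in> S")
    case True
    then have e: "filter (\<lambda>i. i \<in> S) (rev [0..<Suc s]) @ w = s # ?W" by simp
    note r = reduced_ConsD[OF Suc.prems(2)[unfolded e] W]
    show ?thesis unfolding e word_inv_Cons[OF W, of s, OF Suc_le_lessD[OF Suc.prems(1)]]
      using Suc.IH r Suc.prems(1) by (intro stage_gen_up) auto
  next
    case False
    then have e: "filter (\<lambda>i. i \<in> S) (rev [0..<Suc s]) @ w = ?W" by simp
    have "s \<notin> set ?W" using False rest(2) by auto
    then show ?thesis unfolding e using Suc e separated_word[OF W]
      by (intro stage_separated_up) auto
  qed
qed

lemma subseq_subset: "subseq X L \<Longrightarrow> set X \<subseteq> set L"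
  by (auto elim: list_emb_set)

lemma subseq_distinct_filter:
  assumes "subseq X L" "distinct L"
  shows "X = filter (\<lambda>i. i \<in> set X) L"
  using assms
proof (induction X L rule: list_emb.induct)
  case (list_emb_Nil ys)
  then show ?case by simp
next
  case (list_emb_Cons xs ys y)
  have "y \<notin> set xs" using list_emb_Cons subseq_subset[of xs ys] by auto
  then show ?case using list_emb_Cons by simp
next
  case (list_emb_Cons2 x y xs ys)
  then have "filter (\<lambda>i. i \<in> set (x # xs)) ys = filter (\<lambda>i. i \<in> set xs) ys" by (intro filter_cong) auto
  then show ?case using list_emb_Cons2 by simp
qed

text \<open>The stages at the beginning and at the end of a factor are the same condition, so that one factor
after the other can be put in front.\<close>

lemma sortable_word_avoiding:
  assumes "\<forall>X\<in>set Xs. subseq X (rev [0..<n])" "sorted_wrt (\<lambda>X Y. set Y \<subseteq> set X) Xs" "reduced n (concat Xs)"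
  shows "word_inv (concat Xs) \<in> avoiding n"
  using assms
proof (induction Xs)
  case Nil
  have "id \<in> avoiding n" by (rule avoidingI[OF id_signed_perms]) simp
  then show ?case unfolding concat.simps word_inv_Nil .
next
  case (Cons X Xs)
  let ?w = "concat Xs"
  have X: "X = filter (\<lambda>i. i \<in> set X) (rev [0..<n])" using Cons.prems by (intro subseq_distinct_filter) auto
  have sub: "set Y \<subseteq> {..<n}" if "Y \<in> set (X # Xs)" for Y
  proof -
    have "subseq Y (rev [0..<n])" using Cons.prems(1) that by blast
    then have "set Y \<subseteq> set (rev [0..<n])" by (rule subseq_subset)
    then show ?thesis by (simp add: atLeast0LessThan)
  qed
  have w: "set ?w \<subseteq> {..<n}" using sub by fastforce
  have wX: "set ?w \<subseteq> set X" using Cons.prems(2) by auto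
  have "reduced n ?w" if "reduced n (Y @ ?w)" "set Y \<subseteq> {..<n}" for Y
    using that
  proof (induction Y)
    case (Cons y Y)
    have "reduced n (Y @ ?w)" by (rule reduced_ConsD(1)[of n y]) (use Cons.prems w in auto)
    then show ?case using Cons by simp
  qed simp
  then have "reduced n ?w" using Cons.prems(3) sub[of X] by simp
  then have "word_inv ?w \<in> avoiding n" using Cons by simp
  then have "word_inv (filter (\<lambda>i. i \<in> set X) (rev [0..<n]) @ ?w) \<in> stage n n"
    using block_stage[OF w wX, of n] Cons.prems(3) X by simp
  then show ?case using X by (simp add: stage_top)
qed

section \<open>The number of factors of a sorting word\<close>

definition later_smaller :: "nat \<Rightarrow> (int \<Rightarrow> int) \<Rightarrow> int \<Rightarrow> int set" where
  "later_smaller n \<tau> x = {y. x < y \<and> y \<le> int n \<and> \<tau> y < \<tau> x}"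

definition above :: "nat \<Rightarrow> (int \<Rightarrow> int) \<Rightarrow> int \<Rightarrow> int set" where
  "above n \<tau> v = {y. 0 < y \<and> y \<le> int n \<and> v < \<tau> y}"

text \<open>Removing a whole factor is one sweep of bubble sort from right to left: the minimum is carried to
position \<open>1\<close>, and there it is negated if it is negative. The predicate describes the sweep that leaves
\<open>m\<close> further ones, when the positions beyond \<open>s\<close> are done. Each sweep removes one smaller entry to the
right of every entry that has any. A negated entry exceeds the absolute values of all entries that are
still negative; so with every sweep there are more entries that will exceed the next negated one, and
the second conjunct bounds their number from below. The case \<open>s = 0\<close> is the state between two sweeps.\<close>

definition bubble_stage :: "nat \<Rightarrow> nat \<Rightarrow> nat \<Rightarrow> (int \<Rightarrow> int) \<Rightarrow> bool" where
  "bubble_stage n m s \<tau> \<longleftrightarrow>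
     (\<forall>x. 0 < x \<and> x \<le> int n \<longrightarrow>
        (if x < int s then card (later_smaller n \<tau> x) \<le> Suc m
         else if x = int s then later_smaller n \<tau> x = {}
         else card (later_smaller n \<tau> x) \<le> m)) \<and>
     (\<forall>x. 0 < x \<and> x \<le> int n \<and> \<tau> x < 0 \<longrightarrow> n \<le> card (above n \<tau> (- \<tau> x)) + (if s = 0 then m else Suc m))"

lemma finite_later_smaller [simp]: "finite (later_smaller n \<tau> x)"
  by (rule finite_subset[of _ "{x..int n}"]) (auto simp: later_smaller_def)

lemma finite_above [simp]: "finite (above n \<tau> v)"
  by (rule finite_subset[of _ "{0..int n}"]) (auto simp: above_def)

lemma bubble_stage_start:
  assumes "bubble_stage n (Suc m) 0 \<tau>"
  shows "bubble_stage n m n \<tau>"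
proof -
  have "later_smaller n \<tau> (int n) = {}" by (auto simp: later_smaller_def)
  with assms show ?thesis unfolding bubble_stage_def by (auto split: if_splits)
qed

lemma above_gen:
  assumes "i \<noteq> 0" "i < n"
  shows "card (above n (\<tau> \<circ> gen i) v) = card (above n \<tau> v)"
proof (rule bij_betw_same_card)
  show "bij_betw (gen i) (above n (\<tau> \<circ> gen i) v) (above n \<tau> v)"
  proof (rule bij_betwI[where g = "gen i"])
    have g: "0 < gen i y \<and> gen i y \<le> int n \<longleftrightarrow> 0 < y \<and> y \<le> int n" for y using assms by (auto simp: gen_eq)
    show "gen i \<in> above n (\<tau> \<circ> gen i) v \<rightarrow> above n \<tau> v" using g by (simp add: above_def Pi_iff)
    show "gen i \<in> above n \<tau> v \<rightarrow> above n (\<tau> \<circ> gen i) v" using g by (simp add: above_def Pi_iff)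
  qed simp_all
qed

lemma later_smaller_gen_low:
  assumes "0 < x" "x < int i" "i < n"
  shows "card (later_smaller n (\<tau> \<circ> gen i) x) = card (later_smaller n \<tau> x)"
proof (rule bij_betw_same_card)
  have gx: "gen i x = x" using assms by (simp add: gen_eq)
  have g: "x < gen i y \<and> gen i y \<le> int n \<longleftrightarrow> x < y \<and> y \<le> int n" for y using assms by (auto simp: gen_eq)
  show "bij_betw (gen i) (later_smaller n (\<tau> \<circ> gen i) x) (later_smaller n \<tau> x)"
  proof (rule bij_betwI[where g = "gen i"])
    show "gen i \<in> later_smaller n (\<tau> \<circ> gen i) x \<rightarrow> later_smaller n \<tau> x"
      using g by (simp add: later_smaller_def Pi_iff gx)
    show "gen i \<in> later_smaller n \<tau> x \<rightarrow> later_smaller n (\<tau> \<circ> gen i) x"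
      using g by (simp add: later_smaller_def Pi_iff gx)
  qed simp_all
qed

lemma later_smaller_gen_high:
  assumes "int i + 1 < x"
  shows "later_smaller n (\<tau> \<circ> gen i) x = later_smaller n \<tau> x"
  using assms by (auto simp: later_smaller_def gen_values(3))

text \<open>The entry at \<open>i + 1\<close> is the minimum of the positions from \<open>i + 1\<close> on. It either passes the entry at
\<open>i\<close> or leaves it as the new minimum.\<close>

lemma bubble_stage_step:
  assumes \<tau>: "\<tau> \<in> signed_perms n" and i: "i < n" and B: "bubble_stage n m (Suc i) \<tau>"
  shows "\<tau> (int i + 1) < \<tau> (int i) \<Longrightarrow> bubble_stage n m i (\<tau> \<circ> gen i)"
    and "\<tau> (int i) < \<tau> (int i + 1) \<Longrightarrow> bubble_stage n m i \<tau>"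
proof -
  let ?b = "int i + 1"
  have R: "card (later_smaller n \<tau> x) \<le> Suc m" if "0 < x" "x \<le> int i" for x
    using B[unfolded bubble_stage_def, THEN conjunct1, rule_format, of x] i that by simp
  have Rb: "later_smaller n \<tau> ?b = {}"
    using B[unfolded bubble_stage_def, THEN conjunct1, rule_format, of ?b] i by simp
  have Rh: "card (later_smaller n \<tau> x) \<le> m" if "?b < x" "x \<le> int n" for x
    using B[unfolded bubble_stage_def, THEN conjunct1, rule_format, of x] i that by simp
  have N: "n \<le> card (above n \<tau> (- \<tau> x)) + Suc m" if "0 < x" "x \<le> int n" "\<tau> x < 0" for x
    using B[unfolded bubble_stage_def, THEN conjunct2, rule_format, of x] that by simp
  have min: "\<tau> ?b \<le> \<tau> y" if "?b \<le> y" "y \<le> int n" for y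
    using Rb that by (cases "y = ?b") (force simp: later_smaller_def)+
  show "bubble_stage n m i (\<tau> \<circ> gen i)" if d: "\<tau> ?b < \<tau> (int i)"
  proof (cases "i = 0")
    case i0: False
    let ?\<rho> = "\<tau> \<circ> gen i"
    have \<rho>i: "?\<rho> (int i) = \<tau> ?b" "?\<rho> ?b = \<tau> (int i)" using gen_values(1,2)[OF i0] by auto
    have Ri: "later_smaller n ?\<rho> (int i) = {}"
    proof -
      have "\<not> ?\<rho> y < ?\<rho> (int i)" if "int i < y" "y \<le> int n" for y
        using min[of y] that d \<rho>i gen_values(3)[of i y] by (cases "y = ?b") auto
      then show ?thesis by (auto simp: later_smaller_def)
    qed
    have Rb': "card (later_smaller n ?\<rho> ?b) \<le> m"
    proof -
      have "later_smaller n \<tau> (int i) = insert ?b (later_smaller n ?\<rho> ?b)"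
        using i d \<rho>i gen_values(3)[of i] by (auto simp: later_smaller_def)
      moreover have "?b \<notin> later_smaller n ?\<rho> ?b" by (simp add: later_smaller_def)
      ultimately have "card (later_smaller n \<tau> (int i)) = Suc (card (later_smaller n ?\<rho> ?b))" by simp
      then show ?thesis using R[of "int i"] i0 by simp
    qed
    have N': "n \<le> card (above n ?\<rho> (- ?\<rho> x)) + Suc m" if "0 < x" "x \<le> int n" "?\<rho> x < 0" for x
    proof -
      have "0 < gen i x" "gen i x \<le> int n" using that i i0 by (auto simp: gen_eq)
      then show ?thesis using N[of "gen i x"] that above_gen[OF i0 i] by simp
    qed
    show ?thesis unfolding bubble_stage_def
    proof (intro conjI allI impI)
      fix x assume x: "0 < x \<and> x \<le> int n"
      consider "x < int i" | "x = int i" | "x = ?b" | "?b < x" by linarith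
      then show "if x < int i then card (later_smaller n ?\<rho> x) \<le> Suc m
         else if x = int i then later_smaller n ?\<rho> x = {} else card (later_smaller n ?\<rho> x) \<le> m"
      proof cases
        case 1
        then show ?thesis using later_smaller_gen_low[of x i n \<tau>] R[of x] x i by simp
      next
        case 2
        then show ?thesis using Ri by simp
      next
        case 3
        then show ?thesis using Rb' by simp
      next
        case 4
        then show ?thesis using later_smaller_gen_high[of i x n \<tau>] Rh[of x] x by simp
      qed
    qed (use N' i0 in simp)
  next
    case i0: True
    let ?\<rho> = "\<tau> \<circ> gen 0"
    have d1: "\<tau> 1 < 0" using d i0 sp_zero[OF \<tau>] by simp
    have \<rho>1: "?\<rho> 1 = - \<tau> 1" using gen_values(5) sp_minus[OF \<tau>, of 1] by simp
    have \<rho>x: "?\<rho> x = \<tau> x" if "1 < x" for x using gen_values(6)[OF that] by simp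
    have lt: "\<tau> 1 < \<tau> x" if "1 < x" "x \<le> int n" for x
      using min[of x] sp_eq[OF \<tau>, of 1 x] that i0 by fastforce
    have ab: "above n \<tau> v \<subseteq> {2..int n}" if "0 \<le> v" for v
    proof
      fix y assume "y \<in> above n \<tau> v"
      then have "0 < y" "y \<le> int n" "v < \<tau> y" by (auto simp: above_def)
      moreover have "y \<noteq> 1" using \<open>v < \<tau> y\<close> that d1 by auto
      ultimately show "y \<in> {2..int n}" by simp
    qed
    have R1: "card (later_smaller n ?\<rho> 1) \<le> m"
    proof -
      have "later_smaller n ?\<rho> 1 \<inter> above n \<tau> (- \<tau> 1) = {}"
        using \<rho>1 \<rho>x by (auto simp: later_smaller_def above_def)
      moreover have "later_smaller n ?\<rho> 1 \<union> above n \<tau> (- \<tau> 1) \<subseteq> {2..int n}"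
        using ab[of "- \<tau> 1"] d1 by (auto simp: later_smaller_def)
      ultimately have "card (later_smaller n ?\<rho> 1) + card (above n \<tau> (- \<tau> 1)) \<le> card {2..int n}"
        by (metis card_Un_disjoint card_mono finite_above finite_atLeastAtMost_int finite_later_smaller)
      moreover have "n \<le> card (above n \<tau> (- \<tau> 1)) + Suc m" using N[of 1] d1 i by simp
      ultimately show ?thesis using i by simp
    qed
    have N': "n \<le> card (above n ?\<rho> (- ?\<rho> x)) + m" if x: "0 < x" "x \<le> int n" "?\<rho> x < 0" for x
    proof -
      have x1: "1 < x" using x \<rho>1 d1 by (cases "x = 1") auto
      then have "insert 1 (above n \<tau> (- \<tau> x)) \<subseteq> above n ?\<rho> (- ?\<rho> x)"
        using lt[of x] x \<rho>1 \<rho>x ab[of "- \<tau> x"] by (fastforce simp: above_def)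
      moreover have "1 \<notin> above n \<tau> (- \<tau> x)" using ab[of "- \<tau> x"] x \<rho>x[OF x1] by auto
      ultimately have "Suc (card (above n \<tau> (- \<tau> x))) \<le> card (above n ?\<rho> (- ?\<rho> x))"
        by (metis card_insert_disjoint card_mono finite_above)
      then show ?thesis using N[of x] x \<rho>x[OF x1] by simp
    qed
    show ?thesis unfolding bubble_stage_def i0
    proof (intro conjI allI impI)
      fix x assume x: "0 < x \<and> x \<le> int n"
      show "if x < int 0 then card (later_smaller n ?\<rho> x) \<le> Suc m
         else if x = int 0 then later_smaller n ?\<rho> x = {} else card (later_smaller n ?\<rho> x) \<le> m"
      proof (cases "x = 1")
        case False
        then have "1 < x" using x by simp
        then show ?thesis using later_smaller_gen_high[of 0 x n \<tau>] Rh[of x] x i0 by simp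
      qed (use R1 in simp)
    qed (use N' in simp)
  qed
  show "bubble_stage n m i \<tau>" if d: "\<tau> (int i) < \<tau> ?b"
  proof -
    have "\<not> \<tau> y < \<tau> (int i)" if "int i < y" "y \<le> int n" for y using min[of y] d that by simp
    then have Ri: "later_smaller n \<tau> (int i) = {}" by (auto simp: later_smaller_def)
    have "\<not> \<tau> x < 0" if "i = 0" "0 < x" "x \<le> int n" for x using min[of x] d that sp_zero[OF \<tau>] by simp
    moreover have "card (later_smaller n \<tau> x) \<le> m" if "int i < x" "x \<le> int n" for x
      using that Rb Rh[of x] by (cases "x = ?b") auto
    ultimately show ?thesis unfolding bubble_stage_def using R N Ri by auto
  qed
qed

lemma bubble_done:
  assumes \<tau>: "\<tau> \<in> signed_perms n" and B: "bubble_stage n 0 0 \<tau>"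
  shows "\<tau> = id"
proof (rule increasing_eq_id[OF \<tau>])
  have R: "later_smaller n \<tau> x = {}" if "0 < x" "x \<le> int n" for x
    using B that unfolding bubble_stage_def by auto
  fix i assume i: "i < n"
  show "\<tau> (int i) < \<tau> (int i + 1)"
  proof (cases "i = 0")
    case False
    then have "int i + 1 \<notin> later_smaller n \<tau> (int i)" using R[of "int i"] i by simp
    then show ?thesis using i sp_eq[OF \<tau>, of "int i" "int i + 1"] by (simp add: later_smaller_def)
  next
    case True
    have "\<not> \<tau> 1 < 0"
    proof
      assume neg: "\<tau> 1 < 0"
      then have "n \<le> card (above n \<tau> (- \<tau> 1))" using B i unfolding bubble_stage_def by force
      moreover have "above n \<tau> (- \<tau> 1) \<subseteq> {1..int n} - {1}" using neg by (auto simp: above_def)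
      then have "card (above n \<tau> (- \<tau> 1)) \<le> card ({1..int n} - {1})" by (intro card_mono) auto
      ultimately show False using i by (simp add: card_Diff_singleton)
    qed
    then show ?thesis using True sp_zero[OF \<tau>] sp_eq_zero[OF \<tau>, of 1] by simp
  qed
qed

lemma bubble_initial: "bubble_stage n n 0 \<tau>"
proof -
  have "card (later_smaller n \<tau> x) \<le> n" if "0 < x" "x \<le> int n" for x
  proof -
    have "card (later_smaller n \<tau> x) \<le> card {1..int n}" using that by (intro card_mono) (auto simp: later_smaller_def)
    then show ?thesis by simp
  qed
  then show ?thesis unfolding bubble_stage_def by simp
qed

text \<open>The letters of the factor are the descents that are met during the sweep. A letter that is not taken
separates the rest, and no later letter destroys this.\<close>

lemma bubble_sweep:
  assumes "s \<le> n" "\<tau> \<in> stage n s" "bubble_stage n m s \<tau>"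
  shows "\<exists>X \<rho>. \<rho> \<in> avoiding n \<and> subseq X (rev [0..<s]) \<and> bubble_stage n m 0 \<rho> \<and>
    inv \<tau> = word_prod X \<circ> inv \<rho> \<and> twice_length n \<tau> = 2 * length X + twice_length n \<rho> \<and>
    (\<forall>i<s. i \<notin> set X \<longrightarrow> separated i \<rho>) \<and> (\<forall>i. separated i \<tau> \<longrightarrow> i \<notin> set X \<and> separated i \<rho>)"
  using assms
proof (induction s arbitrary: \<tau>)
  case 0
  then show ?case by (intro exI[of _ "[]"] exI[of _ \<tau>]) (simp add: stage_0)
next
  case (Suc s)
  have \<tau>: "\<tau> \<in> signed_perms n" by (rule stage_signed_perms[OF Suc.prems(2)])
  have s: "s < n" using Suc.prems(1) by simp
  note step = bubble_stage_step[OF \<tau> s Suc.prems(3)]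
  show ?case
  proof (cases "\<tau> (int s + 1) < \<tau> (int s)")
    case True
    let ?\<tau> = "\<tau> \<circ> gen s"
    have \<tau>': "?\<tau> \<in> signed_perms n" by (rule comp_signed_perms[OF \<tau> gen_signed_perms[OF s]])
    obtain X \<rho> where *: "\<rho> \<in> avoiding n" "subseq X (rev [0..<s])" "bubble_stage n m 0 \<rho>"
      "inv ?\<tau> = word_prod X \<circ> inv \<rho>" "twice_length n ?\<tau> = 2 * length X + twice_length n \<rho>"
      "\<forall>i<s. i \<notin> set X \<longrightarrow> separated i \<rho>" "\<forall>i. separated i ?\<tau> \<longrightarrow> i \<notin> set X \<and> separated i \<rho>"
      using Suc.IH[OF less_imp_le[OF s] stage_gen_down[OF Suc.prems(2) s True] step(1)[OF True]] by blast
    have "inv \<tau> = gen s \<circ> inv ?\<tau>"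
    proof -
      have "inv ?\<tau> = gen s \<circ> inv \<tau>"
        using o_inv_distrib[OF sp_bij[OF \<tau>] sp_bij[OF gen_signed_perms[OF s]]] by (simp add: inv_gen)
      then show ?thesis by (simp add: fun_eq_iff)
    qed
    then have "inv \<tau> = word_prod (s # X) \<circ> inv \<rho>" using *(4) by (simp add: comp_assoc)
    moreover have "twice_length n \<tau> = 2 * length (s # X) + twice_length n \<rho>"
      using twice_length_gen_down[OF \<tau> s True] *(5) by simp
    moreover have "i \<noteq> s" if "separated i \<tau>" for i using separated_not_descent[OF that] True by auto
    ultimately show ?thesis using * separated_gen[of _ \<tau> s]
      by (intro exI[of _ "s # X"] exI[of _ \<rho>]) (auto simp: less_Suc_eq)
  next
    case False
    then have asc: "\<tau> (int s) < \<tau> (int s + 1)" using sp_eq[OF \<tau>, of "int s" "int s + 1"] by linarith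
    note sep = stage_ascent_separated[OF Suc.prems(2) asc]
    obtain X \<rho> where *: "\<rho> \<in> avoiding n" "subseq X (rev [0..<s])" "bubble_stage n m 0 \<rho>"
      "inv \<tau> = word_prod X \<circ> inv \<rho>" "twice_length n \<tau> = 2 * length X + twice_length n \<rho>"
      "\<forall>i<s. i \<notin> set X \<longrightarrow> separated i \<rho>" "\<forall>i. separated i \<tau> \<longrightarrow> i \<notin> set X \<and> separated i \<rho>"
      using Suc.IH[OF less_imp_le[OF s] sep(2) step(2)[OF asc]] by blast
    have "\<forall>i<Suc s. i \<notin> set X \<longrightarrow> separated i \<rho>" using *(6,7) sep(1) less_Suc_eq by blast
    with * show ?thesis by (intro exI[of _ X] exI[of _ \<rho>]) auto
  qed
qed

text \<open>The factors are nested because a letter missing from one factor separates what is left.\<close>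

lemma avoiding_sortable_word:
  assumes "\<tau> \<in> avoiding n" "bubble_stage n m 0 \<tau>"
  shows "\<exists>Xs. length Xs = m \<and> (\<forall>X\<in>set Xs. subseq X (rev [0..<n])) \<and>
    sorted_wrt (\<lambda>X Y. set Y \<subseteq> set X) Xs \<and> word_prod (concat Xs) = inv \<tau> \<and>
    2 * length (concat Xs) = twice_length n \<tau> \<and> (\<forall>X\<in>set Xs. \<forall>i\<in>set X. i < n \<and> \<not> separated i \<tau>)"
  using assms
proof (induction m arbitrary: \<tau>)
  case 0
  have \<tau>: "\<tau> \<in> signed_perms n" using 0 by (simp add: avoiding_def)
  have "\<tau> = id" by (rule bubble_done[OF \<tau> 0(2)])
  then show ?case by (simp add: id_def twice_length_id[unfolded id_def])
next
  case (Suc m)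
  obtain X \<rho> where *: "\<rho> \<in> avoiding n" "subseq X (rev [0..<n])" "bubble_stage n m 0 \<rho>"
      "inv \<tau> = word_prod X \<circ> inv \<rho>" "twice_length n \<tau> = 2 * length X + twice_length n \<rho>"
      "\<forall>i<n. i \<notin> set X \<longrightarrow> separated i \<rho>" "\<forall>i. separated i \<tau> \<longrightarrow> i \<notin> set X \<and> separated i \<rho>"
    using bubble_sweep[of n n \<tau> m] bubble_stage_start[OF Suc.prems(2)] Suc.prems(1) by (auto simp: stage_top)
  obtain Xs where Xs: "length Xs = m" "\<forall>X\<in>set Xs. subseq X (rev [0..<n])"
    "sorted_wrt (\<lambda>X Y. set Y \<subseteq> set X) Xs" "word_prod (concat Xs) = inv \<rho>"
    "2 * length (concat Xs) = twice_length n \<rho>" "\<forall>X\<in>set Xs. \<forall>i\<in>set X. i < n \<and> \<not> separated i \<rho>"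
    using Suc.IH[OF *(1,3)] by blast
  have Xn: "i < n" if "i \<in> set X" for i
  proof -
    have "set X \<subseteq> set (rev [0..<n])" using *(2) by (rule subseq_subset)
    then show ?thesis using that by auto
  qed
  have "\<forall>Y\<in>set Xs. set Y \<subseteq> set X" using Xs(6) *(6) by blast
  then show ?case using * Xs Xn
    by (intro exI[of _ "X # Xs"]) (auto simp: word_prod_append)
qed

theorem Sort_B_eq: "Sort_B n = inv ` avoiding n"
proof (intro set_eqI iffI)
  fix \<sigma> assume "\<sigma> \<in> Sort_B n"
  then obtain Xs where \<sigma>: "\<sigma> \<in> signed_perms n" and Xs: "length Xs = n" "\<forall>X\<in>set Xs. subseq X (rev [0..<n])"
    "\<forall>l. Suc l < n \<longrightarrow> set (Xs ! Suc l) \<subseteq> set (Xs ! l)" "word_prod (concat Xs) = \<sigma>" "length (concat Xs) = inv_B n \<sigma>"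
    unfolding Sort_B_def by blast
  have sub: "set (concat Xs) \<subseteq> {..<n}"
  proof -
    have "set Y \<subseteq> {..<n}" if "Y \<in> set Xs" for Y
    proof -
      have "subseq Y (rev [0..<n])" using Xs(2) that by blast
      then have "set Y \<subseteq> set (rev [0..<n])" by (rule subseq_subset)
      then show ?thesis by (simp add: atLeast0LessThan)
    qed
    then show ?thesis by fastforce
  qed
  have "sorted_wrt (\<lambda>X Y. set Y \<subseteq> set X) Xs"
    by (subst sorted_wrt_iff_nth_Suc_transp) (use Xs(1,3) in \<open>auto simp: transp_def\<close>)
  then have "word_inv (concat Xs) \<in> avoiding n"
    using Xs(2,4,5) reduced_iff_inv_B[OF sub] by (intro sortable_word_avoiding) auto
  then have "inv \<sigma> \<in> avoiding n" by (simp add: word_inv_def Xs(4))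
  then show "\<sigma> \<in> inv ` avoiding n" using sp_inv_inv[OF \<sigma>] by (metis imageI)
next
  fix \<sigma> assume "\<sigma> \<in> inv ` avoiding n"
  then obtain \<tau> where av: "\<tau> \<in> avoiding n" and \<sigma>: "\<sigma> = inv \<tau>" by blast
  have \<tau>: "\<tau> \<in> signed_perms n" using av by (simp add: avoiding_def)
  obtain Xs where Xs: "length Xs = n" "\<forall>X\<in>set Xs. subseq X (rev [0..<n])"
    "sorted_wrt (\<lambda>X Y. set Y \<subseteq> set X) Xs" "word_prod (concat Xs) = inv \<tau>"
    "2 * length (concat Xs) = twice_length n \<tau>"
    using avoiding_sortable_word[OF av bubble_initial] by blast
  have "length (concat Xs) = inv_B n \<sigma>" using Xs(5) inv_B_eq[OF \<tau>] inv_B_inv[OF \<tau>] \<sigma> by simp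
  moreover have "\<forall>l. Suc l < n \<longrightarrow> set (Xs ! Suc l) \<subseteq> set (Xs ! l)"
    using Xs(1,3) sorted_wrt_nth_less[of "\<lambda>X Y. set Y \<subseteq> set X" Xs] by auto
  ultimately show "\<sigma> \<in> Sort_B n" unfolding Sort_B_def using Xs sp_inv[OF \<tau>] \<sigma> by blast
qed

section \<open>Nested signed permutations\<close>

text \<open>If \<open>0 < \<sigma> u < u\<close>, then \<open>u\<close> is the greatest and \<open>\<sigma> u\<close> the least element of a block, and the positions
between them have images above \<open>\<sigma> u\<close>. If \<open>0 < inv \<sigma> u < u\<close>, then \<open>inv \<sigma> u\<close> and \<open>u\<close> are
consecutive elements of a block, and what lies between them is not an image of an earlier position. The last
condition is the effect of reversing the negative entries.\<close>

definition nested :: "nat \<Rightarrow> (int \<Rightarrow> int) set" where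
  "nested n = {\<sigma> \<in> signed_perms n.
     (\<forall>u v. 0 < \<sigma> u \<and> \<sigma> u \<le> v \<and> v < u \<longrightarrow> \<sigma> u < \<sigma> v) \<and>
     (\<forall>u v. 0 < inv \<sigma> u \<and> inv \<sigma> u < v \<and> v < u \<longrightarrow> inv \<sigma> u < inv \<sigma> v) \<and>
     (\<forall>u v. 0 < u \<and> u < v \<and> \<sigma> u < 0 \<and> \<sigma> v < 0 \<longrightarrow> \<sigma> v < \<sigma> u)}"

text \<open>The path that belongs to a signed permutation has two steps for each position \<open>x\<close>: step \<open>2x - 1\<close> is
an opening step if \<open>x\<close> is the least element of a positive block, and step \<open>2x\<close> is one if \<open>x\<close> is
not the greatest element of its block. The argument \<open>t\<close> numbers the steps from \<open>0\<close>. Read backwards, this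
is a Dyck path with the opening steps as east steps. The label is the number of the last opening step,
counted from \<open>1\<close>.\<close>

definition opens :: "(int \<Rightarrow> int) \<Rightarrow> nat \<Rightarrow> bool" where
  "opens \<sigma> t \<longleftrightarrow> (let x = int (t div 2) + 1 in if even t then x \<le> inv \<sigma> x else x < \<sigma> x)"

definition nested_lab :: "nat \<Rightarrow> (int \<Rightarrow> int) \<Rightarrow> nat" where
  "nested_lab n \<sigma> = Max (insert 0 (Suc ` {t. t < 2 * n \<and> opens \<sigma> t}))"

text \<open>For even \<open>t\<close> this inserts a fixed point, and for odd \<open>t\<close> it inserts a new element into a block,
directly after the element \<open>p + 1\<close>.\<close>

definition nested_grow :: "nat \<Rightarrow> nat \<Rightarrow> (int \<Rightarrow> int) \<Rightarrow> int \<Rightarrow> int" where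
  "nested_grow n t \<sigma> = insert_entry (t div 2) (Suc t div 2) \<sigma>"

text \<open>If all opening steps are among the first \<open>t\<close>, positions beyond \<open>t div 2\<close> do not continue their
blocks, and positions beyond \<open>(t + 1) div 2\<close> do not open one.\<close>

lemma nested_lab_le_iff:
  "nested_lab n \<sigma> \<le> t \<longleftrightarrow>
    (\<forall>x. int (t div 2) < x \<and> x \<le> int n \<longrightarrow> \<sigma> x \<le> x) \<and> (\<forall>x. int (Suc t div 2) < x \<and> x \<le> int n \<longrightarrow> inv \<sigma> x < x)"
proof -
  have "nested_lab n \<sigma> \<le> t \<longleftrightarrow> (\<forall>s. t \<le> s \<and> s < 2 * n \<longrightarrow> \<not> opens \<sigma> s)"
    unfolding nested_lab_def by (subst Max_le_iff) (auto simp: Suc_le_eq, meson not_le)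
  also have "\<dots> \<longleftrightarrow> (\<forall>x. int (t div 2) < x \<and> x \<le> int n \<longrightarrow> \<sigma> x \<le> x) \<and> (\<forall>x. int (Suc t div 2) < x \<and> x \<le> int n \<longrightarrow> inv \<sigma> x < x)"
  proof (intro iffI conjI allI impI)
    fix x assume a: "\<forall>s. t \<le> s \<and> s < 2 * n \<longrightarrow> \<not> opens \<sigma> s" and x: "int (t div 2) < x \<and> x \<le> int n"
    let ?s = "2 * (nat x - 1) + 1"
    have "\<not> opens \<sigma> ?s" using a x by (intro a[rule_format]) auto
    moreover have "?s div 2 = nat x - 1" "odd ?s" by simp_all
    moreover have "0 < x" using x by (meson le_less_trans of_nat_0_le_iff)
    then have "int (nat x - 1) + 1 = x" by simp
    ultimately show "\<sigma> x \<le> x" by (simp add: opens_def Let_def)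
  next
    fix x assume a: "\<forall>s. t \<le> s \<and> s < 2 * n \<longrightarrow> \<not> opens \<sigma> s" and x: "int (Suc t div 2) < x \<and> x \<le> int n"
    let ?s = "2 * (nat x - 1)"
    have "\<not> opens \<sigma> ?s" using a x by (intro a[rule_format]) auto
    moreover have "?s div 2 = nat x - 1" "even ?s" by simp_all
    moreover have "0 < x" using x by (meson le_less_trans of_nat_0_le_iff)
    then have "int (nat x - 1) + 1 = x" by simp
    ultimately show "inv \<sigma> x < x" by (simp add: opens_def Let_def)
  next
    fix s assume a: "(\<forall>x. int (t div 2) < x \<and> x \<le> int n \<longrightarrow> \<sigma> x \<le> x) \<and> (\<forall>x. int (Suc t div 2) < x \<and> x \<le> int n \<longrightarrow> inv \<sigma> x < x)"
      and s: "t \<le> s \<and> s < 2 * n"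
    let ?x = "int (s div 2) + 1"
    have x: "?x \<le> int n" "int (t div 2) < ?x" using s div_le_mono[of t s 2] by auto
    show "\<not> opens \<sigma> s"
    proof (cases "even s")
      case True
      then have "Suc t div 2 \<le> s div 2" using s by presburger
      then have "int (Suc t div 2) < ?x" by linarith
      then have "inv \<sigma> ?x < ?x" using a x(1) by blast
      then show ?thesis using True by (simp add: opens_def Let_def)
    next
      case False
      then show ?thesis using a x by (simp add: opens_def Let_def not_less)
    qed
  qed
  finally show ?thesis .
qed

context
  fixes \<sigma> :: "int \<Rightarrow> int" and n :: nat
  assumes ne: "\<sigma> \<in> nested n"
begin

lemma nested_sp: "\<sigma> \<in> signed_perms n"
  using ne by (simp add: nested_def)

lemma nested_down: "0 < \<sigma> u \<Longrightarrow> \<sigma> u \<le> v \<Longrightarrow> v < u \<Longrightarrow> \<sigma> u < \<sigma> v"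
  using ne by (simp add: nested_def)

lemma nested_down_inv: "0 < inv \<sigma> u \<Longrightarrow> inv \<sigma> u < v \<Longrightarrow> v < u \<Longrightarrow> inv \<sigma> u < inv \<sigma> v"
  using ne by (simp add: nested_def)

lemma nested_neg: "0 < u \<Longrightarrow> u < v \<Longrightarrow> \<sigma> u < 0 \<Longrightarrow> \<sigma> v < 0 \<Longrightarrow> \<sigma> v < \<sigma> u"
  using ne by (simp add: nested_def)

lemma nested_descent: "0 < x \<Longrightarrow> \<sigma> (x + 1) \<le> x \<Longrightarrow> \<sigma> (x + 1) < \<sigma> x"
  using nested_down[of "x + 1" x] nested_neg[of x "x + 1"] sp_eq_zero[OF nested_sp, of x] sp_eq_zero[OF nested_sp, of "x + 1"]
  by linarith

lemma nested_descent_inv: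
  assumes "0 < y" "inv \<sigma> (y + 1) < y"
  shows "inv \<sigma> (y + 1) < inv \<sigma> y"
proof (cases "0 < inv \<sigma> (y + 1)")
  case True
  then show ?thesis using nested_down_inv[of "y + 1" y] assms by simp
next
  case False
  note sp = nested_sp
  show ?thesis
  proof (rule ccontr)
    assume "\<not> inv \<sigma> (y + 1) < inv \<sigma> y"
    then have l: "inv \<sigma> y < inv \<sigma> (y + 1)" using sp_eq[OF sp_inv[OF sp], of y "y + 1"] by linarith
    moreover have "inv \<sigma> (y + 1) \<noteq> 0" using sp_eq_zero[OF sp_inv[OF sp], of "y + 1"] assms by simp
    ultimately have "\<sigma> (- inv \<sigma> y) < \<sigma> (- inv \<sigma> (y + 1))"
      using False assms by (intro nested_neg) (auto simp: sp_minus[OF sp] sp_inv_apply[OF sp])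
    then show False by (simp add: sp_minus[OF sp] sp_inv_apply[OF sp])
  qed
qed

end

context
  fixes \<sigma> :: "int \<Rightarrow> int" and n t p q :: nat
  assumes ne: "\<sigma> \<in> nested n" and t: "nested_lab n \<sigma> \<le> t" "t \<le> 2 * n"
    and p_def: "p = t div 2" and q_def: "q = Suc t div 2"
begin

lemma insertion_bounds: "p \<le> n" "q \<le> n" "p \<le> q" "q \<le> Suc p" "p + q = t"
  using t unfolding p_def q_def by presburger+

lemma closing: "int p < x \<Longrightarrow> x \<le> int n \<Longrightarrow> \<sigma> x \<le> x"
  and closing_inv: "int q < x \<Longrightarrow> x \<le> int n \<Longrightarrow> inv \<sigma> x < x"
  using t(1) unfolding nested_lab_le_iff p_def q_def by auto

text \<open>A position beyond \<open>p\<close> with a value beyond \<open>q\<close> would be at least this value and also less than it.\<close>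

lemma closing_small:
  assumes "int p < x" "x \<le> int n"
  shows "\<sigma> x \<le> int q"
proof (rule ccontr)
  assume a: "\<not> \<sigma> x \<le> int q"
  have "\<sigma> x \<le> x" using closing assms by simp
  moreover have "inv \<sigma> (\<sigma> x) < \<sigma> x" using a calculation assms by (intro closing_inv) auto
  ultimately show False by (simp add: sp_inv_apply[OF nested_sp[OF ne]])
qed

lemma closing_small_inv: "int q < y \<Longrightarrow> y \<le> int n \<Longrightarrow> inv \<sigma> y \<le> int p"
  using inv_small[OF nested_sp[OF ne] closing_small] by simp

lemma closing_descent: "int p < x \<Longrightarrow> x < int n \<Longrightarrow> \<sigma> (x + 1) < \<sigma> x"
  using nested_descent[OF ne, of x] closing_small[of "x + 1"] insertion_bounds by simp

lemma closing_descent_inv: "int q < y \<Longrightarrow> y < int n \<Longrightarrow> inv \<sigma> (y + 1) < inv \<sigma> y"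
  using nested_descent_inv[OF ne, of y] closing_small_inv[of "y + 1"] insertion_bounds by simp

text \<open>Let \<open>t = 2p\<close>. If position \<open>p\<close> is not the greatest element of its block, then \<open>\<sigma> p = p + 1\<close>, and the
neighbours of the inserted fixed point yield no new ascent; otherwise they yield two. The case of odd
\<open>t\<close> is similar, with the question whether \<open>p + 1\<close> is the least element of its block.\<close>

lemma new_ascents:
  "(if \<sigma> (int p) \<le> int q \<and> p \<notin> ascents n \<sigma> then p else 0) +
   (if inv \<sigma> (int q) \<le> int p \<and> q \<notin> ascents n (inv \<sigma>) then q else 0) = (if nested_lab n \<sigma> < t then t else 0)"
proof -
  note sp = nested_sp[OF ne]
  have ap: "p \<in> ascents n \<sigma> \<longleftrightarrow> p < n \<and> \<sigma> (int p) < \<sigma> (int p + 1)"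
    and aq: "q \<in> ascents n (inv \<sigma>) \<longleftrightarrow> q < n \<and> inv \<sigma> (int q) < inv \<sigma> (int q + 1)" by (auto simp: ascents_def)
  have lt: "nested_lab n \<sigma> < t \<longleftrightarrow> t > 0 \<and> nested_lab n \<sigma> \<le> t - 1" by auto
  consider "t = 0" | "q = p" "p > 0" "t = 2 * p" | "q = Suc p" "t = 2 * p + 1" using insertion_bounds by linarith
  then show ?thesis
  proof cases
    case 1
    then show ?thesis using insertion_bounds by simp
  next
    case 2
    have d: "(t - 1) div 2 = p - 1" "Suc (t - 1) div 2 = p" using 2 by auto
    have labt: "nested_lab n \<sigma> < t \<longleftrightarrow> \<sigma> (int p) \<le> int p"
    proof
      assume "nested_lab n \<sigma> < t"
      then show "\<sigma> (int p) \<le> int p" using lt nested_lab_le_iff[of n \<sigma> "t - 1"] d 2 insertion_bounds by auto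
    next
      assume a: "\<sigma> (int p) \<le> int p"
      have "\<sigma> x \<le> x" if "int (p - 1) < x" "x \<le> int n" for x
        using closing[of x] a that by (cases "x = int p") auto
      then show "nested_lab n \<sigma> < t" using lt nested_lab_le_iff[of n \<sigma> "t - 1"] d 2 closing_inv by auto
    qed
    show ?thesis
    proof (cases "\<sigma> (int p) \<le> int p")
      case True
      have "p \<notin> ascents n \<sigma>" using ap closing_small[of "int p + 1"] nested_descent[OF ne, of "int p"] 2 by auto
      moreover have "inv \<sigma> (int p) \<le> int p"
        using nested_down[OF ne, of "inv \<sigma> (int p)" "int p"] True 2 sp_inv_apply[OF sp] by force
      moreover have "p \<notin> ascents n (inv \<sigma>)"
      proof
        assume "p \<in> ascents n (inv \<sigma>)"
        then have a: "p < n" "inv \<sigma> (int p) < inv \<sigma> (int p + 1)" using aq 2 by auto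
        have "inv \<sigma> (int p + 1) \<le> int p" using closing_small_inv[of "int p + 1"] a 2 by simp
        moreover have "inv \<sigma> (int p + 1) \<noteq> int p" using sp_inv_apply(2)[OF sp, of "int p + 1"] True by auto
        ultimately show False using nested_descent_inv[OF ne, of "int p"] a 2 by simp
      qed
      ultimately show ?thesis using True labt 2 by simp
    next
      case False
      have "p \<in> ascents n (inv \<sigma>)" if "inv \<sigma> (int p) \<le> int p"
      proof -
        have "\<sigma> (int p) \<le> int n" using sp_abs_le[OF sp, of "int p"] insertion_bounds by simp
        then have pn: "p < n" using False by simp
        have "\<sigma> (int p) = int p + 1"
        proof (rule ccontr)
          assume "\<sigma> (int p) \<noteq> int p + 1"
          then have "int p < inv \<sigma> (int p + 1)"
            using nested_down_inv[OF ne, of "\<sigma> (int p)" "int p + 1"] False 2 by (simp add: sp_inv_apply[OF sp])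
          then show False using closing_small_inv[of "int p + 1"] pn 2 by simp
        qed
        then have "inv \<sigma> (int p + 1) = int p" by (rule inv_eqI[OF sp])
        moreover have "inv \<sigma> (int p) \<noteq> int p" using sp_inv_apply(2)[OF sp, of "int p"] False by auto
        ultimately show ?thesis using that pn aq 2 by simp
      qed
      then show ?thesis using False labt 2 by auto
    qed
  next
    case 3
    have d: "(t - 1) div 2 = p" "Suc (t - 1) div 2 = p" using 3 by auto
    have pn: "p < n" using insertion_bounds 3 by simp
    have labt: "nested_lab n \<sigma> < t \<longleftrightarrow> inv \<sigma> (int p + 1) \<le> int p"
    proof
      assume "nested_lab n \<sigma> < t"
      then have "nested_lab n \<sigma> \<le> t - 1" using lt by simp
      then have "inv \<sigma> x < x" if "int p < x" "x \<le> int n" for x using that unfolding nested_lab_le_iff d by auto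
      from this[of "int p + 1"] pn have "inv \<sigma> (int p + 1) < int p + 1" by simp
      then show "inv \<sigma> (int p + 1) \<le> int p" by simp
    next
      assume a: "inv \<sigma> (int p + 1) \<le> int p"
      have "inv \<sigma> x < x" if "int p < x" "x \<le> int n" for x
        using closing_inv[of x] a that 3 by (cases "x = int p + 1") auto
      then show "nested_lab n \<sigma> < t" using lt nested_lab_le_iff[of n \<sigma> "t - 1"] d 3 closing by auto
    qed
    have q: "int q = int p + 1" using 3 by simp
    have small: "\<sigma> (int p + 1) \<le> int p + 1" using closing_small[of "int p + 1"] pn q by simp
    show ?thesis
    proof (cases "inv \<sigma> (int p + 1) \<le> int p")
      case True
      have "p = 0 \<or> \<sigma> (int p) \<le> int q"
      proof (rule ccontr)
        assume "\<not> (p = 0 \<or> \<sigma> (int p) \<le> int q)"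
        then have "int p < inv \<sigma> (int p + 1)"
          using nested_down_inv[OF ne, of "\<sigma> (int p)" "int p + 1"] q by (simp add: sp_inv_apply[OF sp])
        then show False using True by simp
      qed
      moreover have "p = 0 \<or> p \<notin> ascents n \<sigma>"
      proof -
        have "\<sigma> (int p + 1) \<noteq> int p + 1" using True inv_eqI[OF sp, of "int p + 1" "int p + 1"] by auto
        then show ?thesis using small nested_descent[OF ne, of "int p"] ap by auto
      qed
      moreover have "q \<notin> ascents n (inv \<sigma>)"
        using aq closing_small_inv[of "int q + 1"] nested_descent_inv[OF ne, of "int q"] q by auto
      moreover have "inv \<sigma> (int q) \<le> int p" using True q by simp
      moreover have "nested_lab n \<sigma> < t" "t = p + q" using True labt insertion_bounds(5) by simp_all
      ultimately show ?thesis by auto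
    next
      case False
      have "inv \<sigma> (int p + 1) = int p + 1"
      proof (rule ccontr)
        assume "inv \<sigma> (int p + 1) \<noteq> int p + 1"
        then have "int p + 1 < \<sigma> (int p + 1)"
          using nested_down[OF ne, of "inv \<sigma> (int p + 1)" "int p + 1"] False by (simp add: sp_inv_apply[OF sp])
        then show False using small by simp
      qed
      then have "\<sigma> (int p + 1) = int p + 1" using sp_inv_apply(2)[OF sp, of "int p + 1"] by simp
      moreover from this have "\<sigma> (int p) \<noteq> int p + 1" using sp_eq[OF sp, of "int p" "int p + 1"] by auto
      ultimately have "\<not> (\<sigma> (int p) \<le> int q \<and> p \<notin> ascents n \<sigma>)" using ap pn q by auto
      then show ?thesis using False labt q by auto
    qed
  qed
qed

lemma insert_entry_nested: "insert_entry p q \<sigma> \<in> nested (Suc n)"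
proof -
  note sp = nested_sp[OF ne]
  define \<rho> where "\<rho> = insert_entry p q \<sigma>"
  have \<rho>: "\<rho> \<in> signed_perms (Suc n)" unfolding \<rho>_def by (rule insert_entry_signed_perms[OF sp insertion_bounds(1,2)])
  have inv\<rho>: "inv \<rho> = insert_entry q p (inv \<sigma>)" unfolding \<rho>_def by (rule inv_insert_entry[OF sp])
  have "\<rho> u < \<rho> v" if h: "0 < \<rho> u" "\<rho> u \<le> v" "v < u" for u v
  proof (cases u rule: skip_cases[of _ p])
    case at
    then show ?thesis using h insertion_bounds by (simp add: \<rho>_def)
  next
    case minus_at
    then show ?thesis using h by (simp add: \<rho>_def)
  next
    case u: (skip u')
    then have \<rho>u: "\<rho> u = skip q (\<sigma> u')" by (simp add: \<rho>_def)
    show ?thesis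
    proof (cases v rule: skip_cases[of _ p])
      case at
      then have "\<rho> v = int q + 1" by (simp add: \<rho>_def)
      then show ?thesis using h at \<rho>u insertion_bounds skip_neq(1)[of q "\<sigma> u'"] by linarith
    next
      case minus_at
      then show ?thesis using h by simp
    next
      case v: (skip v')
      have "0 < \<sigma> u'" "v' < u'" using h \<rho>u u v by auto
      moreover have "\<sigma> u' \<le> v'" using h(2) insertion_bounds unfolding \<rho>u v by (auto simp: skip_def split: if_splits)
      ultimately have "\<sigma> u' < \<sigma> v'" by (intro nested_down[OF ne])
      then show ?thesis using \<rho>u v by (simp add: \<rho>_def)
    qed
  qed
  moreover have "inv \<rho> u < inv \<rho> v" if h: "0 < inv \<rho> u" "inv \<rho> u < v" "v < u" for u v
  proof (cases u rule: skip_cases[of _ q])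
    case at
    then show ?thesis using h insertion_bounds by (simp add: inv\<rho>)
  next
    case minus_at
    then show ?thesis using h by (simp add: inv\<rho>)
  next
    case u: (skip u')
    then have \<rho>u: "inv \<rho> u = skip p (inv \<sigma> u')" by (simp add: inv\<rho>)
    show ?thesis
    proof (cases v rule: skip_cases[of _ q])
      case at
      then have "inv \<rho> v = int p + 1" by (simp add: inv\<rho>)
      then show ?thesis using h at \<rho>u insertion_bounds skip_neq(1)[of p "inv \<sigma> u'"] by linarith
    next
      case minus_at
      then show ?thesis using h by simp
    next
      case v: (skip v')
      have "0 < inv \<sigma> u'" "v' < u'" using h \<rho>u u v by auto
      moreover have "inv \<sigma> u' < v'" using h(2) insertion_bounds \<open>0 < inv \<sigma> u'\<close> unfolding \<rho>u v by (auto simp: skip_def split: if_splits)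
      ultimately have "inv \<sigma> u' < inv \<sigma> v'" by (intro nested_down_inv[OF ne])
      then show ?thesis using \<rho>u v by (simp add: inv\<rho>)
    qed
  qed
  moreover have "\<rho> v < \<rho> u" if h: "0 < u" "u < v" "\<rho> u < 0" "\<rho> v < 0" for u v
  proof -
    have "u \<noteq> int p + 1" "v \<noteq> int p + 1" using h by (auto simp: \<rho>_def)
    then have "u = skip p (unskip p u)" "v = skip p (unskip p v)" using h by (auto intro!: skip_unskip[symmetric])
    then obtain u' v' where uv: "u = skip p u'" "v = skip p v'" by blast
    show ?thesis using h uv nested_neg[OF ne, of u' v'] by (simp add: \<rho>_def)
  qed
  ultimately show ?thesis using \<rho> by (simp add: nested_def \<rho>_def)
qed

lemma insert_entry_lab: "nested_lab (Suc n) (insert_entry p q \<sigma>) = Suc t"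
proof -
  note sp = nested_sp[OF ne]
  define \<rho> where "\<rho> = insert_entry p q \<sigma>"
  have inv\<rho>: "inv \<rho> = insert_entry q p (inv \<sigma>)" unfolding \<rho>_def by (rule inv_insert_entry[OF sp])
  have h: "\<rho> x = skip q (\<sigma> (x - 1))" if "int p + 1 < x" for x unfolding \<rho>_def using that by (rule insert_entry_high)
  have h': "inv \<rho> x = skip p (inv \<sigma> (x - 1))" if "int q + 1 < x" for x unfolding inv\<rho> using that by (rule insert_entry_high)
  have at: "\<rho> (int p + 1) = int q + 1" "inv \<rho> (int q + 1) = int p + 1" by (simp_all add: \<rho>_def inv\<rho>[unfolded \<rho>_def])
  have S1: "\<rho> x \<le> x" if "int q < x" "x \<le> int (Suc n)" for x
  proof (cases "x = int p + 1")
    case False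
    then have "int p + 1 < x" using that insertion_bounds by simp
    then show ?thesis using h[of x] closing_small[of "x - 1"] that by (simp add: skip_def)
  qed (use at that insertion_bounds in simp)
  have T1: "inv \<rho> x < x" if "int p + 1 < x" "x \<le> int (Suc n)" for x
  proof (cases "x = int q + 1")
    case False
    then have "int q + 1 < x" using that insertion_bounds by simp
    then show ?thesis using h'[of x] closing_small_inv[of "x - 1"] that by (simp add: skip_def)
  qed (use at that insertion_bounds in simp)
  have dd: "Suc (Suc t) div 2 = Suc p" by (simp add: p_def)
  have "nested_lab (Suc n) \<rho> \<le> Suc t"
    unfolding nested_lab_le_iff dd q_def[symmetric] using S1 T1 by auto
  moreover have "\<not> nested_lab (Suc n) \<rho> \<le> t"
  proof
    assume "nested_lab (Suc n) \<rho> \<le> t"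
    then have S: "\<And>x. int p < x \<Longrightarrow> x \<le> int (Suc n) \<Longrightarrow> \<rho> x \<le> x" and T: "\<And>x. int q < x \<Longrightarrow> x \<le> int (Suc n) \<Longrightarrow> inv \<rho> x < x"
      unfolding nested_lab_le_iff p_def[symmetric] q_def[symmetric] by auto
    have "int q + 1 \<le> int p + 1" using S[of "int p + 1"] at insertion_bounds by simp
    moreover have "int p + 1 < int q + 1" using T[of "int q + 1"] at insertion_bounds by simp
    ultimately show False by simp
  qed
  ultimately show ?thesis by (simp add: \<rho>_def)
qed

end

lemma delete_entry_nested:
  assumes ne: "\<rho> \<in> nested (Suc n)" and at: "\<rho> (int p + 1) = int q + 1" and pq: "p \<le> n" "p \<le> q" "q \<le> Suc p"
  shows "delete_entry p q \<rho> \<in> nested n"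
proof -
  define \<sigma> where "\<sigma> = delete_entry p q \<rho>"
  note sp = nested_sp[OF ne]
  have \<sigma>: "\<sigma> \<in> signed_perms n" unfolding \<sigma>_def by (rule delete_entry_signed_perms[OF sp at pq(1)])
  have ins: "insert_entry p q \<sigma> = \<rho>" unfolding \<sigma>_def by (rule insert_delete_entry[OF sp at])
  have e: "\<rho> (skip p x) = skip q (\<sigma> x)" for x using insert_entry_skip[of p q \<sigma> x] by (simp add: ins)
  have e': "inv \<rho> (skip q x) = skip p (inv \<sigma> x)" for x
    using insert_entry_skip[of q p "inv \<sigma>" x] inv_insert_entry[OF \<sigma>, of p q] by (simp add: ins)
  have "\<sigma> u < \<sigma> v" if h: "0 < \<sigma> u" "\<sigma> u \<le> v" "v < u" for u v
  proof -
    have "skip q (\<sigma> u) \<le> skip p v" using h pq by (auto simp: skip_def)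
    then show ?thesis using nested_down[OF ne, of "skip p u" "skip p v"] h by (simp add: e)
  qed
  moreover have "inv \<sigma> u < inv \<sigma> v" if h: "0 < inv \<sigma> u" "inv \<sigma> u < v" "v < u" for u v
  proof -
    have "skip p (inv \<sigma> u) < skip q v" using h pq by (auto simp: skip_def)
    then show ?thesis using nested_down_inv[OF ne, of "skip q u" "skip q v"] h by (simp add: e')
  qed
  moreover have "\<sigma> v < \<sigma> u" if h: "0 < u" "u < v" "\<sigma> u < 0" "\<sigma> v < 0" for u v
    using nested_neg[OF ne, of "skip p u" "skip p v"] h by (simp add: e)
  ultimately show ?thesis using \<sigma> by (simp add: nested_def \<sigma>_def[symmetric])
qed

text \<open>The last opening step determines the entry to delete. If position \<open>x\<close> opens a block and does not
continue it, then \<open>x\<close> is a fixed point; if \<open>x\<close> continues its block and \<open>x + 1\<close> is not a least element,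
then \<open>x\<close> is mapped to \<open>x + 1\<close>.\<close>

lemma nested_cover:
  assumes ne: "\<rho> \<in> nested (Suc n)"
  shows "\<rho> = flip (Suc n) \<or> (\<exists>\<sigma>\<in>nested n. \<exists>t. nested_lab n \<sigma> \<le> t \<and> t \<le> 2 * n \<and> \<rho> = nested_grow n t \<sigma>)"
proof -
  note sp = nested_sp[OF ne]
  show ?thesis
  proof (cases "nested_lab (Suc n) \<rho>")
    case 0
    then have S: "\<And>x. 0 < x \<Longrightarrow> x \<le> int (Suc n) \<Longrightarrow> \<rho> x \<le> x" and T: "\<And>x. 0 < x \<Longrightarrow> x \<le> int (Suc n) \<Longrightarrow> inv \<rho> x < x"
      using nested_lab_le_iff[of "Suc n" \<rho> 0] by auto
    have neg: "\<rho> x < 0" if "0 < x" "x \<le> int (Suc n)" for x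
    proof (rule ccontr)
      assume "\<not> \<rho> x < 0"
      moreover have "\<rho> x \<noteq> 0" using sp_eq_zero[OF sp, of x] that by simp
      ultimately have "inv \<rho> (\<rho> x) < \<rho> x" using S[OF that] that by (intro T) auto
      then show False using S[OF that] by (simp add: sp_inv_apply[OF sp])
    qed
    have "\<rho> = flip (Suc n)"
    proof (rule decreasing_negative_eq_flip[OF sp])
      show "\<rho> (x + 1) < \<rho> x" if "0 < x" "x < int (Suc n)" for x
        using nested_neg[OF ne, of x "x + 1"] neg[of x] neg[of "x + 1"] that by simp
      show "\<rho> 1 < 0" using neg[of 1] by simp
    qed
    then show ?thesis ..
  next
    case (Suc t)
    define p where "p = t div 2"
    define q where "q = Suc t div 2"
    have q1: "Suc (Suc t) div 2 = Suc p" by (simp add: p_def)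
    have lab1: "nested_lab (Suc n) \<rho> \<le> Suc t" using Suc by simp
    have lab0: "\<not> nested_lab (Suc n) \<rho> \<le> t" using Suc by simp
    have S: "\<And>x. int q < x \<Longrightarrow> x \<le> int (Suc n) \<Longrightarrow> \<rho> x \<le> x" and T: "\<And>x. int p + 1 < x \<Longrightarrow> x \<le> int (Suc n) \<Longrightarrow> inv \<rho> x < x"
      using lab1 unfolding nested_lab_le_iff q1 q_def[symmetric] by auto
    have pq: "p \<le> q" "q \<le> Suc p" "p + q = t" unfolding p_def q_def by presburger+
    have "\<rho> (int p + 1) = int q + 1 \<and> p \<le> n \<and> q \<le> n"
    proof (cases "p = q")
      case True
      obtain x where x: "int p < x" "x \<le> int (Suc n)" "\<not> \<rho> x \<le> x \<or> \<not> inv \<rho> x < x"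
        using lab0 unfolding nested_lab_le_iff p_def[symmetric] q_def[symmetric] using True by blast
      then have xe: "x = int p + 1" using S[of x] T[of x] True by fastforce
      then have ge: "int p + 1 \<le> inv \<rho> (int p + 1)" using x S[of x] True by auto
      have le: "\<rho> (int p + 1) \<le> int p + 1" using S[of x] x xe True by simp
      have "inv \<rho> (int p + 1) = int p + 1"
      proof (rule ccontr)
        assume "inv \<rho> (int p + 1) \<noteq> int p + 1"
        then show False using nested_down[OF ne, of "inv \<rho> (int p + 1)" "int p + 1"] ge le by (simp add: sp_inv_apply[OF sp])
      qed
      then have "\<rho> (int p + 1) = int p + 1" using sp_inv_apply(2)[OF sp, of "int p + 1"] by simp
      then show ?thesis using True x xe by simp
    next
      case False
      then have q: "q = Suc p" using pq by simp
      obtain x where x: "int p < x" "x \<le> int (Suc n)" "\<not> \<rho> x \<le> x"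
        using lab0 T unfolding nested_lab_le_iff p_def[symmetric] q_def[symmetric] q by fastforce
      then have xe: "x = int p + 1" using S[of x] q by fastforce
      then have gt: "int p + 1 < \<rho> (int p + 1)" using x by simp
      have le: "\<rho> (int p + 1) \<le> int (Suc n)" using sp_abs_le[OF sp, of x] x xe by simp
      have "\<rho> (int p + 1) = int p + 2"
      proof (rule ccontr)
        assume "\<rho> (int p + 1) \<noteq> int p + 2"
        then have "int p + 1 < inv \<rho> (int p + 2)"
          using nested_down_inv[OF ne, of "\<rho> (int p + 1)" "int p + 2"] gt by (simp add: sp_inv_apply[OF sp])
        then show False using T[of "int p + 2"] gt le by simp
      qed
      then show ?thesis using q le gt by simp
    qed
    then have at: "\<rho> (int p + 1) = int q + 1" and pn: "p \<le> n" "q \<le> n" by auto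
    define \<sigma> where "\<sigma> = delete_entry p q \<rho>"
    have \<sigma>: "\<sigma> \<in> nested n" unfolding \<sigma>_def by (rule delete_entry_nested[OF ne at pn(1) pq(1,2)])
    note \<sigma>sp = nested_sp[OF \<sigma>]
    have ins: "insert_entry p q \<sigma> = \<rho>" unfolding \<sigma>_def by (rule insert_delete_entry[OF sp at])
    have small: "\<rho> x \<le> int p + 1" if "int q < x" "x \<le> int (Suc n)" for x
    proof (rule ccontr)
      assume a: "\<not> \<rho> x \<le> int p + 1"
      have "\<rho> x \<le> x" by (rule S[OF that])
      moreover have "inv \<rho> (\<rho> x) < \<rho> x" using a calculation that by (intro T) auto
      ultimately show False by (simp add: sp_inv_apply[OF sp])
    qed
    have "nested_lab n \<sigma> \<le> t" unfolding nested_lab_le_iff p_def[symmetric] q_def[symmetric]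
    proof (intro conjI allI impI)
      fix x assume x: "int p < x \<and> x \<le> int n"
      have "skip q (\<sigma> x) = \<rho> (x + 1)" using insert_entry_skip[of p q \<sigma> x] x by (simp add: ins skip_def)
      moreover have "\<rho> (x + 1) \<le> int p + 1" using small[of "x + 1"] x pq by simp
      ultimately show "\<sigma> x \<le> x" using x pq skip_neq(1)[of q "\<sigma> x"] by (auto simp: skip_def split: if_splits)
    next
      fix x assume x: "int q < x \<and> x \<le> int n"
      have "skip p (inv \<sigma> x) = inv \<rho> (x + 1)"
        using insert_entry_skip[of q p "inv \<sigma>" x] inv_insert_entry[OF \<sigma>sp, of p q] x by (simp add: ins skip_def)
      moreover have "inv \<rho> (x + 1) < x + 1" using T[of "x + 1"] x pq by simp
      moreover have "inv \<sigma> x \<le> int p"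
      proof (rule inv_small[OF \<sigma>sp])
        show "\<sigma> y \<le> int q" if "int p < y" "y \<le> int n" for y
        proof -
          have "skip q (\<sigma> y) = \<rho> (y + 1)" using insert_entry_skip[of p q \<sigma> y] that by (simp add: ins skip_def)
          moreover have "\<rho> (y + 1) \<le> int p + 1" using small[of "y + 1"] that pq by simp
          ultimately show ?thesis using pq by (auto simp: skip_def split: if_splits)
        qed
      qed (use x in auto)
      ultimately show "inv \<sigma> x < x" using x pq by simp
    qed
    moreover have "\<rho> = nested_grow n t \<sigma>" using ins by (simp add: nested_grow_def p_def q_def)
    ultimately show ?thesis using \<sigma> pn pq by (intro disjI2 bexI[OF _ \<sigma>] exI[of _ t]) auto
  qed
qed

lemma flip_nested: "flip n \<in> nested n"
  using flip_signed_perms[of n] by (auto simp: nested_def inv_flip) (auto simp: flip_def split: if_splits)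

lemma nested_growth_family:
  "growth_family nested nested_lab flip nested_grow inv_B total_ascents (\<lambda>n \<sigma>. n - neg n \<sigma>)"
proof
  fix n
  show "flip n \<in> nested n" by (rule flip_nested)
  show "nested 0 = {flip 0}" using flip_nested[of 0] signed_perms_0 by (auto simp: nested_def)
  have "nested_lab n (flip n) \<le> 0" unfolding nested_lab_le_iff inv_flip by (auto simp: flip_def)
  then show "nested_lab n (flip n) = 0" by simp
  show "inv_B n (flip n) = n\<^sup>2" by (rule inv_B_flip)
  show "total_ascents n (flip n) = 0" by (rule total_ascents_flip)
  show "n - neg n (flip n) = 0" by (simp add: neg_flip)
next
  fix \<sigma> n t assume a: "\<sigma> \<in> nested n" "nested_lab n \<sigma> \<le> t" "t \<le> 2 * n"
  note pq = insertion_bounds[OF a refl refl]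
  note st = stats_insert_entry[OF nested_sp[OF a(1)] pq(1,2) closing_small[OF a refl refl]
      closing_descent[OF a refl refl] closing_descent_inv[OF a refl refl]]
  show "nested_grow n t \<sigma> \<in> nested (Suc n)" "nested_lab (Suc n) (nested_grow n t \<sigma>) = Suc t"
    unfolding nested_grow_def using insert_entry_nested[OF a refl refl] insert_entry_lab[OF a refl refl] .
  show "inv_B (Suc n) (nested_grow n t \<sigma>) = inv_B n \<sigma> + (2 * n - t)"
    unfolding nested_grow_def using st(1) pq(5) by simp
  show "total_ascents (Suc n) (nested_grow n t \<sigma>) = total_ascents n \<sigma> + (if nested_lab n \<sigma> < t then t else 0)"
    unfolding nested_grow_def using st(2) new_ascents[OF a refl refl] by simp
  show "Suc n - neg (Suc n) (nested_grow n t \<sigma>) = Suc (n - neg n \<sigma>)"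
    unfolding nested_grow_def using st(3) by simp
next
  fix n t \<sigma> \<tau> assume "nested_grow n t \<sigma> = nested_grow n t \<tau>"
  then show "\<sigma> = \<tau>" unfolding nested_grow_def by (rule insert_entry_inj)
qed (rule nested_cover)

section \<open>Noncrossing partitions\<close>

definition leq_B :: "int \<Rightarrow> int \<Rightarrow> bool" where
  "leq_B a b \<longleftrightarrow> a = b \<or> less_B a b"

text \<open>Membership in \<open>NC_B n\<close> without reference to a partition: what lies between \<open>i\<close> and \<open>\<sigma> i\<close> stays
there. The second condition is for the step from the greatest to the least element of a block.\<close>

definition nc_order :: "nat \<Rightarrow> (int \<Rightarrow> int) set" where
  "nc_order n = {\<sigma> \<in> signed_perms n. \<forall>i\<in>signed_range n. \<forall>x\<in>signed_range n.
     (less_B i x \<and> less_B x (\<sigma> i) \<longrightarrow> less_B i (\<sigma> x) \<and> less_B (\<sigma> x) (\<sigma> i)) \<and>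
     (leq_B (\<sigma> i) x \<and> less_B x i \<longrightarrow> less_B (\<sigma> i) (\<sigma> x) \<and> leq_B (\<sigma> x) i)}"

lemma less_B_irrefl [simp]: "\<not> less_B a a"
  by (auto simp: less_B_def)

lemma less_B_trans: "less_B a b \<Longrightarrow> less_B b c \<Longrightarrow> less_B a c"
  by (auto simp: less_B_def)

lemma less_B_total: "a \<noteq> 0 \<Longrightarrow> b \<noteq> 0 \<Longrightarrow> a \<noteq> b \<Longrightarrow> less_B a b \<or> less_B b a"
  by (auto simp: less_B_def)

text \<open>The cyclic successor of \<open>a\<close> in the block \<open>B\<close>.\<close>

definition next_in :: "int set \<Rightarrow> int \<Rightarrow> int \<Rightarrow> bool" where
  "next_in B a b \<longleftrightarrow> a \<in> B \<and> b \<in> B \<and>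
     (less_B a b \<and> (\<forall>c\<in>B. \<not> (less_B a c \<and> less_B c b)) \<or> (\<forall>c\<in>B. leq_B b c \<and> leq_B c a))"

lemma next_in_unique:
  assumes "0 \<notin> B" "next_in B a b" "next_in B a c"
  shows "b = c"
proof (rule ccontr)
  assume "b \<noteq> c"
  moreover have "b \<noteq> 0" "c \<noteq> 0" using assms by (auto simp: next_in_def)
  ultimately have "less_B b c \<or> less_B c b" by (intro less_B_total)
  with assms(2,3) show False unfolding next_in_def leq_B_def by (metis less_B_irrefl less_B_trans)
qed

lemma next_in_cycle_of_list:
  assumes s: "sorted_wrt less_B cs" and a: "a \<in> set cs"
  shows "next_in (set cs) a (cycle_of_list cs a)"
proof -
  have lt: "less_B (cs ! i) (cs ! j)" if "i < j" "j < length cs" for i j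
    using s that by (rule sorted_wrt_nth_less)
  have d: "distinct cs"
    unfolding distinct_conv_nth using lt by (metis less_B_irrefl nat_neq_iff)
  obtain i where i: "i < length cs" "a = cs ! i" using a by (metis in_set_conv_nth)
  have "cycle_of_list cs a = map (cycle_of_list cs ^^ 1) cs ! i" using i by simp
  also have "\<dots> = rotate 1 cs ! i" by (simp only: cyclic_rotation[OF d])
  also have "\<dots> = cs ! (Suc i mod length cs)" using i nth_rotate[of i cs 1] by simp
  finally have e: "cycle_of_list cs a = cs ! (Suc i mod length cs)" .
  have le: "leq_B (cs ! k) (cs ! l)" if "k \<le> l" "l < length cs" for k l
    using lt[of k l] that by (cases "k = l") (auto simp: leq_B_def)
  show ?thesis
  proof (cases "Suc i = length cs")
    case True
    then have "cycle_of_list cs a = cs ! 0" using e by simp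
    moreover have "leq_B (cs ! 0) c \<and> leq_B c (cs ! i)" if c: "c \<in> set cs" for c
    proof -
      obtain j where "j < length cs" "c = cs ! j" using c by (metis in_set_conv_nth)
      then show ?thesis using le[of 0 j] le[of j i] True by simp
    qed
    ultimately show ?thesis using i True unfolding next_in_def by (metis nth_mem zero_less_Suc)
  next
    case False
    then have si: "Suc i < length cs" using i by simp
    then have e': "cycle_of_list cs a = cs ! Suc i" using e by simp
    have "\<not> (less_B (cs ! i) c \<and> less_B c (cs ! Suc i))" if c: "c \<in> set cs" for c
    proof -
      obtain j where j: "j < length cs" "c = cs ! j" using c by (metis in_set_conv_nth)
      show ?thesis
      proof (cases "j \<le> i")
        case True
        then have "leq_B c (cs ! i)" using le[of j i] i j by simp
        then show ?thesis unfolding leq_B_def by (metis less_B_irrefl less_B_trans)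
      next
        case False
        then have "leq_B (cs ! Suc i) c" using le[of "Suc i" j] j by simp
        then show ?thesis unfolding leq_B_def by (metis less_B_irrefl less_B_trans)
      qed
    qed
    then show ?thesis using lt[of i "Suc i"] si i e' unfolding next_in_def by auto
  qed
qed

lemma ex_sorted_B:
  assumes "finite B" "0 \<notin> B"
  shows "\<exists>cs. set cs = B \<and> sorted_wrt less_B cs"
proof (intro exI conjI)
  let ?N = "sorted_list_of_set {x \<in> B. x < 0}" and ?P = "sorted_list_of_set {x \<in> B. 0 < x}"
  have N: "set ?N = {x \<in> B. x < 0}" and P: "set ?P = {x \<in> B. 0 < x}" using assms(1) by simp_all
  have "x < 0 \<or> 0 < x" if "x \<in> B" for x using assms(2) that by (cases x "0 :: int" rule: linorder_cases) auto
  then show "set (rev ?N @ ?P) = B" unfolding set_append set_rev N P by blast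
  have "sorted_wrt (\<lambda>x y. less_B y x) ?N"
    by (rule sorted_wrt_mono_rel[of _ "(<)"]) (use assms(1) in \<open>auto simp: less_B_def\<close>)
  moreover have "sorted_wrt less_B ?P"
    by (rule sorted_wrt_mono_rel[of _ "(<)"]) (use assms(1) in \<open>auto simp: less_B_def\<close>)
  moreover have "\<forall>x\<in>set (rev ?N). \<forall>y\<in>set ?P. less_B x y" unfolding set_rev N P by (auto simp: less_B_def)
  ultimately show "sorted_wrt less_B (rev ?N @ ?P)" by (simp only: sorted_wrt_append sorted_wrt_rev)
qed

lemma cycles_of_blocks_iff:
  assumes "\<Union>P \<subseteq> signed_range n"
  shows "cycles_of_blocks P \<sigma> \<longleftrightarrow> (\<forall>B\<in>P. \<forall>a\<in>B. next_in B a (\<sigma> a))"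
proof -
  have fin: "finite B" "0 \<notin> B" if "B \<in> P" for B
    using assms that finite_subset[of B "signed_range n"] by (auto simp: mem_signed_range)
  show ?thesis
  proof
    assume c: "cycles_of_blocks P \<sigma>"
    show "\<forall>B\<in>P. \<forall>a\<in>B. next_in B a (\<sigma> a)"
    proof (intro ballI)
      fix B a assume B: "B \<in> P" "a \<in> B"
      then obtain cs where cs: "set cs = B" "sorted_wrt less_B cs" "\<forall>a\<in>B. \<sigma> a = cycle_of_list cs a"
        using c unfolding cycles_of_blocks_def by blast
      then show "next_in B a (\<sigma> a)" using next_in_cycle_of_list[OF cs(2), of a] B by simp
    qed
  next
    assume h: "\<forall>B\<in>P. \<forall>a\<in>B. next_in B a (\<sigma> a)"
    show "cycles_of_blocks P \<sigma>" unfolding cycles_of_blocks_def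
    proof
      fix B assume B: "B \<in> P"
      obtain cs where cs: "set cs = B" "sorted_wrt less_B cs" using ex_sorted_B fin[OF B] by blast
      have "\<sigma> a = cycle_of_list cs a" if "a \<in> B" for a
        using next_in_unique[OF fin(2)[OF B]] h B that next_in_cycle_of_list[OF cs(2), of a] cs(1) by blast
      then show "\<exists>cs. set cs = B \<and> sorted_wrt less_B cs \<and> (\<forall>a\<in>B. \<sigma> a = cycle_of_list cs a)" using cs by blast
    qed
  qed
qed

text \<open>If \<open>x\<close> lies between the cyclic neighbours \<open>i\<close> and \<open>\<sigma> i\<close> of one block and \<open>\<sigma> x\<close> does not, these four
elements cross.\<close>

lemma NC_B_subset_nc_order: "NC_B n \<subseteq> nc_order n"
proof
  fix \<sigma> assume "\<sigma> \<in> NC_B n"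
  then obtain P where \<sigma>: "\<sigma> \<in> signed_perms n" and P: "partition_on (signed_range n) P"
    and nc: "noncrossing less_B P" and cyc: "cycles_of_blocks P \<sigma>"
    unfolding NC_B_def partition_B_def by blast
  have U: "\<Union>P = signed_range n" using P by (simp add: partition_on_def)
  have nx: "next_in B a (\<sigma> a)" if "B \<in> P" "a \<in> B" for B a
    using cyc cycles_of_blocks_iff[of P n \<sigma>] U that by simp
  have disj: "x \<notin> C" if "B \<in> P" "C \<in> P" "B \<noteq> C" "x \<in> B" for B C x
    using P that unfolding partition_on_def disjoint_def by blast
  have cross: False if "B \<in> P" "C \<in> P" "B \<noteq> C" "a \<in> B" "c \<in> B" "b \<in> C" "d \<in> C" "less_B a b" "less_B b c" "less_B c d" for B C a b c d
    using nc that unfolding noncrossing_def by blast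
  have tot: "less_B a b \<or> less_B b a" if "B \<in> P" "C \<in> P" "B \<noteq> C" "a \<in> B" "b \<in> C" for B C a b
  proof (rule less_B_total)
    show "a \<noteq> 0" "b \<noteq> 0" using U that by (auto simp: mem_signed_range)
    show "a \<noteq> b" using disj that by blast
  qed
  show "\<sigma> \<in> nc_order n" unfolding nc_order_def
  proof (clarify, intro conjI ballI impI \<sigma>; (elim conjE)?)
    fix i x assume ix: "i \<in> signed_range n" "x \<in> signed_range n" "less_B i x" "less_B x (\<sigma> i)"
    obtain B C where B: "B \<in> P" "i \<in> B" and C: "C \<in> P" "x \<in> C" using U ix by blast
    note nB = nx[OF B] and nC = nx[OF C]
    have lt: "less_B i (\<sigma> i)" using ix less_B_trans by blast
    have "\<not> leq_B (\<sigma> i) i" using lt unfolding leq_B_def by (metis less_B_irrefl less_B_trans)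
    then have "\<forall>c\<in>B. \<not> (less_B i c \<and> less_B c (\<sigma> i))" "\<sigma> i \<in> B" using nB B unfolding next_in_def by blast+
    then have BC: "B \<noteq> C" using ix C by blast
    have \<sigma>x: "\<sigma> x \<in> C" using nC by (simp add: next_in_def)
    show "less_B i (\<sigma> x)" using tot[OF B(1) C(1) BC B(2) \<sigma>x] cross[OF C(1) B(1) BC[symmetric] \<sigma>x C(2) B(2) \<open>\<sigma> i \<in> B\<close>] ix by blast
    show "less_B (\<sigma> x) (\<sigma> i)" using tot[OF B(1) C(1) BC \<open>\<sigma> i \<in> B\<close> \<sigma>x] cross[OF B(1) C(1) BC B(2) \<open>\<sigma> i \<in> B\<close> C(2) \<sigma>x] ix by blast
  next
    fix i x assume ix: "i \<in> signed_range n" "x \<in> signed_range n" "leq_B (\<sigma> i) x" "less_B x i"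
    obtain B C where B: "B \<in> P" "i \<in> B" and C: "C \<in> P" "x \<in> C" using U ix by blast
    note nB = nx[OF B] and nC = nx[OF C]
    have lt: "less_B (\<sigma> i) i" using ix less_B_trans unfolding leq_B_def by blast
    have "\<not> less_B i (\<sigma> i)" using lt by (metis less_B_irrefl less_B_trans)
    then have minmax: "\<forall>c\<in>B. leq_B (\<sigma> i) c \<and> leq_B c i" and \<sigma>i: "\<sigma> i \<in> B" using nB unfolding next_in_def by blast+
    have \<sigma>x: "\<sigma> x \<in> C" using nC by (simp add: next_in_def)
    have neq: "\<sigma> x \<noteq> \<sigma> i" using sp_eq[OF \<sigma>, of x i] ix by auto
    show "less_B (\<sigma> i) (\<sigma> x)"
    proof (cases "B = C")
      case True
      then show ?thesis using minmax \<sigma>x neq unfolding leq_B_def by auto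
    next
      case False
      have "less_B (\<sigma> i) x" using ix(3) \<sigma>i C disj[OF B(1) C(1) False] unfolding leq_B_def by blast
      then show ?thesis using tot[OF B(1) C(1) False \<sigma>i \<sigma>x] cross[OF C(1) B(1) False[symmetric] \<sigma>x C(2) \<sigma>i B(2)] ix by blast
    qed
    show "leq_B (\<sigma> x) i"
    proof (cases "B = C")
      case True
      then show ?thesis using minmax \<sigma>x by simp
    next
      case False
      have "less_B (\<sigma> i) x" using ix(3) \<sigma>i C disj[OF B(1) C(1) False] unfolding leq_B_def by blast
      then show ?thesis using tot[OF B(1) C(1) False B(2) \<sigma>x] cross[OF B(1) C(1) False \<sigma>i B(2) C(2) \<sigma>x] ix unfolding leq_B_def by blast
    qed
  qed
qed

lemma orbit_invariant:
  assumes "x \<in> I" "\<And>y. y \<in> I \<Longrightarrow> f y \<in> I"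
  shows "orbit f x \<subseteq> I"
proof
  fix y assume "y \<in> orbit f x"
  then show "y \<in> I" by induction (use assms in auto)
qed

text \<open>The partition consists of the orbits. By the order conditions the elements strictly between \<open>i\<close> and
\<open>\<sigma> i\<close> form an invariant set, which therefore contains every orbit that it meets. Hence \<open>\<sigma> i\<close> is the
successor of \<open>i\<close> in its orbit, and no other orbit leaves the gap between them.\<close>

lemma nc_order_subset_NC_B: "nc_order n \<subseteq> NC_B n"
proof
  fix \<sigma> assume nc: "\<sigma> \<in> nc_order n"
  then have \<sigma>: "\<sigma> \<in> signed_perms n" by (simp add: nc_order_def)
  have up: "less_B i (\<sigma> x)" "less_B (\<sigma> x) (\<sigma> i)"
    if "i \<in> signed_range n" "x \<in> signed_range n" "less_B i x" "less_B x (\<sigma> i)" for i x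
    using nc that unfolding nc_order_def by blast+
  have down: "less_B (\<sigma> i) (\<sigma> x)" "leq_B (\<sigma> x) i"
    if "i \<in> signed_range n" "x \<in> signed_range n" "leq_B (\<sigma> i) x" "less_B x i" for i x
    using nc that unfolding nc_order_def by blast+
  let ?R = "signed_range n"
  have R: "\<sigma> x \<in> ?R \<longleftrightarrow> x \<in> ?R" for x by (rule sp_range[OF \<sigma>])
  have perm: "permutation \<sigma>"
    using \<sigma> permutation_permutes finite_signed_range unfolding signed_perms_def by blast
  let ?O = "orbit \<sigma>"
  have self: "x \<in> ?O x" for x by (rule permutation_self_in_orbit[OF perm])
  have eq: "?O y = ?O x" if "y \<in> ?O x" for x y
    by (rule orbit_cyclic_eq3[OF cyclic_on_orbit'[OF perm] that])
  have step: "\<sigma> y \<in> ?O x" if "y \<in> ?O x" for x y using that by (rule orbit.step)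
  have OR: "?O x \<subseteq> ?R" if "x \<in> ?R" for x by (rule orbit_invariant) (use that R in auto)
  have inside: "?O b \<subseteq> {x \<in> ?R. less_B a x \<and> less_B x (\<sigma> a)}"
    if "a \<in> ?R" "b \<in> ?R" "less_B a b" "less_B b (\<sigma> a)" for a b
    by (rule orbit_invariant) (use that up[OF that(1)] R in auto)
  have next': "next_in (?O x) a (\<sigma> a)" if x: "x \<in> ?R" and a: "a \<in> ?O x" for x a
  proof -
    have aR: "a \<in> ?R" using OR[OF x] a by blast
    then have nz: "a \<noteq> 0" "\<sigma> a \<noteq> 0" using R[of a] by (auto simp: mem_signed_range)
    show ?thesis
    proof (cases "less_B a (\<sigma> a)")
      case True
      have "\<not> (less_B a b \<and> less_B b (\<sigma> a))" if b: "b \<in> ?O x" for b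
      proof
        assume h: "less_B a b \<and> less_B b (\<sigma> a)"
        have "b \<in> ?R" using OR[OF x] b by blast
        then have "?O b \<subseteq> {x. less_B a x}" using inside[OF aR] h by blast
        moreover have "a \<in> ?O b" using a eq[OF b] by simp
        ultimately show False by auto
      qed
      then show ?thesis using True a step[OF a] unfolding next_in_def by blast
    next
      case False
      have "?O a \<subseteq> {y \<in> ?R. leq_B (\<sigma> a) y \<and> leq_B y a}"
      proof (rule orbit_invariant)
        show "a \<in> {y \<in> ?R. leq_B (\<sigma> a) y \<and> leq_B y a}"
          using aR False less_B_total[OF nz] by (cases "\<sigma> a = a") (auto simp: leq_B_def)
      next
        fix y assume y: "y \<in> {y \<in> ?R. leq_B (\<sigma> a) y \<and> leq_B y a}"
        show "\<sigma> y \<in> {y \<in> ?R. leq_B (\<sigma> a) y \<and> leq_B y a}"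
        proof (cases "y = a")
          case True
          then show ?thesis using y R by (auto simp: leq_B_def)
        next
          case False
          then have "less_B y a" using y by (simp add: leq_B_def)
          then show ?thesis using y down[OF aR, of y] R by (auto simp: leq_B_def)
        qed
      qed
      then show ?thesis using a step[OF a] eq[OF a] unfolding next_in_def by blast
    qed
  qed
  define P where "P = ?O ` ?R"
  have UP: "\<Union>P = ?R" unfolding P_def using OR self by blast
  have part: "partition_on ?R P"
  proof (rule partition_onI[OF UP])
    show "disjnt p q" if pq: "p \<in> P" "q \<in> P" "p \<noteq> q" for p q
    proof (rule ccontr)
      assume "\<not> disjnt p q"
      then obtain z where "z \<in> p" "z \<in> q" by (auto simp: disjnt_def)
      moreover obtain x y where "p = ?O x" "q = ?O y" using pq unfolding P_def by blast
      ultimately show False using eq[of z x] eq[of z y] pq by simp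
    qed
    show "{} \<notin> P" using self unfolding P_def by blast
  qed
  have mO: "uminus ` ?O x = ?O (- x)" for x
    by (rule orbit_inverse[OF self]) (simp add: sp_minus[OF \<sigma>])
  have sym: "B \<in> P \<longleftrightarrow> uminus ` B \<in> P" for B
  proof -
    have 1: "uminus ` B \<in> P" if "B \<in> P" for B
    proof -
      obtain x where x: "x \<in> ?R" "B = ?O x" using \<open>B \<in> P\<close> unfolding P_def by blast
      then have "- x \<in> ?R" by (simp add: mem_signed_range)
      then show ?thesis unfolding P_def x(2) mO by blast
    qed
    have "uminus ` uminus ` B = B" by (simp add: image_image)
    then show ?thesis using 1[of B] 1[of "uminus ` B"] by auto
  qed
  have "noncrossing less_B P" unfolding noncrossing_def
  proof (intro notI, elim exE bexE conjE)
    fix a b c d B C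
    assume lt: "less_B a b" "less_B b c" "less_B c d" and BC: "B \<in> P" "C \<in> P" "B \<noteq> C" "a \<in> B" "c \<in> B" "b \<in> C" "d \<in> C"
    have BO: "B = ?O a" "C = ?O b" using BC eq unfolding P_def by blast+
    have inR: "a \<in> ?R" "b \<in> ?R" using BC UP by blast+
    have BR: "B \<subseteq> ?R" using BC UP by blast
    \<comment> \<open>the block B passes over b in some step from x to its image\<close>
    have "\<exists>x\<in>B. less_B x b \<and> \<not> less_B (\<sigma> x) b"
    proof (rule ccontr)
      assume h: "\<not> (\<exists>x\<in>B. less_B x b \<and> \<not> less_B (\<sigma> x) b)"
      have "?O a \<subseteq> {x \<in> B. less_B x b}"
        by (rule orbit_invariant) (use h lt BC step[of _ a] BO in auto)
      then have "less_B c b" using BO BC by blast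
      then show False using lt less_B_trans less_B_irrefl by blast
    qed
    then obtain x where x: "x \<in> B" "less_B x b" "\<not> less_B (\<sigma> x) b" by blast
    have \<sigma>xB: "\<sigma> x \<in> B" using step[of x a] x BO by simp
    have "\<sigma> x \<noteq> b" using \<sigma>xB BC BO eq[of b a] by auto
    moreover have "\<sigma> x \<noteq> 0" "b \<noteq> 0" using \<sigma>xB BR inR by (auto simp: mem_signed_range)
    ultimately have bx: "less_B b (\<sigma> x)" using x(3) less_B_total by blast
    have xR: "x \<in> ?R" using x BR by blast
    have "less_B d (\<sigma> x)" using inside[OF xR inR(2) x(2) bx] BC BO by blast
    then have "less_B c (\<sigma> x)" using lt less_B_trans by blast
    moreover have "less_B x c" using x lt less_B_trans by blast
    moreover have "c \<in> ?R" using BC BR by blast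
    ultimately have "?O c \<subseteq> {y. less_B x y}" using inside[OF xR] by blast
    moreover have "x \<in> ?O c" using x eq[of c a] BC BO by simp
    ultimately show False by auto
  qed
  moreover have "cycles_of_blocks P \<sigma>"
    using cycles_of_blocks_iff[of P n \<sigma>] UP next' unfolding P_def by auto
  ultimately show "\<sigma> \<in> NC_B n"
    unfolding NC_B_def partition_B_def using \<sigma> part sym by blast
qed

lemma NC_B_eq: "NC_B n = nc_order n"
  using NC_B_subset_nc_order nc_order_subset_NC_B by blast

section \<open>Reversing the negative entries\<close>

text \<open>The position at which the reversed one-line notation finds its entry, where \<open>ps\<close> are the positions
of the negative entries.\<close>

definition partner :: "int list \<Rightarrow> int \<Rightarrow> int" where
  "partner ps i = (case map_of (zip ps (rev ps)) i of None \<Rightarrow> i | Some j \<Rightarrow> j)"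

lemma partner_nth:
  assumes "distinct ps" "k < length ps"
  shows "partner ps (ps ! k) = ps ! (length ps - Suc k)"
proof -
  have "map_of (zip ps (rev ps)) (ps ! k) = Some (rev ps ! k)"
    using assms by (intro map_of_zip_nth) auto
  then show ?thesis using assms by (simp add: partner_def rev_nth)
qed

lemma partner_other: "i \<notin> set ps \<Longrightarrow> partner ps i = i"
  by (simp add: partner_def map_of_zip_is_None split: option.split)
    (metis in_set_zipE map_of_SomeD)

lemma partner_in:
  assumes "distinct ps" "i \<in> set ps"
  shows "partner ps i \<in> set ps" "partner ps (partner ps i) = i"
proof -
  obtain k where k: "k < length ps" "i = ps ! k" using assms(2) by (metis in_set_conv_nth)
  have "length ps - Suc k < length ps" using k by simp
  then show "partner ps i \<in> set ps" "partner ps (partner ps i) = i"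
    using k partner_nth[OF assms(1)] by (simp_all add: Suc_diff_Suc)
qed

lemma partner_antimono:
  assumes "sorted_wrt (<) ps" "i \<in> set ps" "j \<in> set ps" "i < j"
  shows "partner ps j < partner ps i"
proof -
  have d: "distinct ps" using assms(1) by (simp add: strict_sorted_iff)
  obtain k where k: "k < length ps" "i = ps ! k" using assms(2) by (metis in_set_conv_nth)
  obtain l where l: "l < length ps" "j = ps ! l" using assms(3) by (metis in_set_conv_nth)
  have "k < l"
  proof (rule ccontr)
    assume "\<not> k < l"
    then have "j \<le> i" using k l sorted_wrt_nth_less[OF assms(1), of l k] by (cases "k = l") auto
    then show False using assms(4) by simp
  qed
  then have "ps ! (length ps - Suc l) < ps ! (length ps - Suc k)"
    using k l by (intro sorted_wrt_nth_less[OF assms(1)]) auto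
  then show ?thesis using k l partner_nth[OF d] by simp
qed

lemma set_neg_positions: "set (neg_positions n \<sigma>) = {i. 0 < i \<and> i \<le> int n \<and> \<sigma> i < 0}"
  by (auto simp: neg_positions_def)

lemma sorted_neg_positions: "sorted_wrt (<) (neg_positions n \<sigma>)"
proof -
  have "sorted_wrt (<) [1..int n]" by (simp add: sorted_wrt_iff_nth_less)
  then show ?thesis unfolding neg_positions_def by (rule sorted_wrt_filter)
qed

lemma distinct_neg_positions: "distinct (neg_positions n \<sigma>)"
  using sorted_neg_positions[of n \<sigma>] by (simp add: strict_sorted_iff)

lemma rev_B_pos: "0 \<le> x \<Longrightarrow> rev_B n \<sigma> x = \<sigma> (partner (neg_positions n \<sigma>) x)"
proof -
  have "zip ps (map f ys) = map (\<lambda>(a, b). (a, f b)) (zip ps ys)" for ps :: "int list" and f :: "int \<Rightarrow> int" and ys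
    by (rule zip_map2)
  then have "map_of (zip ps (map f ys)) = map_option f \<circ> map_of (zip ps ys)" for ps :: "int list" and f :: "int \<Rightarrow> int" and ys
    by (simp add: map_of_map)
  then show "0 \<le> x \<Longrightarrow> rev_B n \<sigma> x = \<sigma> (partner (neg_positions n \<sigma>) x)"
    by (cases "map_of (zip (neg_positions n \<sigma>) (rev (neg_positions n \<sigma>))) x")
      (simp_all add: rev_B_def rev_one_line_def partner_def del: map_of_zip_is_None)
qed

text \<open>Reversal composes the signed permutation with an involution of the positions.\<close>

lemma rev_B_signed_perms:
  assumes \<sigma>: "\<sigma> \<in> signed_perms n"
  shows "rev_B n \<sigma> \<in> signed_perms n"
proof -
  let ?ps = "neg_positions n \<sigma>"
  define \<pi> where "\<pi> x = (if x < 0 then - partner ?ps (- x) else partner ?ps x)" for x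
  have pos: "0 < partner ?ps x" if "0 < x" for x
    using partner_other[of x ?ps] partner_in(1)[OF distinct_neg_positions, of x n \<sigma>] that
    by (cases "x \<in> set ?ps") (auto simp: set_neg_positions)
  have p0: "partner ?ps 0 = 0" by (rule partner_other) (simp add: set_neg_positions)
  have inv: "partner ?ps (partner ?ps x) = x" for x
    using partner_other[of x ?ps] partner_in(2)[OF distinct_neg_positions, of x n \<sigma>] by (cases "x \<in> set ?ps") auto
  have "\<pi> \<in> signed_perms n"
  proof (rule signed_permsI[of \<pi>])
    show "\<pi> (\<pi> x) = x" for x using pos[of x] pos[of "- x"] p0 inv[of x] inv[of "- x"]
      by (cases x "0 :: int" rule: linorder_cases) (auto simp: \<pi>_def)
    then show "\<pi> (\<pi> x) = x" for x .
    show "\<pi> (- x) = - \<pi> x" for x using p0 by (simp add: \<pi>_def)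
    show "\<pi> x = x" if "int n < x" for x
      using that partner_other[of x ?ps] by (simp add: \<pi>_def set_neg_positions)
  qed
  moreover have "rev_B n \<sigma> = \<sigma> \<circ> \<pi>"
  proof
    fix x show "rev_B n \<sigma> x = (\<sigma> \<circ> \<pi>) x"
    proof (cases "x < 0")
      case True
      then have "rev_B n \<sigma> x = - rev_B n \<sigma> (- x)" by (simp add: rev_B_def)
      then show ?thesis using True rev_B_pos[of "- x" n \<sigma>] sp_minus[OF \<sigma>] by (simp add: \<pi>_def)
    next
      case False
      then show ?thesis using rev_B_pos[of x n \<sigma>] by (simp add: \<pi>_def)
    qed
  qed
  ultimately show ?thesis using comp_signed_perms[OF \<sigma>] by simp
qed

lemma rev_B_nonneg_entry: "0 < x \<Longrightarrow> 0 \<le> \<sigma> x \<Longrightarrow> rev_B n \<sigma> x = \<sigma> x"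
  using rev_B_pos[of x n \<sigma>] partner_other[of x "neg_positions n \<sigma>"] by (simp add: set_neg_positions)

lemma rev_B_neg_entry:
  assumes "\<sigma> \<in> signed_perms n" "0 < x" "\<sigma> x < 0"
  shows "rev_B n \<sigma> x < 0" "x \<in> set (neg_positions n \<sigma>)"
proof -
  have "x \<le> int n" using sp_fix[OF assms(1), of x] assms(2,3) by (cases "x \<le> int n") auto
  then show x: "x \<in> set (neg_positions n \<sigma>)" using assms by (simp add: set_neg_positions)
  have "partner (neg_positions n \<sigma>) x \<in> set (neg_positions n \<sigma>)"
    by (rule partner_in(1)[OF distinct_neg_positions x])
  then show "rev_B n \<sigma> x < 0" using rev_B_pos[of x n \<sigma>] assms(2) by (simp add: set_neg_positions)
qed

lemma rev_B_sign: "\<sigma> \<in> signed_perms n \<Longrightarrow> 0 < x \<Longrightarrow> rev_B n \<sigma> x < 0 \<longleftrightarrow> \<sigma> x < 0"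
  using rev_B_neg_entry(1)[of \<sigma> n x] rev_B_nonneg_entry[of x \<sigma> n] by linarith

text \<open>For a negative entry at position \<open>u\<close> the block of \<open>- u\<close> continues among the positive numbers; so \<open>- v\<close>
lies between \<open>- u\<close> and its image.\<close>

lemma nc_order_neg_increasing:
  assumes nc: "\<sigma> \<in> nc_order n" and uv: "0 < u" "u < v" "\<sigma> u < 0" "\<sigma> v < 0"
  shows "\<sigma> u < \<sigma> v"
proof -
  have \<sigma>: "\<sigma> \<in> signed_perms n" using nc by (simp add: nc_order_def)
  have "v \<le> int n" using sp_fix[OF \<sigma>, of v] uv by (cases "v \<le> int n") auto
  then have "- u \<in> signed_range n" "- v \<in> signed_range n" using uv by (auto simp: mem_signed_range)
  moreover have "less_B (- u) (- v)" "less_B (- v) (\<sigma> (- u))" using uv by (auto simp: less_B_def sp_minus[OF \<sigma>])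
  ultimately have "less_B (\<sigma> (- v)) (\<sigma> (- u))" using nc unfolding nc_order_def by blast
  then show ?thesis using uv by (auto simp: less_B_def sp_minus[OF \<sigma>])
qed

lemma rev_B_neg_decreasing:
  assumes nc: "\<sigma> \<in> nc_order n" and uv: "0 < u" "u < v" "\<sigma> u < 0" "\<sigma> v < 0"
  shows "rev_B n \<sigma> v < rev_B n \<sigma> u"
proof -
  let ?ps = "neg_positions n \<sigma>"
  have \<sigma>: "\<sigma> \<in> signed_perms n" using nc by (simp add: nc_order_def)
  have m: "u \<in> set ?ps" "v \<in> set ?ps" using rev_B_neg_entry(2)[OF \<sigma>] uv by auto
  have "partner ?ps v < partner ?ps u" by (rule partner_antimono[OF sorted_neg_positions m uv(2)])
  then have "\<sigma> (partner ?ps v) < \<sigma> (partner ?ps u)"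
    using m[THEN partner_in(1)[OF distinct_neg_positions]] by (intro nc_order_neg_increasing[OF nc]) (auto simp: set_neg_positions)
  then show ?thesis using rev_B_pos[of u n \<sigma>] rev_B_pos[of v n \<sigma>] uv by simp
qed

text \<open>The first two conditions of \<open>nested\<close> concern positive entries, and these are kept by the reversal.
In the condition on the inverse one uses that a permutation maps a finite set onto itself if it maps
it into itself.\<close>

lemma rev_B_nc_order_nested:
  assumes nc: "\<nu> \<in> nc_order n"
  shows "rev_B n \<nu> \<in> nested n"
proof -
  have \<nu>: "\<nu> \<in> signed_perms n" using nc by (simp add: nc_order_def)
  define \<rho> where "\<rho> = rev_B n \<nu>"
  have \<rho>: "\<rho> \<in> signed_perms n" unfolding \<rho>_def by (rule rev_B_signed_perms[OF \<nu>])
  have neg: "\<rho> x < 0 \<longleftrightarrow> \<nu> x < 0" if "0 < x" for x unfolding \<rho>_def by (rule rev_B_sign[OF \<nu> that])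
  have pos: "\<rho> x = \<nu> x" if "0 < x" "0 < \<rho> x \<or> 0 < \<nu> x" for x
    using neg[of x] rev_B_nonneg_entry[of x \<nu> n] that by (simp add: \<rho>_def) linarith
  have up: "less_B i (\<nu> x) \<and> less_B (\<nu> x) (\<nu> i)"
    if "i \<in> signed_range n" "x \<in> signed_range n" "less_B i x" "less_B x (\<nu> i)" for i x
    using nc that unfolding nc_order_def by blast
  have down: "less_B (\<nu> i) (\<nu> x)"
    if "i \<in> signed_range n" "x \<in> signed_range n" "leq_B (\<nu> i) x" "less_B x i" for i x
    using nc that unfolding nc_order_def by blast
  have "\<rho> u < \<rho> v" if h: "0 < \<rho> u" "\<rho> u \<le> v" "v < u" for u v
  proof -
    have u: "0 < u" "0 < v" "\<rho> u = \<nu> u" using h pos[of u] by auto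
    have "u \<le> int n" using sp_fix[OF \<rho>, of u] h by (cases "u \<le> int n") auto
    then have "less_B (\<nu> u) (\<nu> v)"
      using h u by (intro down) (auto simp: mem_signed_range leq_B_def less_B_def)
    then have "\<nu> u < \<nu> v" using h u by (auto simp: less_B_def)
    then show ?thesis using pos[of v] u h by simp
  qed
  moreover have "inv \<rho> u < inv \<rho> v" if h: "0 < inv \<rho> u" "inv \<rho> u < v" "v < u" for u v
  proof -
    let ?x = "inv \<rho> u"
    have \<rho>x: "\<rho> ?x = u" by (rule sp_inv_apply(2)[OF \<rho>])
    then have \<nu>x: "\<nu> ?x = u" using pos[of ?x] h by simp
    have "u \<le> int n" using sp_fix[OF sp_inv[OF \<rho>], of u] h by (cases "u \<le> int n") auto
    let ?I = "{y. ?x < y \<and> y < u}"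
    have "\<nu> y \<in> ?I" if y: "y \<in> ?I" for y
    proof -
      have "less_B ?x (\<nu> y) \<and> less_B (\<nu> y) (\<nu> ?x)"
        using h y \<nu>x \<open>u \<le> int n\<close> by (intro up) (auto simp: mem_signed_range less_B_def)
      then show ?thesis using h \<nu>x by (auto simp: less_B_def)
    qed
    then have "\<nu> ` ?I \<subseteq> ?I" by blast
    moreover have "finite ?I" by (rule finite_subset[of _ "{?x..u}"]) auto
    moreover have "inj_on \<nu> ?I" using sp_eq[OF \<nu>] by (auto simp: inj_on_def)
    ultimately have "\<nu> ` ?I = ?I" by (intro endo_inj_surj)
    then obtain y where y: "y \<in> ?I" "\<nu> y = v" using h by (metis (mono_tags, lifting) imageE mem_Collect_eq)
    then have "\<rho> y = v" using pos[of y] h by simp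
    then have "inv \<rho> v = y" by (rule inv_eqI[OF \<rho>])
    then show ?thesis using y by simp
  qed
  moreover have "\<rho> v < \<rho> u" if h: "0 < u" "u < v" "\<rho> u < 0" "\<rho> v < 0" for u v
    unfolding \<rho>_def using h neg by (intro rev_B_neg_decreasing[OF nc]) auto
  ultimately show ?thesis using \<rho> by (simp add: nested_def \<rho>_def)
qed

lemma less_B_skip [simp]: "less_B (skip p a) (skip p b) \<longleftrightarrow> less_B a b"
  by (auto simp: less_B_def)

lemma skip_mixed:
  assumes "p \<le> q" "q \<le> Suc p"
  shows "less_B (skip p x) (skip q v) \<longleftrightarrow> less_B x v"
    and "leq_B (skip q v) (skip p x) \<longleftrightarrow> leq_B v x"
  using assms by (auto simp: less_B_def leq_B_def skip_def)

text \<open>Inserting a fixed point, or a new element next to an element of its block, creates no crossing.\<close>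

lemma insert_entry_nc_order:
  assumes nc: "\<nu> \<in> nc_order n" and pq: "p \<le> n" "q \<le> n" "p \<le> q" "q \<le> Suc p"
  shows "insert_entry p q \<nu> \<in> nc_order (Suc n)"
proof -
  define \<rho> where "\<rho> = insert_entry p q \<nu>"
  have \<nu>: "\<nu> \<in> signed_perms n" using nc by (simp add: nc_order_def)
  have \<rho>: "\<rho> \<in> signed_perms (Suc n)" unfolding \<rho>_def by (rule insert_entry_signed_perms[OF \<nu> pq(1,2)])
  have up: "less_B i (\<nu> x) \<and> less_B (\<nu> x) (\<nu> i)"
    if "i \<in> signed_range n" "x \<in> signed_range n" "less_B i x" "less_B x (\<nu> i)" for i x
    using nc that unfolding nc_order_def by blast
  have down: "less_B (\<nu> i) (\<nu> x) \<and> leq_B (\<nu> x) i"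
    if "i \<in> signed_range n" "x \<in> signed_range n" "leq_B (\<nu> i) x" "less_B x i" for i x
    using nc that unfolding nc_order_def by blast
  note m = skip_mixed[OF pq(3,4)]
  note r = skip_signed_range[OF pq(1)]
  have "(less_B i x \<and> less_B x (\<rho> i) \<longrightarrow> less_B i (\<rho> x) \<and> less_B (\<rho> x) (\<rho> i)) \<and>
     (leq_B (\<rho> i) x \<and> less_B x i \<longrightarrow> less_B (\<rho> i) (\<rho> x) \<and> leq_B (\<rho> x) i)"
    if i: "i \<in> signed_range (Suc n)" and x: "x \<in> signed_range (Suc n)" for i x
  proof (cases i rule: skip_cases[of _ p])
    case at
    then show ?thesis using pq by (auto simp: \<rho>_def less_B_def leq_B_def)
  next
    case minus_at
    then show ?thesis using pq by (auto simp: \<rho>_def less_B_def leq_B_def)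
  next
    case s: (skip i')
    then have \<rho>i: "\<rho> i = skip q (\<nu> i')" by (simp add: \<rho>_def)
    obtain w where w: "\<rho> i = w" "w \<noteq> int q + 1" "w \<noteq> - int q - 1" unfolding \<rho>i using skip_neq by blast
    have i': "i \<noteq> int p + 1" "i \<noteq> - int p - 1" unfolding s by simp_all
    show ?thesis
    proof (cases x rule: skip_cases[of _ p])
      case at
      then have "\<rho> x = int q + 1" by (simp add: \<rho>_def)
      then show ?thesis unfolding w(1) at using pq w(2,3) i' by (auto simp: less_B_def leq_B_def)
    next
      case minus_at
      then have "\<rho> x = - int q - 1" by (simp add: \<rho>_def)
      then show ?thesis unfolding w(1) minus_at using pq w(2,3) i' by (auto simp: less_B_def leq_B_def)
    next
      case (skip x')
      then have "\<rho> x = skip q (\<nu> x')" by (simp add: \<rho>_def)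
      then show ?thesis using up[of i' x'] down[of i' x'] i x \<rho>i unfolding s skip r by (simp add: m)
    qed
  qed
  then show ?thesis unfolding nc_order_def using \<rho> by (simp add: \<rho>_def)
qed

lemma neg_positions_insert_entry:
  assumes "\<nu> \<in> signed_perms n" "p \<le> n"
  shows "neg_positions (Suc n) (insert_entry p q \<nu>) = map (skip p) (neg_positions n \<nu>)"
proof (rule sorted_distinct_set_unique)
  show "set (neg_positions (Suc n) (insert_entry p q \<nu>)) = set (map (skip p) (neg_positions n \<nu>))"
  proof (intro set_eqI iffI)
    fix x assume "x \<in> set (neg_positions (Suc n) (insert_entry p q \<nu>))"
    then have x: "0 < x" "x \<le> int (Suc n)" "insert_entry p q \<nu> x < 0" by (auto simp: set_neg_positions)
    show "x \<in> set (map (skip p) (neg_positions n \<nu>))"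
    proof (cases x rule: skip_cases[of _ p])
      case (skip y)
      then have "0 < y" "y \<le> int n" "\<nu> y < 0" using x skip_le_iff[OF assms(2), of y] by auto
      then show ?thesis by (simp add: set_neg_positions skip)
    qed (use x in auto)
  next
    fix x assume "x \<in> set (map (skip p) (neg_positions n \<nu>))"
    then obtain y where y: "x = skip p y" "0 < y" "y \<le> int n" "\<nu> y < 0" by (auto simp: set_neg_positions)
    then show "x \<in> set (neg_positions (Suc n) (insert_entry p q \<nu>))"
      using skip_le_iff[OF assms(2), of y] by (simp add: set_neg_positions)
  qed
  show "sorted (neg_positions (Suc n) (insert_entry p q \<nu>))" "distinct (neg_positions (Suc n) (insert_entry p q \<nu>))"
    using sorted_neg_positions[of "Suc n" "insert_entry p q \<nu>"] by (simp_all add: strict_sorted_iff)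
  have "sorted_wrt (<) (map (skip p) (neg_positions n \<nu>))" using sorted_neg_positions[of n \<nu>] by (simp add: sorted_wrt_map)
  then show "sorted (map (skip p) (neg_positions n \<nu>))" "distinct (map (skip p) (neg_positions n \<nu>))"
    by (simp_all add: strict_sorted_iff)
qed

lemma partner_map_skip:
  assumes "distinct ps"
  shows "partner (map (skip p) ps) (skip p y) = skip p (partner ps y)"
proof (cases "y \<in> set ps")
  case True
  then obtain k where k: "k < length ps" "y = ps ! k" by (metis in_set_conv_nth)
  have "distinct (map (skip p) ps)" using assms by (simp add: distinct_map inj_on_def)
  then have "partner (map (skip p) ps) (map (skip p) ps ! k) = map (skip p) ps ! (length (map (skip p) ps) - Suc k)"
    using k by (intro partner_nth) simp_all
  then show ?thesis using k partner_nth[OF assms k(1)] by simp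
next
  case False
  then have "skip p y \<notin> set (map (skip p) ps)" by auto
  then show ?thesis using False by (simp only: partner_other not_False_eq_True)
qed

text \<open>The new entry is positive, so the insertion only shifts the positions of the negative entries.\<close>

lemma rev_B_insert_entry:
  assumes \<nu>: "\<nu> \<in> signed_perms n" and pq: "p \<le> n" "q \<le> n"
  shows "rev_B (Suc n) (insert_entry p q \<nu>) = insert_entry p q (rev_B n \<nu>)"
proof (rule signed_perms_eqI)
  show "rev_B (Suc n) (insert_entry p q \<nu>) \<in> signed_perms (Suc n)"
    by (intro rev_B_signed_perms insert_entry_signed_perms \<nu> pq)
  show "insert_entry p q (rev_B n \<nu>) \<in> signed_perms (Suc n)"
    by (intro rev_B_signed_perms insert_entry_signed_perms \<nu> pq)
  fix x :: int assume x: "0 < x"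
  show "rev_B (Suc n) (insert_entry p q \<nu>) x = insert_entry p q (rev_B n \<nu>) x"
  proof (cases x rule: skip_cases[of _ p])
    case at
    then show ?thesis using rev_B_nonneg_entry[of x "insert_entry p q \<nu>" "Suc n"] by simp
  next
    case minus_at
    then show ?thesis using x by simp
  next
    case (skip y)
    then have y: "0 < y" using x by simp
    have "rev_B (Suc n) (insert_entry p q \<nu>) x =
        insert_entry p q \<nu> (partner (map (skip p) (neg_positions n \<nu>)) (skip p y))"
      using rev_B_pos[of x "Suc n" "insert_entry p q \<nu>"] x neg_positions_insert_entry[OF \<nu> pq(1), of q] skip by simp
    also have "\<dots> = skip q (\<nu> (partner (neg_positions n \<nu>) y))"
      by (simp add: partner_map_skip[OF distinct_neg_positions])
    also have "\<dots> = skip q (rev_B n \<nu> y)" using rev_B_pos[of y n \<nu>] y by simp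
    finally show ?thesis by (simp add: skip)
  qed
qed

text \<open>The witness \<open>[-n, \<dots>, -1]\<close> exchanges opposite places of the order \<open>-1 < \<dots> < -n < 1 < \<dots> < n\<close>; its
blocks are the pairs \<open>{i, i - n - 1}\<close>, one nested in the other.\<close>

lemma flip_in_rev_nc_order: "flip n \<in> rev_B n ` nc_order n"
proof -
  define \<nu> where "\<nu> x = (if \<bar>x\<bar> \<le> int n then (if 0 < x then x - int n - 1 else if x < 0 then x + int n + 1 else 0) else x)" for x
  have \<nu>: "\<nu> \<in> signed_perms n" by (rule signed_permsI[of \<nu>]) (auto simp: \<nu>_def)
  have nc: "\<nu> \<in> nc_order n" unfolding nc_order_def
    using \<nu> by (auto simp: \<nu>_def less_B_def leq_B_def mem_signed_range)
  have neg: "\<nu> x < 0" if "0 < x" "x \<le> int n" for x using that by (simp add: \<nu>_def)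
  have "rev_B n \<nu> = flip n"
  proof (rule decreasing_negative_eq_flip[OF rev_B_signed_perms[OF \<nu>]])
    show "rev_B n \<nu> (x + 1) < rev_B n \<nu> x" if "0 < x" "x < int n" for x
      using rev_B_neg_decreasing[OF nc, of x "x + 1"] neg[of x] neg[of "x + 1"] that by simp
    show "rev_B n \<nu> 1 < 0" if "n > 0" using rev_B_sign[OF \<nu>, of 1] neg[of 1] that by simp
  qed
  then show ?thesis using nc by (metis imageI)
qed

text \<open>Every nested signed permutation arises by insertions from \<open>flip\<close>, and each of these insertions
can be made before the reversal.\<close>

lemma nested_subset: "nested n \<subseteq> rev_B n ` nc_order n"
proof (induction n)
  case 0
  then show ?case using flip_in_rev_nc_order[of 0] signed_perms_0 by (auto simp: nested_def)
next
  case (Suc n)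
  show ?case
  proof
    fix \<rho> assume "\<rho> \<in> nested (Suc n)"
    then consider "\<rho> = flip (Suc n)"
      | \<sigma> t where "\<sigma> \<in> nested n" "nested_lab n \<sigma> \<le> t" "t \<le> 2 * n" "\<rho> = nested_grow n t \<sigma>"
      using nested_cover by blast
    then show "\<rho> \<in> rev_B (Suc n) ` nc_order (Suc n)"
    proof cases
      case 1
      then show ?thesis using flip_in_rev_nc_order by simp
    next
      case 2
      then obtain \<nu> where \<nu>: "\<nu> \<in> nc_order n" "\<sigma> = rev_B n \<nu>" using Suc by blast
      let ?p = "t div 2" and ?q = "Suc t div 2"
      have pq: "?p \<le> n" "?q \<le> n" "?p \<le> ?q" "?q \<le> Suc ?p" using insertion_bounds[OF 2(1-3) refl refl] by simp_all
      have "\<nu> \<in> signed_perms n" using \<nu> by (simp add: nc_order_def)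
      then have "\<rho> = rev_B (Suc n) (insert_entry ?p ?q \<nu>)"
        using 2(4) \<nu>(2) pq by (simp add: nested_grow_def rev_B_insert_entry)
      then show ?thesis using insert_entry_nc_order[OF \<nu>(1) pq] by blast
    qed
  qed
qed

theorem rev_NC_B_eq: "rev_B n ` NC_B n = nested n"
  unfolding NC_B_eq using rev_B_nc_order_nested nested_subset by blast

section \<open>The bijections\<close>

lemma neg_le: "neg n \<sigma> \<le> n"
  unfolding neg_def by (rule order_trans[OF card_mono[of "{1..n}"]]) auto

theorem theorem1p3:
  fixes n :: nat
  assumes "n \<ge> 1"
  shows "\<exists>\<phi> \<psi>.
    bij_betw \<phi> (dyck_paths n) (rev_B n ` NC_B n) \<and>
    bij_betw \<psi> (dyck_paths n) (Sort_B n) \<and>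
    (\<forall>D\<in>dyck_paths n.
       area n D = inv_B n (\<phi> D) \<and>
       area n D = inv_B n (\<psi> D) \<and>
       2 * (int n)\<^sup>2 - int (path_fmaj n D) = int (fmaj n (\<phi> D)) + int (ifmaj n (\<phi> D)) \<and>
       2 * (int n)\<^sup>2 - int (path_fmaj n D) = int (fmaj n (\<psi> D)) + int (ifmaj n (\<psi> D)))"
proof -
  obtain \<phi> where \<phi>: "bij_betw \<phi> (dyck_paths n) (nested n)"
    and \<phi>_stats: "\<forall>D\<in>dyck_paths n. nested_lab n (\<phi> D) = path_lab n D \<and> inv_B n (\<phi> D) = area n D \<and>
      total_ascents n (\<phi> D) = (\<Sum>i\<in>path_fDes n D. 2 * n - i) \<and> n - neg n (\<phi> D) = path_neg D"
    using growth_families_equidistributed[OF path_growth_family nested_growth_family] by blast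
  obtain \<theta> where \<theta>: "bij_betw \<theta> (dyck_paths n) (avoiding n)"
    and \<theta>_stats: "\<forall>D\<in>dyck_paths n. avoiding_lab n (\<theta> D) = path_lab n D \<and> inv_B n (\<theta> D) = area n D \<and>
      total_ascents n (\<theta> D) = (\<Sum>i\<in>path_fDes n D. 2 * n - i) \<and> n - neg n (\<theta> D) = path_neg D"
    using growth_families_equidistributed[OF path_growth_family avoiding_growth_family] by blast
  have fmaj: "2 * (int n)\<^sup>2 - int (path_fmaj n D) = int (fmaj n \<sigma>) + int (ifmaj n \<sigma>)"
    if \<sigma>: "\<sigma> \<in> signed_perms n" and st: "total_ascents n \<sigma> = (\<Sum>i\<in>path_fDes n D. 2 * n - i)" "n - neg n \<sigma> = path_neg D" for \<sigma> D
  proof -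
    have "int (path_neg D) = int n - int (neg n \<sigma>)" using st(2) neg_le[of n \<sigma>] by linarith
    moreover have "int (path_fmaj n D) = 2 * int (path_neg D) + 2 * int (total_ascents n \<sigma>)"
      using st(1) by (simp add: path_fmaj_def)
    ultimately show ?thesis unfolding fmaj_plus_ifmaj[OF \<sigma>] by (simp add: power2_eq_square algebra_simps)
  qed
  have inj: "inj_on inv (avoiding n)"
    by (rule inj_on_inverseI[of _ inv]) (auto simp: avoiding_def sp_inv_inv)
  have \<psi>: "bij_betw (inv \<circ> \<theta>) (dyck_paths n) (Sort_B n)"
    unfolding Sort_B_eq by (rule bij_betw_trans[OF \<theta> inj_on_imp_bij_betw[OF inj]])
  show ?thesis
  proof (intro exI conjI ballI)
    show "bij_betw \<phi> (dyck_paths n) (rev_B n ` NC_B n)" using \<phi> by (simp add: rev_NC_B_eq)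
    show "bij_betw (inv \<circ> \<theta>) (dyck_paths n) (Sort_B n)" by (rule \<psi>)
    fix D assume D: "D \<in> dyck_paths n"
    have \<phi>D: "\<phi> D \<in> signed_perms n" using \<phi> D by (auto simp: bij_betw_def nested_def)
    have \<theta>D: "\<theta> D \<in> signed_perms n" using \<theta> D by (auto simp: bij_betw_def avoiding_def)
    show "area n D = inv_B n (\<phi> D)" using \<phi>_stats D by simp
    show "area n D = inv_B n ((inv \<circ> \<theta>) D)" using \<theta>_stats D inv_B_inv[OF \<theta>D] by simp
    show "2 * (int n)\<^sup>2 - int (path_fmaj n D) = int (fmaj n (\<phi> D)) + int (ifmaj n (\<phi> D))"
      using fmaj[OF \<phi>D] \<phi>_stats D by simp
    show "2 * (int n)\<^sup>2 - int (path_fmaj n D) = int (fmaj n ((inv \<circ> \<theta>) D)) + int (ifmaj n ((inv \<circ> \<theta>) D))"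
      using fmaj[OF \<theta>D] \<theta>_stats D sp_inv_inv[OF \<theta>D] by (simp add: ifmaj_def)
  qed
qed

end
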